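(* Let $\varepsilon>0$. There exists a constant $A=A(\varepsilon)>0$ such that for every $\gamma<0$ there is $n_0=n_0(\gamma,\varepsilon)$ with $$\mathbb E\Big[\mathbf P_{\mathcal T}\big(A^{-1}\sqrt n\le \operatorname{diam}(\mathcal T)\le A\sqrt n\big)\Big]\ge 1-\varepsilon\qquad\text{for all } n\ge n_0,$$ where $\mathcal T$ is the weighted uniform spanning tree of $K_n$ with the random edge weights $\mathrm w(e)\in\{1,n^{1+\gamma}\}$.
   Context: Let $K_n$ be the complete graph on $n$ vertices and $\gamma\in\mathbb R$. The edges $e$ of $K_n$ receive independent random weights $\mathrm w(e)$, where $\mathrm w(e)=n^{1+\gamma}$ with probability $1/n$ and $\mathrm w(e)=1$ otherwise; $\mathbb E$ denotes expectation with respect to the weights. Given a realization of the weights, the weighted uniform spanning tree $\mathcal T$ is the random spanning tree of $K_n$ with law $\mathbf P_{\mathcal T}(\mathcal T=T)=\frac1{Z^{\mathrm w}}\prod_{e\in T}\mathrm w(e)$ for each spanning tree $T$ of $K_n$, where $Z^{\mathrm w}=\sum_{T}\prod_{e\in T}\mathrm w(e)$ (sum over all spanning trees). $\operatorname{diam}(\mathcal T)$ is the maximal graph distance between two vertices in $\mathcal T$. *)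

theory Defs
  imports "HOL-Probability.Probability"
begin

section \<open>Finite simple graphs\<close>

text \<open>A graph is given by its vertex set \<open>V\<close> and a set \<open>E\<close> of two-element subsets of \<open>V\<close>.\<close>

definition complete_edges :: "'a set \<Rightarrow> 'a set set" where
  "complete_edges V = {e. e \<subseteq> V \<and> card e = 2}"

definition walk :: "'a set \<Rightarrow> 'a set set \<Rightarrow> 'a list \<Rightarrow> bool" where
  "walk V E p \<longleftrightarrow> p \<noteq> [] \<and> set p \<subseteq> V \<and> successively (\<lambda>u v. {u, v} \<in> E) p"

text \<open>A cycle is listed without repeating its first vertex at the end.\<close>

definition graph_cycle :: "'a set \<Rightarrow> 'a set set \<Rightarrow> 'a list \<Rightarrow> bool" where
  "graph_cycle V E p \<longleftrightarrow>
     walk V E p \<and> distinct p \<and> length p \<ge> 3 \<and> {last p, hd p} \<in> E"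

definition connected_graph :: "'a set \<Rightarrow> 'a set set \<Rightarrow> bool" where
  "connected_graph V E \<longleftrightarrow>
     V \<noteq> {} \<and> (\<forall>u\<in>V. \<forall>v\<in>V. \<exists>p. walk V E p \<and> hd p = u \<and> last p = v)"

definition tree :: "'a set \<Rightarrow> 'a set set \<Rightarrow> bool" where
  "tree V E \<longleftrightarrow> connected_graph V E \<and> \<not> (\<exists>p. graph_cycle V E p)"

text \<open>A spanning tree of \<open>(V, E)\<close> is identified with its edge set.\<close>

definition spanning_trees :: "'a set \<Rightarrow> 'a set set \<Rightarrow> 'a set set set" where
  "spanning_trees V E = {T. T \<subseteq> E \<and> tree V T}"

text \<open>A walk with \<open>k\<close> edges visits \<open>k + 1\<close> vertices.  The distance is only meaningful if
  \<open>u\<close> and \<open>v\<close> are joined by a walk.\<close>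

definition graph_dist :: "'a set \<Rightarrow> 'a set set \<Rightarrow> 'a \<Rightarrow> 'a \<Rightarrow> nat" where
  "graph_dist V E u v =
     (LEAST k. \<exists>p. walk V E p \<and> hd p = u \<and> last p = v \<and> length p = k + 1)"

definition graph_diam :: "'a set \<Rightarrow> 'a set set \<Rightarrow> nat" where
  "graph_diam V E = Max {graph_dist V E u v | u v. u \<in> V \<and> v \<in> V}"


section \<open>The weighted uniform spanning tree\<close>

definition partition_function :: "'a set \<Rightarrow> 'a set set \<Rightarrow> ('a set \<Rightarrow> real) \<Rightarrow> real" where
  "partition_function V E w = (\<Sum>T\<in>spanning_trees V E. \<Prod>e\<in>T. w e)"

text \<open>That the function below is a probability mass function when the weights are positive
  and a spanning tree exists is shown in \<open>pmf_weighted_ust\<close>.\<close>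

definition weighted_ust :: "'a set \<Rightarrow> 'a set set \<Rightarrow> ('a set \<Rightarrow> real) \<Rightarrow> 'a set set pmf" where
  "weighted_ust V E w = embed_pmf (\<lambda>T.
     if T \<in> spanning_trees V E then (\<Prod>e\<in>T. w e) / partition_function V E w else 0)"

lemma pmf_weighted_ust:
  assumes "finite E" "spanning_trees V E \<noteq> {}" "\<And>e. e \<in> E \<Longrightarrow> w e > 0"
  shows "pmf (weighted_ust V E w) T =
    (if T \<in> spanning_trees V E then (\<Prod>e\<in>T. w e) / partition_function V E w else 0)"
proof -
  let ?S = "spanning_trees V E"
  let ?Z = "partition_function V E w"
  let ?f = "\<lambda>T. if T \<in> ?S then (\<Prod>e\<in>T. w e) / ?Z else 0"
  have fin: "finite ?S"
    by (rule finite_subset[of _ "Pow E"]) (auto simp: spanning_trees_def assms(1))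
  have pos: "(\<Prod>e\<in>T. w e) > 0" if "T \<in> ?S" for T
    using that assms(3) by (intro prod_pos) (auto simp: spanning_trees_def)
  have Z: "?Z > 0"
    unfolding partition_function_def using fin assms(2) pos by (intro sum_pos) auto
  have nonneg: "?f T \<ge> 0" for T
    using pos[of T] Z by (auto simp: less_imp_le)
  have "(\<integral>\<^sup>+ T. ennreal (?f T) \<partial>count_space UNIV) = (\<Sum>T\<in>?S. ennreal (?f T))"
    using fin by (intro nn_integral_count_space') auto
  also have "\<dots> = ennreal (\<Sum>T\<in>?S. ?f T)"
    by (rule sum_ennreal) (rule nonneg)
  also have "(\<Sum>T\<in>?S. ?f T) = 1"
    using Z by (simp add: partition_function_def flip: sum_divide_distrib)
  finally have total: "(\<integral>\<^sup>+ T. ennreal (?f T) \<partial>count_space UNIV) = 1" by simp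
  show ?thesis
    unfolding weighted_ust_def by (rule pmf_embed_pmf[OF nonneg total])
qed

lemma spanning_trees_complete_nonempty:
  assumes "V \<noteq> {}"
  shows "spanning_trees V (complete_edges V) \<noteq> {}"
proof -
  obtain c where c: "c \<in> V" using assms by blast
  define T where "T = {{c, v} | v. v \<in> V \<and> v \<noteq> c}"
  have inT: "u = c \<or> v = c" if "{u, v} \<in> T" for u v
    using that by (auto simp: T_def doubleton_eq_iff)
  have edge: "{c, v} \<in> T" "{v, c} \<in> T" if "v \<in> V" "v \<noteq> c" for v
    using that by (auto simp: T_def doubleton_eq_iff)
  have "\<exists>p. walk V T p \<and> hd p = u \<and> last p = v" if "u \<in> V" "v \<in> V" for u v
  proof -
    consider "u = v" | "u \<noteq> v" "u = c" | "u \<noteq> v" "v = c" | "u \<noteq> c" "v \<noteq> c" by blast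
    then show ?thesis
    proof cases
      case 1 then show ?thesis using that by (intro exI[of _ "[u]"]) (auto simp: walk_def)
    next
      case 2 then show ?thesis using that edge
        by (intro exI[of _ "[u, v]"]) (auto simp: walk_def)
    next
      case 3 then show ?thesis using that edge
        by (intro exI[of _ "[u, v]"]) (auto simp: walk_def)
    next
      case 4 then show ?thesis using that edge c
        by (intro exI[of _ "[u, c, v]"]) (auto simp: walk_def)
    qed
  qed
  then have "connected_graph V T" using assms by (auto simp: connected_graph_def)
  moreover have "\<not> graph_cycle V T p" for p
  proof
    assume cyc: "graph_cycle V T p"
    then have "3 \<le> length p" by (simp add: graph_cycle_def)
    then obtain x y z q where p: "p = x # y # z # q"
      by (auto simp: numeral_eq_Suc Suc_le_length_iff)
    have *: "{x, y} \<in> T" "{y, z} \<in> T" "x \<noteq> z" "y \<noteq> x" "y \<noteq> z" "y \<notin> set q"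
      using cyc by (auto simp: graph_cycle_def walk_def p)
    then have y: "y = c" using inT[of x y] inT[of y z] by auto
    show False
    proof (cases q)
      case Nil
      then have "{z, x} \<in> T" using cyc by (auto simp: graph_cycle_def p)
      then show False using inT[of z x] y * by auto
    next
      case (Cons a r)
      then have "{z, a} \<in> T" using cyc by (auto simp: graph_cycle_def walk_def p)
      then show False using inT[of z a] y * Cons by auto
    qed
  qed
  moreover have "T \<subseteq> complete_edges V"
    using c by (auto simp: T_def complete_edges_def card_insert_if)
  ultimately show ?thesis by (auto simp: spanning_trees_def tree_def)
qed


section \<open>The random environment on the complete graph\<close>

text \<open>The complete graph \<open>K\<^sub>n\<close> has vertex set \<open>{..<n}\<close>.\<close>

abbreviation K_edges :: "nat \<Rightarrow> nat set set" where
  "K_edges n \<equiv> complete_edges {..<n}"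

definition edge_weight_pmf :: "nat \<Rightarrow> real \<Rightarrow> real pmf" where
  "edge_weight_pmf n \<gamma> =
     map_pmf (\<lambda>b. if b then real n powr (1 + \<gamma>) else 1) (bernoulli_pmf (1 / real n))"

text \<open>The value \<open>0\<close> given to sets that are not edges of \<open>K\<^sub>n\<close> is a dummy and is never used.\<close>

definition weights_pmf :: "nat \<Rightarrow> real \<Rightarrow> (nat set \<Rightarrow> real) pmf" where
  "weights_pmf n \<gamma> = Pi_pmf (K_edges n) 0 (\<lambda>_. edge_weight_pmf n \<gamma>)"

abbreviation K_ust :: "nat \<Rightarrow> (nat set \<Rightarrow> real) \<Rightarrow> nat set set pmf" where
  "K_ust n w \<equiv> weighted_ust {..<n} (K_edges n) w"

abbreviation K_diam :: "nat \<Rightarrow> nat set set \<Rightarrow> nat" where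
  "K_diam n T \<equiv> graph_diam {..<n} T"

lemma finite_K_edges: "finite (K_edges n)"
  by (rule finite_subset[of _ "Pow {..<n}"]) (auto simp: complete_edges_def)

lemma weights_pmf_pos:
  assumes "n > 0" "w \<in> set_pmf (weights_pmf n \<gamma>)" "e \<in> K_edges n"
  shows "w e > 0"
proof -
  have "w e \<in> set_pmf (edge_weight_pmf n \<gamma>)"
    using assms(2,3) finite_K_edges[of n]
    by (auto simp: weights_pmf_def set_Pi_pmf PiE_dflt_def)
  then show ?thesis using assms(1) by (auto simp: edge_weight_pmf_def split: if_splits)
qed

corollary pmf_K_ust:
  assumes "n > 0" "w \<in> set_pmf (weights_pmf n \<gamma>)"
  shows "pmf (K_ust n w) T = (if T \<in> spanning_trees {..<n} (K_edges n)
    then (\<Prod>e\<in>T. w e) / partition_function {..<n} (K_edges n) w else 0)"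
  using assms
  by (intro pmf_weighted_ust finite_K_edges spanning_trees_complete_nonempty weights_pmf_pos) auto

end

theory Submission
  imports Defs "HOL-Real_Asymp.Real_Asymp"
begin

text \<open>
  Root the tree at a vertex \<open>r\<close> without heavy edges and encode rooted forests as parent functions.
  Given the first steps \<open>u\<^sub>0, \<dots>, u\<^sub>j\<close> of the path from a vertex to a root set \<open>R\<close>, the next
  vertex is \<open>x\<close> with probability proportional to \<open>w(u\<^sub>j, x) h(x)\<close>, where \<open>h(x)\<close> is the
  probability that \<open>x\<close> is joined to \<open>R\<close> rather than to the path.  The function \<open>h\<close> is harmonic, so
  the maximum principle and the flux identity bound it from both sides; this replaces Wilson's
  algorithm.

  Paths to \<open>R\<close> have length at most of order \<open>n / |R|\<close> with exponential tails, and paths to \<open>r\<close>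
  have length of order \<open>\<surd>n\<close>, which gives the lower bound on the diameter.  Moreover, from an average
  vertex the path to \<open>R\<close> is not much shorter than \<open>n / |R|\<close>, so one can choose \<open>32\<^sup>k\<close> vertices
  whose paths to \<open>r\<close> cover at least \<open>\<sigma> 4\<^sup>k \<surd>n\<close> vertices, except with probability of order
  \<open>\<sigma>\<^sup>2 2\<^sup>-\<^sup>k\<close>.  Chaining over \<open>k\<close>, the \<open>32\<^sup>k\<^sup>+\<^sup>1\<close> vertices of the next level reach the tree of level \<open>k\<close>
  within \<open>O(2\<^sup>-\<^sup>k \<surd>n)\<close> steps, and these lengths are summable.
\<close>

text \<open>The heavy edges are the obstacle. Write \<open>B\<close> for their weight and
  \<open>D\<close> for a bound on their number at one vertex. For \<open>\<gamma> < 0\<close> the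
  product \<open>B * D\<close> is small against n, hence against the conductance of a vertex, but it
  may far exceed \<surd>n and so dominate the weight from a vertex into a set of \<surd>n roots. A
  vertex with a heavy edge into \<open>R\<close> may be joined to \<open>R\<close> at once, so path
  lengths to \<open>R\<close> are bounded below only on average over the starting vertex. This is
  why the vertices of a level are selected one after the other by averaging. A root without heavy
  edges has weight 1 to every other vertex, which gives bounds from every starting vertex, and
  comparison with \<open>r\<close> handles larger root sets.

  The base 32 comes from a balance: \<open>m\<close> paths of length \<open>L\<close> cover about
  \<open>S = m * L\<close> vertices, and each is too short with probability of order
  \<open>L * S / n = S^2 / (m * n)\<close>. As \<open>S\<close> grows like \<open>4^k\<close>, the
  number \<open>m\<close> must grow faster than \<open>16^k\<close> for the failures to be
  summable.\<close>

section \<open>Orbits of parent functions\<close>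

definition reaches :: "('a \<Rightarrow> 'a) \<Rightarrow> 'a set \<Rightarrow> 'a \<Rightarrow> bool" where
  "reaches f R v \<longleftrightarrow> (\<exists>k. (f ^^ k) v \<in> R)"

lemma reaches_refl: "v \<in> R \<Longrightarrow> reaches f R v"
  unfolding reaches_def by (intro exI[of _ 0]) simp

lemma reaches_step: "reaches f R (f v) \<Longrightarrow> reaches f R v"
  unfolding reaches_def by (metis funpow_Suc_right o_apply)

lemma reaches_induct [consumes 1, case_names base step]:
  assumes "reaches f R v" "\<And>v. v \<in> R \<Longrightarrow> P v" "\<And>v. v \<notin> R \<Longrightarrow> reaches f R (f v) \<Longrightarrow> P (f v) \<Longrightarrow> P v"
  shows "P v"
proof -
  obtain k where "(f ^^ k) v \<in> R" using assms(1) unfolding reaches_def by blast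
  then show ?thesis
  proof (induction k arbitrary: v)
    case (Suc k)
    then have "(f ^^ k) (f v) \<in> R" by (simp add: funpow_swap1)
    then show ?case using Suc.IH[of "f v"] assms(2,3) reaches_def by metis
  qed (use assms(2) in auto)
qed

lemma funpow_cong_orbit:
  assumes "\<And>i. i < k \<Longrightarrow> f ((g ^^ i) v) = g ((g ^^ i) v)"
  shows "(f ^^ k) v = (g ^^ k) v"
  using assms by (induction k) auto

text \<open>Only the orbit before its first entry into \<open>R\<close> matters. This allows
  \<open>trim\<close> and \<open>glue\<close> to change a function on the set that has to be
  reached.\<close>

lemma reaches_cong:
  assumes "reaches g R v" "\<And>k. (g ^^ k) v \<notin> R \<Longrightarrow> f ((g ^^ k) v) = g ((g ^^ k) v)"
  shows "reaches f R v"
proof -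
  define k where "k = (LEAST k. (g ^^ k) v \<in> R)"
  have k: "(g ^^ k) v \<in> R"
    using assms(1) unfolding k_def reaches_def by (rule LeastI_ex)
  have "(g ^^ i) v \<notin> R" if "i < k" for i
    using that not_less_Least unfolding k_def by blast
  then have "(f ^^ k) v = (g ^^ k) v"
    using assms(2) by (intro funpow_cong_orbit) auto
  then show ?thesis using k unfolding reaches_def by metis
qed

lemma reaches_trans:
  assumes "reaches f C v" "\<And>c. c \<in> C \<Longrightarrow> reaches f R c"
  shows "reaches f R v"
  using assms(1) by (induction rule: reaches_induct) (auto intro: assms(2) dest: reaches_step)

lemma funpow_absorb:
  assumes "\<And>x. x \<in> R \<Longrightarrow> f x = x" "(f ^^ k) v \<in> R" "k \<le> l"
  shows "(f ^^ l) v = (f ^^ k) v"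
proof -
  have "(f ^^ d) ((f ^^ k) v) = (f ^^ k) v" for d
    by (induction d) (auto simp: assms(1,2))
  from this[of "l - k"] show ?thesis
    using assms(3) by (metis funpow_add le_add_diff_inverse2 o_apply)
qed


lemma sum_half_powers: "(\<Sum>k\<le>K. (1 / 2 :: real) ^ k) \<le> 2" "(\<Sum>k<K. (1 / 2 :: real) ^ k) \<le> 2"
proof -
  have "(\<Sum>k\<le>K. (1 / 2 :: real) ^ k) = 2 - (1 / 2) ^ K" by (induction K) auto
  then show "(\<Sum>k\<le>K. (1 / 2 :: real) ^ k) \<le> 2" by simp
  have "(\<Sum>k<K. (1 / 2 :: real) ^ k) = 2 - 2 * (1 / 2) ^ K" by (induction K) auto
  then show "(\<Sum>k<K. (1 / 2 :: real) ^ k) \<le> 2" by simp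
qed

lemma power_exp_le:
  fixes x :: real
  assumes "0 \<le> x" "x \<le> 1"
  shows "(1 - x) ^ t \<le> exp (- (x * real t))"
proof -
  have "(1 - x) ^ t \<le> exp (- x) ^ t"
    using assms exp_ge_add_one_self[of "- x"] by (intro power_mono) auto
  then show ?thesis by (simp add: exp_of_nat_mult[symmetric] mult.commute)
qed

section \<open>Weighted forests\<close>

locale network =
  fixes V :: "'a set" and W :: "'a \<Rightarrow> 'a \<Rightarrow> real"
  assumes fin: "finite V"
    and W_sym: "W u v = W v u"
    and W_self: "W u u = 0"
    and W_pos: "u \<in> V \<Longrightarrow> v \<in> V \<Longrightarrow> u \<noteq> v \<Longrightarrow> W u v > 0"
begin

lemma W_nonneg: "u \<in> V \<Longrightarrow> v \<in> V \<Longrightarrow> W u v \<ge> 0"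
  using W_pos W_self by (metis less_eq_real_def)

text \<open>Roots and points outside \<open>V\<close> are fixed points, so the iterates of a parent function are
  absorbed by \<open>R\<close>.\<close>

definition forests :: "'a set \<Rightarrow> ('a \<Rightarrow> 'a) set" where
  "forests R = {f. (\<forall>x. x \<notin> V - R \<longrightarrow> f x = x) \<and> (\<forall>x\<in>V. f x \<in> V \<and> reaches f R x)}"

definition forest_weight :: "'a set \<Rightarrow> ('a \<Rightarrow> 'a) \<Rightarrow> real" where
  "forest_weight R f = (\<Prod>x\<in>V - R. W x (f x))"

definition wsum :: "'a set \<Rightarrow> (('a \<Rightarrow> 'a) \<Rightarrow> real) \<Rightarrow> real" where
  "wsum R \<phi> = (\<Sum>f\<in>forests R. forest_weight R f * \<phi> f)"

text \<open>Unnormalised probability: divided by \<open>Z R\<close> it is the probability of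
  \<open>P\<close> for the random forest rooted at \<open>R\<close>. Bounds are kept in the form
  \<open>mass R P \<le> q * Z R\<close>, which avoids division.\<close>

definition mass :: "'a set \<Rightarrow> (('a \<Rightarrow> 'a) \<Rightarrow> bool) \<Rightarrow> real" where
  "mass R P = wsum R (\<lambda>f. of_bool (P f))"

abbreviation Z :: "'a set \<Rightarrow> real" where "Z R \<equiv> mass R (\<lambda>_. True)"

lemma forestsD:
  assumes "f \<in> forests R"
  shows "x \<notin> V \<Longrightarrow> f x = x" "x \<in> R \<Longrightarrow> f x = x" "x \<in> V \<Longrightarrow> f x \<in> V" "x \<in> V \<Longrightarrow> reaches f R x"
  using assms by (auto simp: forests_def)

lemma forests_funpow_in: "f \<in> forests R \<Longrightarrow> x \<in> V \<Longrightarrow> (f ^^ k) x \<in> V"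
  by (induction k) (simp_all add: forestsD(3))

lemma forests_absorb:
  assumes "f \<in> forests R" "(f ^^ k) v \<in> R" "k \<le> l"
  shows "(f ^^ l) v = (f ^^ k) v"
  using funpow_absorb[OF forestsD(2)[OF assms(1)] assms(2,3)] .

text \<open>Going round a cycle \<open>j\<close> times takes at least \<open>j\<close> steps, enough
  to be absorbed by \<open>R\<close>; yet the path is then back at \<open>x\<close>.\<close>

lemma forests_no_cycle:
  assumes "f \<in> forests R" "x \<in> V" "(f ^^ Suc k) x = x"
  shows "x \<in> R"
proof -
  obtain j where j: "(f ^^ j) x \<in> R"
    using forestsD(4)[OF assms(1,2)] unfolding reaches_def by blast
  have per: "(f ^^ (i * Suc k)) x = x" for i
  proof (induction i)
    case (Suc i)
    have "(f ^^ (Suc i * Suc k)) x = (f ^^ Suc k) ((f ^^ (i * Suc k)) x)"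
      by (metis funpow_add mult_Suc o_apply)
    then show ?case using Suc assms(3) by simp
  qed simp
  have "(f ^^ (j * Suc k)) x = (f ^^ j) x"
    by (rule forests_absorb[OF assms(1) j]) simp
  then show ?thesis using per[of j] j by simp
qed

lemma finite_forests: "finite (forests R)"
proof -
  have "inj_on (\<lambda>f. restrict f V) (forests R)"
  proof (rule inj_onI)
    fix f g assume *: "f \<in> forests R" "g \<in> forests R" "restrict f V = restrict g V"
    show "f = g"
    proof
      fix x show "f x = g x"
        using fun_cong[OF *(3), of x] forestsD(1)[OF *(1), of x] forestsD(1)[OF *(2), of x]
        by (cases "x \<in> V") simp_all
    qed
  qed
  moreover have "(\<lambda>f. restrict f V) ` forests R \<subseteq> V \<rightarrow>\<^sub>E V"
    by (auto simp: PiE_iff extensional_def forestsD(3))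
  ultimately show ?thesis
    using fin by (meson finite_PiE finite_imageD finite_subset)
qed

lemma forest_weight_nonneg: "f \<in> forests R \<Longrightarrow> forest_weight R f \<ge> 0"
  unfolding forest_weight_def by (rule prod_nonneg) (simp add: W_nonneg forestsD(3))

lemma wsum_mono: "(\<And>f. f \<in> forests R \<Longrightarrow> \<phi> f \<le> \<psi> f) \<Longrightarrow> wsum R \<phi> \<le> wsum R \<psi>"
  unfolding wsum_def by (intro sum_mono mult_left_mono forest_weight_nonneg)

lemma wsum_cong: "(\<And>f. f \<in> forests R \<Longrightarrow> \<phi> f = \<psi> f) \<Longrightarrow> wsum R \<phi> = wsum R \<psi>"
  unfolding wsum_def by (intro sum.cong) auto

lemma wsum_add: "wsum R (\<lambda>f. \<phi> f + \<psi> f) = wsum R \<phi> + wsum R \<psi>"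
  unfolding wsum_def by (simp add: algebra_simps sum.distrib)

lemma wsum_cmult: "wsum R (\<lambda>f. c * \<phi> f) = c * wsum R \<phi>"
  unfolding wsum_def by (simp add: sum_distrib_left algebra_simps)

lemma wsum_sum: "wsum R (\<lambda>f. \<Sum>i\<in>I. \<phi> i f) = (\<Sum>i\<in>I. wsum R (\<phi> i))"
  unfolding wsum_def by (simp add: sum_distrib_left sum.swap[of _ I])

lemma mass_mono: "(\<And>f. f \<in> forests R \<Longrightarrow> P f \<Longrightarrow> Q f) \<Longrightarrow> mass R P \<le> mass R Q"
  unfolding mass_def by (intro wsum_mono) auto

lemma mass_cong: "(\<And>f. f \<in> forests R \<Longrightarrow> P f = Q f) \<Longrightarrow> mass R P = mass R Q"
  unfolding mass_def by (intro wsum_cong) auto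

lemma wsum_nonneg: "(\<And>f. f \<in> forests R \<Longrightarrow> \<phi> f \<ge> 0) \<Longrightarrow> wsum R \<phi> \<ge> 0"
  unfolding wsum_def by (intro sum_nonneg mult_nonneg_nonneg forest_weight_nonneg)

lemma mass_nonneg [simp]: "mass R P \<ge> 0"
  unfolding mass_def by (intro wsum_nonneg) auto

lemma mass_le_Z: "mass R P \<le> Z R"
  by (rule mass_mono) simp

lemma mass_disj: "mass R (\<lambda>f. P f \<or> Q f) \<le> mass R P + mass R Q"
  unfolding mass_def wsum_add[symmetric] by (intro wsum_mono) auto

lemma mass_Bex:
  assumes "finite I"
  shows "mass R (\<lambda>f. \<exists>i\<in>I. P i f) \<le> (\<Sum>i\<in>I. mass R (P i))"
  using assms
proof (induction I rule: finite_induct)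
  case (insert i I)
  have "mass R (\<lambda>f. \<exists>j\<in>insert i I. P j f) \<le> mass R (P i) + mass R (\<lambda>f. \<exists>j\<in>I. P j f)"
    using mass_disj[of R "P i" "\<lambda>f. \<exists>j\<in>I. P j f"] by (simp add: bex_simps)
  then show ?case using insert by simp
qed (simp add: mass_def wsum_def)

section \<open>Harmonicity\<close>

text \<open>Since \<open>R\<close> is absorbing, \<open>k\<close> is the step at which the path of \<open>x\<close> enters \<open>R\<close>.\<close>

definition exits_via :: "('a \<Rightarrow> 'a \<Rightarrow> bool) \<Rightarrow> 'a set \<Rightarrow> ('a \<Rightarrow> 'a) \<Rightarrow> 'a \<Rightarrow> bool" where
  "exits_via Q R f x \<longleftrightarrow>
    (\<exists>k. (f ^^ k) x \<notin> R \<and> (f ^^ Suc k) x \<in> R \<and> Q ((f ^^ k) x) ((f ^^ Suc k) x))"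

lemma exits_via_step:
  assumes "f \<in> forests R" "x \<notin> R"
  shows "exits_via Q R f x \<longleftrightarrow> (if f x \<in> R then Q x (f x) else exits_via Q R f (f x))"
proof (cases "f x \<in> R")
  case True
  have "(f ^^ k) x \<in> R" if "k > 0" for k
    using forests_absorb[OF assms(1), of 1 x k] True that by simp
  then have "k = 0" if "(f ^^ k) x \<notin> R" for k using that by blast
  then show ?thesis
    unfolding exits_via_def using True assms(2)
    by (metis (no_types, lifting) funpow_0 funpow_simps_right(2) o_apply)
next
  case False
  have "(\<exists>k. (f ^^ k) x \<notin> R \<and> (f ^^ Suc k) x \<in> R \<and> Q ((f ^^ k) x) ((f ^^ Suc k) x))
    \<longleftrightarrow> (\<exists>k. (f ^^ k) (f x) \<notin> R \<and> (f ^^ Suc k) (f x) \<in> R \<and> Q ((f ^^ k) (f x)) ((f ^^ Suc k) (f x)))"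
    (is "(\<exists>k. ?A k) = (\<exists>k. ?B k)")
  proof -
    have "?A (Suc k) = ?B k" for k by (simp add: funpow_swap1)
    moreover have "\<not> ?A 0" using False by simp
    ultimately show ?thesis by (metis not0_implies_Suc)
  qed
  then show ?thesis using False unfolding exits_via_def by simp
qed

lemma exits_via_cong:
  assumes "\<And>k. f ((g ^^ k) v) = g ((g ^^ k) v)"
  shows "exits_via Q R f v \<longleftrightarrow> exits_via Q R g v"
proof -
  have "(f ^^ k) v = (g ^^ k) v" for k by (rule funpow_cong_orbit) (rule assms)
  then show ?thesis unfolding exits_via_def by presburger
qed

text \<open>A new edge from \<open>x\<close> to \<open>y\<close> could close a cycle only through a
  path from \<open>y\<close> back to \<open>x\<close>, which \<open>av\<close> excludes.\<close>

lemma forests_upd: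
  assumes f: "f \<in> forests R" and x: "x \<in> V - R" and y: "y \<in> V" and av: "\<And>k. (f ^^ k) y \<noteq> x"
  shows "f(x := y) \<in> forests R"
proof -
  let ?f = "f(x := y)"
  have "reaches ?f R y"
    by (rule reaches_cong[OF forestsD(4)[OF f y]]) (use av in auto)
  then have rx: "reaches ?f R x" using reaches_step[of ?f R x] by simp
  have "reaches ?f R v" if "v \<in> V" for v
    using forestsD(4)[OF f that]
  proof (induction rule: reaches_induct)
    case (step v)
    show ?case
    proof (cases "v = x")
      case False
      then have "?f v = f v" by simp
      then show ?thesis using step reaches_step[of ?f R v] by metis
    qed (use rx in blast)
  qed (rule reaches_refl)
  then show ?thesis using f x y by (auto simp: forests_def)
qed

lemma forest_weight_upd:
  assumes x: "x \<in> V - R"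
  shows "forest_weight R (f(x := y)) * W x (f x) = forest_weight R f * W x y"
proof -
  have fi: "finite (V - R)" using fin by simp
  have eq: "(\<Prod>v\<in>V - R - {x}. W v ((f(x := y)) v)) = (\<Prod>v\<in>V - R - {x}. W v (f v))"
    by (intro prod.cong) auto
  show ?thesis
    unfolding forest_weight_def prod.remove[OF fi x] eq by simp
qed

text \<open>Swapping the pair \<open>(f, y)\<close> for \<open>(f(x := y), f x)\<close> preserves the product of the weights;
  it is possible exactly when the path of \<open>y\<close> avoids \<open>x\<close>, and otherwise \<open>y\<close> and \<open>x\<close> leave through
  the same edge anyway.\<close>

lemma exits_via_swap:
  assumes x: "x \<in> V - R"
  shows "(\<Sum>y\<in>V. W x y) * mass R (\<lambda>f. exits_via Q R f x)
    = (\<Sum>y\<in>V. W x y * mass R (\<lambda>f. if y \<in> R then Q x y else exits_via Q R f y))"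
proof -
  define g where "g = (\<lambda>f y. if y \<in> R then Q x y else exits_via Q R f y)"
  define A where "A = {(f, y). f \<in> forests R \<and> y \<in> V \<and> (\<forall>k. (f ^^ k) y \<noteq> x)}"
  define B where "B = forests R \<times> V - A"
  define s where "s = (\<lambda>(f::'a \<Rightarrow> 'a, y::'a). (f(x := y), f x))"
  define w where "w = (\<lambda>(f::'a \<Rightarrow> 'a, y). forest_weight R f * W x y)"
  have AB: "forests R \<times> V = A \<union> B" "A \<inter> B = {}" unfolding B_def A_def by auto
  have "finite (A \<union> B)" unfolding AB(1)[symmetric] using finite_forests fin by blast
  then have finA: "finite A" "finite B" by auto
  have av: "(f ^^ k) (f x) \<noteq> x" if "f \<in> forests R" for f k
  proof
    assume "(f ^^ k) (f x) = x"
    then have "(f ^^ Suc k) x = x" by (simp add: funpow_swap1)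
    then show False using forests_no_cycle[OF that] x by blast
  qed
  have itr: "((f(x := y)) ^^ k) z = (f ^^ k) z" if "\<And>k. (f ^^ k) z \<noteq> x" for f y z k
    by (rule funpow_cong_orbit) (use that in auto)
  have gx: "exits_via Q R f x = g f (f x)" if "f \<in> forests R" for f
    using exits_via_step[OF that, of x Q] x unfolding g_def by simp
  have sA: "s p \<in> A" "s (s p) = p" "w (s p) = w p"
    "g (fst (s p)) (snd (s p)) = g (fst p) ((fst p) x)" if pA: "p \<in> A" for p
  proof -
    obtain f y where p: "p = (f, y)" "f \<in> forests R" "y \<in> V" "\<And>k. (f ^^ k) y \<noteq> x"
      using pA unfolding A_def by auto
    show "s p \<in> A"
      using forests_upd[OF p(2) x p(3,4)] forestsD(3)[OF p(2)] av[OF p(2)] x itr[of f "f x" _ y]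
      unfolding A_def s_def p(1) by auto
    show "s (s p) = p" unfolding s_def p(1) by auto
    show "w (s p) = w p" unfolding s_def p(1) w_def using forest_weight_upd[OF x] by simp
    have "exits_via Q R (f(x := y)) (f x) = exits_via Q R f (f x)"
      by (rule exits_via_cong) (use av[OF p(2)] in auto)
    then show "g (fst (s p)) (snd (s p)) = g (fst p) ((fst p) x)"
      unfolding s_def p(1) g_def by simp
  qed
  have sumA: "(\<Sum>p\<in>A. w p * of_bool (g (fst p) (fst p x))) = (\<Sum>p\<in>A. w p * of_bool (g (fst p) (snd p)))"
    by (rule sum.reindex_bij_witness[of _ s s]) (use sA in auto)
  have sumB: "(\<Sum>p\<in>B. w p * of_bool (g (fst p) (fst p x))) = (\<Sum>p\<in>B. w p * of_bool (g (fst p) (snd p)))"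
  proof (rule sum.cong[OF refl])
    fix p assume "p \<in> B"
    then obtain f y k where p: "p = (f, y)" "f \<in> forests R" "y \<in> V" "(f ^^ k) y = x"
      unfolding B_def A_def by auto
    have "y \<notin> R \<and> exits_via Q R f y = exits_via Q R f x" using p(4)
    proof (induction k arbitrary: y)
      case (Suc k)
      then have IH: "f y \<notin> R \<and> exits_via Q R f (f y) = exits_via Q R f x"
        using Suc.IH[of "f y"] by (simp add: funpow_swap1)
      have "y \<notin> R" using IH forestsD(2)[OF p(2), of y] by auto
      then show ?case using IH exits_via_step[OF p(2), of y Q] by simp
    qed (use x in auto)
    then show "w p * of_bool (g (fst p) (fst p x)) = w p * of_bool (g (fst p) (snd p))"
      using gx[OF p(2)] unfolding p(1) g_def by simp
  qed
  have cart: "(\<Sum>p\<in>forests R \<times> V. F p) = (\<Sum>f\<in>forests R. \<Sum>y\<in>V. F (f, y))" for F :: "_ \<Rightarrow> real"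
    by (simp add: sum.cartesian_product)
  have "(\<Sum>y\<in>V. W x y) * mass R (\<lambda>f. exits_via Q R f x) = (\<Sum>p\<in>forests R \<times> V. w p * of_bool (g (fst p) (fst p x)))"
    unfolding mass_def wsum_def sum_product w_def cart
    by (subst sum.swap) (auto intro!: sum.cong simp: gx)
  also have "\<dots> = (\<Sum>p\<in>forests R \<times> V. w p * of_bool (g (fst p) (snd p)))"
    unfolding AB(1) sum.union_disjoint[OF finA AB(2)] sumA sumB ..
  also have "\<dots> = (\<Sum>y\<in>V. W x y * mass R (\<lambda>f. g f y))"
    unfolding mass_def wsum_def sum_distrib_left w_def cart
    by (subst sum.swap) (auto intro!: sum.cong)
  finally show ?thesis unfolding g_def .
qed

definition exit_weight :: "('a \<Rightarrow> 'a \<Rightarrow> bool) \<Rightarrow> 'a set \<Rightarrow> 'a \<Rightarrow> real" where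
  "exit_weight Q R x = (\<Sum>y\<in>R. W x y * of_bool (Q x y))"

definition conductance :: "'a \<Rightarrow> real" where "conductance x = (\<Sum>y\<in>V. W x y)"

lemma conductance_split: "R \<subseteq> V \<Longrightarrow> conductance x = (\<Sum>y\<in>R. W x y) + (\<Sum>y\<in>V - R. W x y)"
  unfolding conductance_def using sum.subset_diff[of R V "W x"] fin by simp

text \<open>This is the one-step equation of the weighted random walk stopped on \<open>R\<close>,
  although no walk is ever constructed: as a function of the starting vertex, the exit probability
  is harmonic outside \<open>R\<close>.\<close>

lemma exits_via_harmonic:
  assumes R: "R \<subseteq> V" and x: "x \<in> V - R"
  shows "conductance x * mass R (\<lambda>f. exits_via Q R f x)
    = Z R * exit_weight Q R x + (\<Sum>y\<in>V - R. W x y * mass R (\<lambda>f. exits_via Q R f y))"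
proof -
  have "conductance x * mass R (\<lambda>f. exits_via Q R f x) =
    (\<Sum>y\<in>V. W x y * mass R (\<lambda>f. if y \<in> R then Q x y else exits_via Q R f y))"
    unfolding conductance_def by (rule exits_via_swap[OF x])
  also have "\<dots> = (\<Sum>y\<in>V - R. W x y * mass R (\<lambda>f. if y \<in> R then Q x y else exits_via Q R f y))
     + (\<Sum>y\<in>R. W x y * mass R (\<lambda>f. if y \<in> R then Q x y else exits_via Q R f y))"
    by (rule sum.subset_diff[OF R fin])
  also have "(\<Sum>y\<in>V - R. W x y * mass R (\<lambda>f. if y \<in> R then Q x y else exits_via Q R f y))
    = (\<Sum>y\<in>V - R. W x y * mass R (\<lambda>f. exits_via Q R f y))"
    by (intro sum.cong) auto
  also have "(\<Sum>y\<in>R. W x y * mass R (\<lambda>f. if y \<in> R then Q x y else exits_via Q R f y)) = Z R * exit_weight Q R x"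
  proof -
    have "W x y * mass R (\<lambda>f. Q x y) = Z R * (W x y * of_bool (Q x y))" for y
      by (cases "Q x y") (simp_all add: mass_def wsum_def)
    then show ?thesis unfolding exit_weight_def sum_distrib_left by (intro sum.cong) auto
  qed
  finally show ?thesis by simp
qed

text \<open>Sum the harmonic equation over all vertices outside \<open>R\<close>: since
  \<open>W\<close> is symmetric, the interior terms of both sides cancel. What remains is a
  conservation law, which controls averages of exit probabilities where no pointwise bound is
  available.\<close>

lemma exits_via_flux:
  assumes R: "R \<subseteq> V"
  shows "(\<Sum>y\<in>V - R. mass R (\<lambda>f. exits_via Q R f y) * (\<Sum>z\<in>R. W y z)) = Z R * (\<Sum>x\<in>V - R. exit_weight Q R x)"
proof -
  let ?h = "\<lambda>y. mass R (\<lambda>f. exits_via Q R f y)"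
  have "(\<Sum>x\<in>V - R. conductance x * ?h x) = (\<Sum>x\<in>V - R. Z R * exit_weight Q R x) + (\<Sum>x\<in>V - R. \<Sum>y\<in>V - R. W x y * ?h y)"
    unfolding sum.distrib[symmetric] by (intro sum.cong refl exits_via_harmonic[OF R])
  moreover have "(\<Sum>x\<in>V - R. \<Sum>y\<in>V - R. W x y * ?h y) = (\<Sum>y\<in>V - R. ?h y * (\<Sum>x\<in>V - R. W y x))"
  proof -
    have "(\<Sum>x\<in>V - R. \<Sum>y\<in>V - R. W x y * ?h y) = (\<Sum>y\<in>V - R. \<Sum>x\<in>V - R. ?h y * W y x)"
      by (subst sum.swap, intro sum.cong refl) (metis W_sym mult.commute)
    then show ?thesis by (simp add: sum_distrib_left)
  qed
  moreover have "(\<Sum>x\<in>V - R. conductance x * ?h x) = (\<Sum>y\<in>V - R. ?h y * (\<Sum>z\<in>R. W y z)) + (\<Sum>y\<in>V - R. ?h y * (\<Sum>x\<in>V - R. W y x))"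
    unfolding sum.distrib[symmetric] conductance_split[OF R] by (simp add: algebra_simps)
  ultimately show ?thesis by (simp add: sum_distrib_left)
qed

section \<open>Maximum and comparison principles\<close>

text \<open>At a vertex where \<open>k\<close> is maximal the neighbours outside \<open>R\<close>
  cannot exceed it, so the equation leaves only the edges into \<open>R\<close>, and these have
  positive total weight.\<close>

lemma max_principle:
  assumes R: "R \<subseteq> V" "R \<noteq> {}"
    and sub: "\<And>x. x \<in> V - R \<Longrightarrow> conductance x * k x \<le> b * (\<Sum>z\<in>R. W x z) + (\<Sum>y\<in>V - R. W x y * k y)"
    and x: "x \<in> V - R"
  shows "k x \<le> b"
proof -
  have fi: "finite (V - R)" using fin by simp
  have "\<exists>m\<in>V - R. \<forall>y\<in>V - R. k y \<le> k m"
  proof -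
    have "Max (k ` (V - R)) \<in> k ` (V - R)" using fi x by (intro Max_in) auto
    then obtain m where "m \<in> V - R" "k m = Max (k ` (V - R))" by force
    then show ?thesis using fi by (intro bexI[of _ m]) auto
  qed
  then obtain m where m: "m \<in> V - R" "\<And>y. y \<in> V - R \<Longrightarrow> k y \<le> k m" by blast
  have "(\<Sum>y\<in>V - R. W m y * k y) \<le> (\<Sum>y\<in>V - R. W m y * k m)"
    using m W_nonneg by (intro sum_mono mult_left_mono) auto
  then have "conductance m * k m \<le> b * (\<Sum>z\<in>R. W m z) + (\<Sum>y\<in>V - R. W m y) * k m"
    using sub[OF m(1)] by (simp add: sum_distrib_right)
  then have "(\<Sum>z\<in>R. W m z) * k m \<le> (\<Sum>z\<in>R. W m z) * b"
    unfolding conductance_split[OF R(1)] by (simp add: algebra_simps)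
  moreover have "(\<Sum>z\<in>R. W m z) > 0"
    using R m finite_subset[OF R(1) fin] by (intro sum_pos) (auto intro!: W_pos)
  ultimately have "k m \<le> b" by simp
  then show ?thesis using m(2)[OF x] by simp
qed

text \<open>Whichever vertex the path enters \<open>R\<close> from, the entering edge satisfies
  \<open>Q\<close> with conditional probability at most \<open>b\<close>.\<close>

lemma exits_via_le:
  assumes R: "R \<subseteq> V" "R \<noteq> {}" and b: "\<And>x. x \<in> V - R \<Longrightarrow> exit_weight Q R x \<le> b * (\<Sum>z\<in>R. W x z)"
    and x: "x \<in> V - R"
  shows "mass R (\<lambda>f. exits_via Q R f x) \<le> b * Z R"
proof (rule max_principle[OF R _ x])
  fix x assume x: "x \<in> V - R"
  show "conductance x * mass R (\<lambda>f. exits_via Q R f x) \<le> b * Z R * (\<Sum>z\<in>R. W x z)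
    + (\<Sum>y\<in>V - R. W x y * mass R (\<lambda>f. exits_via Q R f y))"
    unfolding exits_via_harmonic[OF R(1) x] using mult_left_mono[OF b[OF x], of "Z R"]
    by (simp add: algebra_simps)
qed

text \<open>The difference of the two sides satisfies the inequality of \<open>max_principle\<close>
  with boundary value 0.\<close>

lemma exits_via_compare:
  assumes R: "R \<subseteq> V" "R \<noteq> {}" and b: "\<And>x. x \<in> V - R \<Longrightarrow> s * exit_weight Q R x \<le> exit_weight Q' R x"
    and x: "x \<in> V - R"
  shows "s * mass R (\<lambda>f. exits_via Q R f x) \<le> mass R (\<lambda>f. exits_via Q' R f x)"
proof -
  have "s * mass R (\<lambda>f. exits_via Q R f x) - mass R (\<lambda>f. exits_via Q' R f x) \<le> 0"
  proof (rule max_principle[OF R _ x])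
    fix x assume x: "x \<in> V - R"
    have "conductance x * (s * mass R (\<lambda>f. exits_via Q R f x) - mass R (\<lambda>f. exits_via Q' R f x))
      = s * (conductance x * mass R (\<lambda>f. exits_via Q R f x)) - conductance x * mass R (\<lambda>f. exits_via Q' R f x)"
      by (simp add: algebra_simps)
    also have "\<dots> = Z R * (s * exit_weight Q R x - exit_weight Q' R x)
      + (\<Sum>y\<in>V - R. W x y * (s * mass R (\<lambda>f. exits_via Q R f y) - mass R (\<lambda>f. exits_via Q' R f y)))"
      unfolding exits_via_harmonic[OF R(1) x]
      by (simp add: algebra_simps sum_subtractf sum_distrib_left)
    also have "\<dots> \<le> (\<Sum>y\<in>V - R. W x y * (s * mass R (\<lambda>f. exits_via Q R f y) - mass R (\<lambda>f. exits_via Q' R f y)))"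
      using b[OF x] by (simp add: mult_nonneg_nonpos)
    finally show "conductance x * (s * mass R (\<lambda>f. exits_via Q R f x) - mass R (\<lambda>f. exits_via Q' R f x))
      \<le> 0 * (\<Sum>z\<in>R. W x z) + (\<Sum>y\<in>V - R. W x y * (s * mass R (\<lambda>f. exits_via Q R f y) - mass R (\<lambda>f. exits_via Q' R f y)))"
      by simp
  qed
  then show ?thesis by simp
qed


section \<open>Surgery on forests\<close>

definition trim :: "'a set \<Rightarrow> ('a \<Rightarrow> 'a) \<Rightarrow> 'a \<Rightarrow> 'a" where
  "trim C f = (\<lambda>v. if v \<in> C then v else f v)"

definition glue :: "'a set \<Rightarrow> ('a \<Rightarrow> 'a) \<Rightarrow> ('a \<Rightarrow> 'a) \<Rightarrow> 'a \<Rightarrow> 'a" where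
  "glue C \<phi> g = (\<lambda>v. if v \<in> C then \<phi> v else g v)"

lemma reaches_mono: "reaches f R v \<Longrightarrow> R \<subseteq> C \<Longrightarrow> reaches f C v"
  unfolding reaches_def by blast

lemma trim_forests:
  assumes f: "f \<in> forests R" and C: "R \<subseteq> C" "C \<subseteq> V"
  shows "trim C f \<in> forests C"
proof -
  have "reaches (trim C f) C v" if "v \<in> V" for v
    by (rule reaches_cong[OF reaches_mono[OF forestsD(4)[OF f that] C(1)]]) (simp add: trim_def)
  then show ?thesis
    using forestsD(1,3)[OF f] C by (auto simp: forests_def trim_def)
qed

lemma glue_forests:
  assumes g: "g \<in> forests C" and C: "R \<subseteq> C" "C \<subseteq> V"
    and \<phi>: "\<And>x. x \<in> C \<Longrightarrow> \<phi> x \<in> V" "\<And>x. x \<in> R \<Longrightarrow> \<phi> x = x"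
    and r: "\<And>x. x \<in> C \<Longrightarrow> reaches (glue C \<phi> g) R x"
  shows "glue C \<phi> g \<in> forests R"
proof -
  have "reaches (glue C \<phi> g) R v" if "v \<in> V" for v
  proof (rule reaches_trans[OF _ r])
    show "reaches (glue C \<phi> g) C v"
      by (rule reaches_cong[OF forestsD(4)[OF g that]]) (simp add: glue_def)
  qed
  then show ?thesis
    using forestsD(1,3)[OF g] C \<phi> by (auto simp: forests_def glue_def)
qed

lemma forest_weight_glue:
  assumes C: "R \<subseteq> C" "C \<subseteq> V"
  shows "forest_weight R (glue C \<phi> g) = (\<Prod>x\<in>C - R. W x (\<phi> x)) * forest_weight C g"
proof -
  have eq: "V - R = (C - R) \<union> (V - C)" using C by auto
  have "forest_weight R (glue C \<phi> g) = (\<Prod>x\<in>C - R. W x (glue C \<phi> g x)) * (\<Prod>x\<in>V - C. W x (glue C \<phi> g x))"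
    unfolding forest_weight_def eq using C fin finite_subset[OF C(2) fin] by (intro prod.union_disjoint) auto
  then show ?thesis unfolding forest_weight_def glue_def by simp
qed

lemma trim_glue: "g \<in> forests C \<Longrightarrow> trim C (glue C \<phi> g) = g"
  by (auto simp: glue_def trim_def forestsD(2))

section \<open>Conditioning on a part of the forest\<close>

text \<open>Domain Markov property. By \<open>loc\<close> the set \<open>X f\<close> is not affected
  by the values of \<open>f\<close> outside it, much like a stopping time. Given \<open>X f\<close>
  and \<open>f\<close> on it, the rest of \<open>f\<close> is a weighted forest rooted at
  \<open>X f\<close>, so a bound that holds for every possible root set carries over.\<close>

lemma wsum_domain_markov:
  fixes X :: "('a \<Rightarrow> 'a) \<Rightarrow> 'a set" and \<phi> :: "'a set \<Rightarrow> ('a \<Rightarrow> 'a) \<Rightarrow> real"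
  assumes X: "\<And>f. f \<in> forests R \<Longrightarrow> R \<subseteq> X f" "\<And>f. f \<in> forests R \<Longrightarrow> X f \<subseteq> V"
      "\<And>f x. f \<in> forests R \<Longrightarrow> x \<in> X f \<Longrightarrow> f x \<in> X f"
    and loc: "\<And>f g. f \<in> forests R \<Longrightarrow> g \<in> forests (X f) \<Longrightarrow> X (glue (X f) f g) = X f"
    and bound: "\<And>f. f \<in> forests R \<Longrightarrow> wsum (X f) (\<phi> (X f)) \<le> q * Z (X f)"
  shows "wsum R (\<lambda>f. \<phi> (X f) (trim (X f) f)) \<le> q * Z R"
proof -
  \<comment> \<open>Filling up with \<open>id\<close> makes \<open>key f\<close> record
    \<open>X f\<close> and the values of \<open>f\<close> there, and nothing else.\<close>
  define key where "key f = (X f, glue (X f) f id)" for f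
  have cls: "(\<Sum>f\<in>{f \<in> forests R. key f = \<kappa>}. forest_weight R f * \<phi> (X f) (trim (X f) f))
    \<le> (\<Sum>f\<in>{f \<in> forests R. key f = \<kappa>}. forest_weight R f * q)" if "\<kappa> \<in> key ` forests R" for \<kappa>
  proof -
    obtain f0 where f0: "f0 \<in> forests R" "\<kappa> = key f0" using \<open>\<kappa> \<in> _\<close> by auto
    define C where "C = X f0"
    have C: "R \<subseteq> C" "C \<subseteq> V" "\<And>x. x \<in> C \<Longrightarrow> f0 x \<in> C" unfolding C_def using X[OF f0(1)] by auto
    have itC: "(f0 ^^ k) x \<in> C" if "x \<in> C" for x k using that C(3) by (induction k) auto
    have gf: "glue C f0 g \<in> forests R" if g: "g \<in> forests C" for g
    proof (rule glue_forests[OF g C(1,2)])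
      fix x assume x: "x \<in> C"
      show "reaches (glue C f0 g) R x"
        by (rule reaches_cong[of f0]) (use x C(2) forestsD(4)[OF f0(1)] itC in \<open>auto simp: glue_def\<close>)
    qed (use C forestsD[OF f0(1)] in auto)
    have kg: "key (glue C f0 g) = key f0" "X (glue C f0 g) = C" if g: "g \<in> forests C" for g
      using loc[OF f0(1), of g] g unfolding key_def C_def by (auto simp: glue_def)
    have inC: "trim C f \<in> forests C \<and> glue C f0 (trim C f) = f" if "f \<in> forests R" "key f = key f0" for f
    proof -
      have XC: "X f = C" and "glue C f id = glue C f0 id" using that(2) unfolding key_def C_def by auto
      then have "f x = f0 x" if "x \<in> C" for x using that unfolding glue_def by metis
      then show ?thesis using trim_forests[OF that(1) C(1,2)] by (auto simp: glue_def trim_def)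
    qed
    define a where "a = (\<Prod>x\<in>C - R. W x (f0 x))"
    have a0: "a \<ge> 0" unfolding a_def by (rule prod_nonneg) (use C W_nonneg in blast)
    have fwC: "X f = C \<and> a * forest_weight C (trim C f) = forest_weight R f" if "f \<in> forests R" "key f = key f0" for f
      using forest_weight_glue[OF C(1,2), of f0 "trim C f"] inC[OF that] that(2) unfolding a_def key_def C_def by simp
    \<comment> \<open>Valid for every \<open>\<psi>\<close>, so that it evaluates both the left
      side, with \<open>\<phi>\<close>, and the total weight of the class, with the constant
      \<open>q\<close>.\<close>
    have eq: "(\<Sum>f\<in>{f \<in> forests R. key f = \<kappa>}. forest_weight R f * \<psi> (X f) (trim (X f) f)) = a * wsum C (\<psi> C)" for \<psi>
    proof -
      have "(\<Sum>f\<in>{f \<in> forests R. key f = \<kappa>}. forest_weight R f * \<psi> (X f) (trim (X f) f)) = (\<Sum>g\<in>forests C. a * (forest_weight C g * \<psi> C g))"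
        by (rule sum.reindex_bij_witness[of _ "glue C f0" "trim C"])
          (use gf kg inC fwC in \<open>auto simp: f0(2) trim_glue mult.assoc[symmetric]\<close>)
      then show ?thesis unfolding wsum_def by (simp add: sum_distrib_left)
    qed
    have "a * wsum C (\<phi> C) \<le> a * (q * Z C)"
      using bound[OF f0(1)] a0 unfolding C_def by (intro mult_left_mono)
    also have "q * Z C = wsum C (\<lambda>_. q)"
      by (simp add: mass_def wsum_def sum_distrib_left mult.commute)
    finally show ?thesis using eq[of \<phi>] eq[of "\<lambda>_ _. q"] by simp
  qed
  have "wsum R (\<lambda>f. \<phi> (X f) (trim (X f) f))
    = (\<Sum>\<kappa>\<in>key ` forests R. \<Sum>f\<in>{f \<in> forests R. key f = \<kappa>}. forest_weight R f * \<phi> (X f) (trim (X f) f))"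
    unfolding wsum_def by (rule sum.image_gen[OF finite_forests])
  also have "\<dots> \<le> (\<Sum>\<kappa>\<in>key ` forests R. \<Sum>f\<in>{f \<in> forests R. key f = \<kappa>}. forest_weight R f * q)"
    by (intro sum_mono cls)
  also have "\<dots> = (\<Sum>f\<in>forests R. forest_weight R f * q)"
    by (rule sum.image_gen[OF finite_forests, symmetric])
  also have "\<dots> = q * Z R" by (simp add: mass_def wsum_def sum_distrib_left mult.commute)
  finally show ?thesis .
qed

text \<open>Given the first \<open>j\<close> steps of the path of \<open>v\<close>, ending in \<open>u\<close>, the next step is \<open>x\<close> with
  probability proportional to \<open>W u x\<close> times the probability that \<open>x\<close> is joined to \<open>R\<close> rather than
  to the vertices already visited.\<close>

lemma hazard_compare:
  fixes \<phi> \<psi> :: "'a \<Rightarrow> 'a \<Rightarrow> real"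
  assumes R: "R \<subseteq> V" and v: "v \<in> V"
    and cmp: "\<And>P u. P \<subseteq> V - R \<Longrightarrow> u \<in> P \<Longrightarrow> card P = Suc j \<Longrightarrow>
      (\<Sum>x\<in>V. W u x * \<phi> u x * mass (R \<union> P) (\<lambda>g. reaches g R x))
      \<le> (\<Sum>x\<in>V. W u x * \<psi> u x * mass (R \<union> P) (\<lambda>g. reaches g R x))"
  shows "wsum R (\<lambda>f. of_bool ((f ^^ j) v \<notin> R) * \<phi> ((f ^^ j) v) ((f ^^ Suc j) v))
    \<le> wsum R (\<lambda>f. of_bool ((f ^^ j) v \<notin> R) * \<psi> ((f ^^ j) v) ((f ^^ Suc j) v))"
proof -
  define F where "F = {f \<in> forests R. (f ^^ j) v \<notin> R}"
  define key where "key f = map (\<lambda>i. (f ^^ i) v) [0..<Suc j]" for f :: "'a \<Rightarrow> 'a"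
  have finF: "finite F" unfolding F_def using finite_forests by simp
  have keyD: "(f ^^ i) v = (g ^^ i) v" if "key f = key g" "i \<le> j" for f g i
    using that unfolding key_def by (auto dest!: bspec[of _ _ i] simp del: upt_Suc)
  \<comment> \<open>\<open>P\<close>, \<open>u\<close> and \<open>c\<close> depend on the class of
    forests with a common initial path but not on \<open>\<phi>\<close>; hence the same data serve
    \<open>\<phi>\<close> and \<open>\<psi>\<close>, and \<open>cmp\<close> can be applied class by
    class.\<close>
  have cls: "\<exists>P u c. P \<subseteq> V - R \<and> u \<in> P \<and> card P = Suc j \<and> c \<ge> 0 \<and>
      (\<forall>\<phi>::'a \<Rightarrow> 'a \<Rightarrow> real. (\<Sum>f\<in>{f \<in> F. key f = \<kappa>}. forest_weight R f * \<phi> ((f ^^ j) v) ((f ^^ Suc j) v))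
        = c * (\<Sum>x\<in>V. W u x * \<phi> u x * mass (R \<union> P) (\<lambda>g. reaches g R x)))"
    if "\<kappa> \<in> key ` F" for \<kappa>
  proof -
    obtain f0 where f0: "f0 \<in> forests R" "(f0 ^^ j) v \<notin> R" "\<kappa> = key f0" using \<open>\<kappa> \<in> _\<close> unfolding F_def by auto
    define p where "p i = (f0 ^^ i) v" for i
    define P where "P = p ` {..j}"
    define u where "u = p j"
    define C where "C = R \<union> P"
    have pR: "p i \<in> V - R" if "i \<le> j" for i
      using forests_absorb[OF f0(1) _ that] f0(2) forests_funpow_in[OF f0(1) v] unfolding p_def by auto
    have pne: False if "a < b" "b \<le> j" "p a = p b" for a b
    proof -
      obtain d where d: "b = Suc d + a" using less_imp_Suc_add[OF \<open>a < b\<close>] by auto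
      have "(f0 ^^ Suc d) (p a) = p b" unfolding p_def d funpow_add o_apply ..
      then have "p a \<in> R" using forests_no_cycle[OF f0(1), of "p a"] that pR[of a] by simp
      then show False using pR[of a] that by auto
    qed
    then have inj: "inj_on p {..j}" by (intro inj_onI) (metis atMost_iff linorder_neqE_nat)
    have P: "P \<subseteq> V - R" "u \<in> P" "card P = Suc j"
      unfolding P_def u_def using pR inj by (auto simp: card_image)
    have C: "R \<subseteq> C" "C \<subseteq> V" unfolding C_def using R P by auto
    have psuc: "f0 (p i) = p (Suc i)" for i unfolding p_def by simp
    define \<alpha> where "\<alpha> x y = (if y = u then x else f0 y)" for x y
    \<comment> \<open>Once the initial path is fixed, a forest amounts to a pair: what is left when
      the roots are enlarged to \<open>C\<close>, and the parent \<open>x\<close> of the endpoint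
      \<open>u\<close>. The maps \<open>to\<close> and \<open>fro\<close> are inverse to each other
      on such pairs.\<close>
    define fro where "fro = (\<lambda>(g, x). glue C (\<alpha> x) g)"
    define to where "to f = (trim C f, f u)" for f
    define D where "D = {(g, x). g \<in> forests C \<and> x \<in> V \<and> reaches g R x}"
    define c where "c = (\<Prod>y\<in>P - {u}. W y (f0 y))"
    have c0: "c \<ge> 0" unfolding c_def
      by (rule prod_nonneg) (use P forestsD(3)[OF f0(1)] W_nonneg in blast)
    \<comment> \<open>All of \<open>C\<close> is absorbing for \<open>g\<close>, so a path that ends
      in \<open>R\<close> never meets \<open>P\<close>. Therefore the new edge from \<open>u\<close>
      to \<open>x\<close> closes no cycle.\<close>
    have avoid: "(g ^^ k) x \<notin> P" if "g \<in> forests C" "reaches g R x" for g x k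
    proof
      assume a: "(g ^^ k) x \<in> P"
      obtain l where l: "(g ^^ l) x \<in> R" using \<open>reaches g R x\<close> unfolding reaches_def by blast
      have "(g ^^ k) x = (g ^^ l) x"
        using forests_absorb[OF \<open>g \<in> _\<close>, of k x l] forests_absorb[OF \<open>g \<in> _\<close>, of l x k] a l C
        unfolding C_def by (metis UnCI linear)
      then show False using a l P by auto
    qed
    have fro_in: "fro (g, x) \<in> {f \<in> F. key f = \<kappa>}" "to (fro (g, x)) = (g, x)"
      "forest_weight R (fro (g, x)) = c * W u x * forest_weight C g"
      "((fro (g, x)) ^^ j) v = u" "((fro (g, x)) ^^ Suc j) v = x" if gx: "(g, x) \<in> D" for g x
    proof -
      let ?f = "glue C (\<alpha> x) g"
      have g: "g \<in> forests C" "x \<in> V" "reaches g R x" using gx unfolding D_def by auto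
      have it: "(?f ^^ i) v = p i" if "i \<le> j" for i
      proof -
        have "?f (p k) = f0 (p k)" if "k < j" for k
        proof -
          have "p k \<noteq> u" using pne[of k j] that unfolding u_def by auto
          then show ?thesis using that unfolding glue_def \<alpha>_def C_def P_def by auto
        qed
        then show ?thesis using that unfolding p_def by (intro funpow_cong_orbit) auto
      qed
      have rx: "reaches ?f R x"
      proof (rule reaches_cong[OF g(3)])
        fix k assume "(g ^^ k) x \<notin> R"
        then have "(g ^^ k) x \<notin> C" using avoid[OF g(1,3)] unfolding C_def by auto
        then show "?f ((g ^^ k) x) = g ((g ^^ k) x)" by (simp add: glue_def)
      qed
      have fu: "?f u = x" using P unfolding glue_def \<alpha>_def C_def by auto
      then have ru: "reaches ?f R u" using reaches_step[of ?f R u] rx by simp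
      have rp: "reaches ?f R (p i)" if "i \<le> j" for i
      proof -
        have "(?f ^^ (j - i)) (p i) = u"
          using that it[of i] it[of j] funpow_add[of "j - i" i ?f] unfolding u_def
          by (simp add: fun_eq_iff)
        then have "(?f ^^ (j - i)) (p i) \<in> {u}" by simp
        then have "reaches ?f {u} (p i)" unfolding reaches_def by blast
        then show ?thesis by (rule reaches_trans) (use ru in auto)
      qed
      have mem: "?f \<in> forests R"
      proof (rule glue_forests[OF g(1) C])
        show "\<alpha> x y \<in> V" if "y \<in> C" for y
          using forestsD(3)[OF f0(1), of y] that C g(2) unfolding \<alpha>_def by (cases "y = u") auto
        show "\<alpha> x y = y" if "y \<in> R" for y
          using forestsD(2)[OF f0(1) that] that P unfolding \<alpha>_def by auto
        show "reaches ?f R y" if "y \<in> C" for y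
          using that rp unfolding C_def P_def by (auto intro: reaches_refl)
      qed
      show "fro (g, x) \<in> {f \<in> F. key f = \<kappa>}"
        using mem it pR[of j] unfolding fro_def F_def f0(3) key_def p_def by auto
      show "to (fro (g, x)) = (g, x)"
        unfolding to_def fro_def using trim_glue[OF g(1)] fu by simp
      show "((fro (g, x)) ^^ j) v = u" using it[of j] unfolding fro_def u_def by simp
      then show "((fro (g, x)) ^^ Suc j) v = x" using fu unfolding fro_def by simp
      have "C - R = P" using P unfolding C_def by auto
      then have "(\<Prod>y\<in>C - R. W y (\<alpha> x y)) = W u (\<alpha> x u) * (\<Prod>y\<in>P - {u}. W y (\<alpha> x y))"
        using P by (simp add: prod.remove P_def)
      also have "\<dots> = W u x * c" unfolding \<alpha>_def c_def by simp
      finally show "forest_weight R (fro (g, x)) = c * W u x * forest_weight C g"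
        unfolding fro_def by (simp add: forest_weight_glue[OF C])
    qed
    have to_in: "to f \<in> D" "fro (to f) = f" if f: "f \<in> {f \<in> F. key f = \<kappa>}" for f
    proof -
      have f': "f \<in> forests R" "key f = key f0" using f unfolding F_def f0(3) by auto
      have it: "(f ^^ i) v = p i" if "i \<le> j" for i using keyD[OF f'(2) that] unfolding p_def .
      have fu: "f u \<in> V" using forestsD(3)[OF f'(1)] P by auto
      have nP: "(f ^^ k) (f u) \<notin> P" for k
      proof
        assume "(f ^^ k) (f u) \<in> P"
        then obtain i where i: "i \<le> j" "(f ^^ k) (f u) = p i" unfolding P_def by auto
        have "(f ^^ (j - i)) (p i) = u"
          using i it[of i] it[of j] funpow_add[of "j - i" i f] unfolding u_def
          by (simp add: fun_eq_iff)
        then have "(f ^^ (j - i + Suc k)) u = u"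
          unfolding funpow_add funpow_Suc_right o_apply i(2) .
        then have "(f ^^ Suc (j - i + k)) u = u" by simp
        then have "u \<in> R" using forests_no_cycle[OF f'(1)] P by blast
        then show False using P by auto
      qed
      have "reaches (trim C f) R (f u)"
      proof (rule reaches_cong[OF forestsD(4)[OF f'(1) fu]])
        fix k assume "(f ^^ k) (f u) \<notin> R"
        then show "trim C f ((f ^^ k) (f u)) = f ((f ^^ k) (f u))"
          using nP[of k] unfolding trim_def C_def by auto
      qed
      then show "to f \<in> D" unfolding to_def D_def using fu trim_forests[OF f'(1) C] by auto
      have agree: "f y = f0 y" if "y \<in> C" "y \<noteq> u" for y
      proof (cases "y \<in> R")
        case True
        then show ?thesis using forestsD(2)[OF f'(1)] forestsD(2)[OF f0(1)] by simp
      next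
        case False
        then obtain i where i: "i \<le> j" "y = p i" using \<open>y \<in> C\<close> unfolding C_def P_def by auto
        then have "i < j" using that unfolding u_def by (cases "i = j") auto
        then show ?thesis using it[of i] it[of "Suc i"] psuc[of i] i by simp
      qed
      then show "fro (to f) = f"
        unfolding to_def fro_def \<alpha>_def glue_def trim_def by auto
    qed
    have to_w: "c * W u (f u) * forest_weight C (trim C f) = forest_weight R f" "(f ^^ j) v = u" if f: "f \<in> {f \<in> F. key f = \<kappa>}" for f
      using to_in[OF f] fro_in(3,4)[of "trim C f" "f u"] unfolding to_def by simp_all
    have "(\<Sum>f\<in>{f \<in> F. key f = \<kappa>}. forest_weight R f * \<phi> ((f ^^ j) v) ((f ^^ Suc j) v))
        = c * (\<Sum>x\<in>V. W u x * \<phi> u x * mass (R \<union> P) (\<lambda>g. reaches g R x))" for \<phi> :: "'a \<Rightarrow> 'a \<Rightarrow> real"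
    proof -
      have "(\<Sum>f\<in>{f \<in> F. key f = \<kappa>}. forest_weight R f * \<phi> ((f ^^ j) v) ((f ^^ Suc j) v))
        = (\<Sum>(g, x)\<in>D. c * W u x * forest_weight C g * \<phi> u x)"
        by (rule sum.reindex_bij_witness[of _ fro to])
          (use fro_in to_in to_w in \<open>auto simp: to_def split: prod.splits\<close>)
      also have "\<dots> = (\<Sum>(g, x)\<in>forests C \<times> V. c * W u x * forest_weight C g * \<phi> u x * of_bool (reaches g R x))"
        by (rule sum.mono_neutral_cong_left) (use finite_forests fin in \<open>auto simp: D_def\<close>)
      also have "\<dots> = (\<Sum>x\<in>V. \<Sum>g\<in>forests C. c * W u x * forest_weight C g * \<phi> u x * of_bool (reaches g R x))"
        unfolding sum.cartesian_product[symmetric] by (rule sum.swap)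
      also have "\<dots> = c * (\<Sum>x\<in>V. W u x * \<phi> u x * mass (R \<union> P) (\<lambda>g. reaches g R x))"
        unfolding mass_def wsum_def sum_distrib_left C_def by (simp add: algebra_simps)
      finally show ?thesis .
    qed
    then show ?thesis using P c0 by blast
  qed
  have split: "wsum R (\<lambda>f. of_bool ((f ^^ j) v \<notin> R) * \<phi> ((f ^^ j) v) ((f ^^ Suc j) v))
    = (\<Sum>\<kappa>\<in>key ` F. \<Sum>f\<in>{f \<in> F. key f = \<kappa>}. forest_weight R f * \<phi> ((f ^^ j) v) ((f ^^ Suc j) v))" for \<phi> :: "'a \<Rightarrow> 'a \<Rightarrow> real"
  proof -
    have "wsum R (\<lambda>f. of_bool ((f ^^ j) v \<notin> R) * \<phi> ((f ^^ j) v) ((f ^^ Suc j) v))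
      = (\<Sum>f\<in>F. forest_weight R f * \<phi> ((f ^^ j) v) ((f ^^ Suc j) v))"
      unfolding wsum_def
      by (rule sum.mono_neutral_cong_right) (use finite_forests in \<open>auto simp: F_def\<close>)
    then show ?thesis unfolding sum.image_gen[OF finF, of _ key] .
  qed
  show ?thesis unfolding split
  proof (rule sum_mono)
    fix \<kappa> assume "\<kappa> \<in> key ` F"
    from cls[OF this] obtain P u c where *: "P \<subseteq> V - R" "u \<in> P" "card P = Suc j" "c \<ge> 0"
      "\<And>\<phi>::'a \<Rightarrow> 'a \<Rightarrow> real. (\<Sum>f\<in>{f \<in> F. key f = \<kappa>}. forest_weight R f * \<phi> ((f ^^ j) v) ((f ^^ Suc j) v))
        = c * (\<Sum>x\<in>V. W u x * \<phi> u x * mass (R \<union> P) (\<lambda>g. reaches g R x))" by blast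
    show "(\<Sum>f\<in>{f \<in> F. key f = \<kappa>}. forest_weight R f * \<phi> ((f ^^ j) v) ((f ^^ Suc j) v))
      \<le> (\<Sum>f\<in>{f \<in> F. key f = \<kappa>}. forest_weight R f * \<psi> ((f ^^ j) v) ((f ^^ Suc j) v))"
      unfolding *(5) using cmp[OF *(1-3)] *(4) by (rule mult_left_mono)
  qed
qed


section \<open>Step probabilities in terms of exit probabilities\<close>

text \<open>All of \<open>R'\<close> is absorbing, so a path reaches \<open>R\<close> exactly if its
  entry point into \<open>R'\<close> lies in \<open>R\<close>. This links
  \<open>hazard_compare\<close> to the harmonic estimates.\<close>

lemma reaches_iff_exits_via:
  assumes g: "g \<in> forests R'" and R: "R \<subseteq> R'" and x: "x \<in> V - R'"
  shows "reaches g R x \<longleftrightarrow> exits_via (\<lambda>_ z. z \<in> R) R' g x"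
proof
  assume "reaches g R x"
  then obtain l where l: "(g ^^ l) x \<in> R" unfolding reaches_def by blast
  define m where "m = (LEAST m. (g ^^ m) x \<in> R')"
  have m: "(g ^^ m) x \<in> R'" unfolding m_def by (rule LeastI[of _ l]) (use l R in auto)
  have "m \<noteq> 0" using m x by (metis DiffE funpow_0)
  then obtain k where k: "m = Suc k" using not0_implies_Suc by blast
  have "(g ^^ k) x \<notin> R'" using not_less_Least[of k "\<lambda>m. (g ^^ m) x \<in> R'"] k unfolding m_def by simp
  moreover have "(g ^^ m) x = (g ^^ l) x"
    using forests_absorb[OF g, of m x l] forests_absorb[OF g, of l x m] m l R
    by (metis linear subsetD)
  ultimately show "exits_via (\<lambda>_ z. z \<in> R) R' g x"
    unfolding exits_via_def using l m k by metis
next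
  assume "exits_via (\<lambda>_ z. z \<in> R) R' g x"
  then show "reaches g R x" unfolding exits_via_def reaches_def by blast
qed

text \<open>The normalising sum of the step probabilities: vertices of \<open>R\<close> are joined
  to \<open>R\<close> with certainty, vertices of \<open>P\<close> never, and the others with an
  exit probability.\<close>

lemma reaches_weights:
  assumes R: "R \<subseteq> V" and P: "P \<subseteq> V - R"
  shows "(\<Sum>x\<in>V. F x * mass (R \<union> P) (\<lambda>g. reaches g R x)) =
    Z (R \<union> P) * (\<Sum>x\<in>R. F x) +
    (\<Sum>x\<in>V - (R \<union> P). F x * mass (R \<union> P) (\<lambda>g. exits_via (\<lambda>_ z. z \<in> R) (R \<union> P) g x))"
proof -
  let ?R = "R \<union> P"
  have fR: "finite R" "finite P" using finite_subset[OF _ fin] R P by auto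
  have V: "V = (R \<union> P) \<union> (V - ?R)" using R P by auto
  have inR: "mass ?R (\<lambda>g. reaches g R x) = Z ?R" if "x \<in> R" for x
    by (intro mass_cong) (use that reaches_refl in auto)
  have inP: "mass ?R (\<lambda>g. reaches g R x) = 0" if "x \<in> P" for x
  proof -
    have "\<not> reaches g R x" if g: "g \<in> forests ?R" for g
    proof
      assume "reaches g R x"
      then obtain l where "(g ^^ l) x \<in> R" unfolding reaches_def by blast
      moreover have "(g ^^ l) x = x"
        using forests_absorb[OF g, of 0 x l] \<open>x \<in> P\<close> by simp
      ultimately show False using \<open>x \<in> P\<close> P by auto
    qed
    then show ?thesis by (simp add: mass_def wsum_def)
  qed
  have "(\<Sum>x\<in>V. F x * mass ?R (\<lambda>g. reaches g R x)) =
    (\<Sum>x\<in>?R. F x * mass ?R (\<lambda>g. reaches g R x)) + (\<Sum>x\<in>V - ?R. F x * mass ?R (\<lambda>g. reaches g R x))"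
    using sum.subset_diff[of ?R V] R P fin by (simp add: add.commute subset_iff)
  also have "(\<Sum>x\<in>?R. F x * mass ?R (\<lambda>g. reaches g R x)) =
    (\<Sum>x\<in>R. F x * mass ?R (\<lambda>g. reaches g R x)) + (\<Sum>x\<in>P. F x * mass ?R (\<lambda>g. reaches g R x))"
    using fR P by (intro sum.union_disjoint) auto
  also have "\<dots> = Z ?R * (\<Sum>x\<in>R. F x)"
    using inR inP by (simp add: sum_distrib_right[symmetric] mult.commute)
  also have "(\<Sum>x\<in>V - ?R. F x * mass ?R (\<lambda>g. reaches g R x))
    = (\<Sum>x\<in>V - ?R. F x * mass ?R (\<lambda>g. exits_via (\<lambda>_ z. z \<in> R) ?R g x))"
  proof (rule sum.cong[OF refl])
    fix x assume x: "x \<in> V - ?R"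
    have "mass ?R (\<lambda>g. reaches g R x) = mass ?R (\<lambda>g. exits_via (\<lambda>_ z. z \<in> R) ?R g x)"
      by (intro mass_cong reaches_iff_exits_via) (use x in auto)
    then show "F x * mass ?R (\<lambda>g. reaches g R x) = F x * mass ?R (\<lambda>g. exits_via (\<lambda>_ z. z \<in> R) ?R g x)"
      by simp
  qed
  finally show ?thesis .
qed

text \<open>The hypothesis says that, given any initial path of \<open>j\<close> steps outside
  \<open>R\<close>, the next step enters \<open>R\<close> with probability at least
  \<open>\<theta>\<close>.\<close>

lemma mass_decay:
  assumes R: "R \<subseteq> V" and v: "v \<in> V"
    and cmp: "\<And>P u. P \<subseteq> V - R \<Longrightarrow> u \<in> P \<Longrightarrow> card P = Suc j \<Longrightarrow>
      \<theta> * (\<Sum>x\<in>V. W u x * mass (R \<union> P) (\<lambda>g. reaches g R x)) \<le> Z (R \<union> P) * (\<Sum>x\<in>R. W u x)"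
  shows "mass R (\<lambda>f. (f ^^ Suc j) v \<notin> R) \<le> (1 - \<theta>) * mass R (\<lambda>f. (f ^^ j) v \<notin> R)"
proof -
  have "wsum R (\<lambda>f. of_bool ((f ^^ j) v \<notin> R) * \<theta>)
    \<le> wsum R (\<lambda>f. of_bool ((f ^^ j) v \<notin> R) * of_bool ((f ^^ Suc j) v \<in> R))"
  proof (rule hazard_compare[OF R v, of j "\<lambda>_ _. \<theta>" "\<lambda>_ x. of_bool (x \<in> R)"])
    fix P u assume P: "P \<subseteq> V - R" "u \<in> P" "card P = Suc j"
    have "(\<Sum>x\<in>V. W u x * of_bool (x \<in> R) * mass (R \<union> P) (\<lambda>g. reaches g R x)) = Z (R \<union> P) * (\<Sum>x\<in>R. W u x)"
      unfolding reaches_weights[OF R P(1), of "\<lambda>x. W u x * of_bool (x \<in> R)"] by (auto intro!: sum.neutral)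
    then show "(\<Sum>x\<in>V. W u x * \<theta> * mass (R \<union> P) (\<lambda>g. reaches g R x))
      \<le> (\<Sum>x\<in>V. W u x * of_bool (x \<in> R) * mass (R \<union> P) (\<lambda>g. reaches g R x))"
      using cmp[OF P] by (simp add: sum_distrib_left algebra_simps)
  qed
  moreover have "wsum R (\<lambda>f. of_bool ((f ^^ j) v \<notin> R) * \<theta>) = \<theta> * mass R (\<lambda>f. (f ^^ j) v \<notin> R)"
    unfolding mass_def wsum_cmult[symmetric] by (simp add: mult.commute)
  moreover have "mass R (\<lambda>f. (f ^^ j) v \<notin> R) =
      wsum R (\<lambda>f. of_bool ((f ^^ j) v \<notin> R) * of_bool ((f ^^ Suc j) v \<in> R)) + mass R (\<lambda>f. (f ^^ Suc j) v \<notin> R)"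
    unfolding mass_def wsum_add[symmetric]
  proof (rule wsum_cong)
    fix f assume f: "f \<in> forests R"
    show "(of_bool ((f ^^ j) v \<notin> R) :: real) =
      of_bool ((f ^^ j) v \<notin> R) * of_bool ((f ^^ Suc j) v \<in> R) + of_bool ((f ^^ Suc j) v \<notin> R)"
      using forests_absorb[OF f, of j v "Suc j"] by (cases "(f ^^ j) v \<in> R") auto
  qed
  ultimately show ?thesis by (simp add: algebra_simps)
qed

end


section \<open>Sparse perturbations of the complete graph\<close>

text \<open>\<open>Sp\<close> marks the pairs of weight \<open>B\<close>. Both \<open>B < 1\<close>
  and \<open>B \<ge> 1\<close> occur, since \<open>n powr (1 + \<gamma>)\<close> drops below 1 for
  \<open>\<gamma> < -1\<close>; several estimates need separate arguments for the two cases.\<close>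

locale sparse_network = network V W for V :: "'a set" and W +
  fixes Sp :: "'a \<Rightarrow> 'a \<Rightarrow> bool" and B D :: real and r :: 'a
  assumes W_eq: "u \<noteq> v \<Longrightarrow> W u v = (if Sp u v then B else 1)"
    and Sp_sym: "Sp u v = Sp v u"
    and degree: "u \<in> V \<Longrightarrow> real (card {v \<in> V. Sp u v}) \<le> D"
    and B_pos: "B > 0"
    and root: "r \<in> V" "\<not> Sp r v"
begin

abbreviation "n \<equiv> real (card V)"

lemma n_pos: "n > 0" using root(1) fin by (simp add: card_gt_0_iff) blast

lemma D_nonneg: "D \<ge> 0" using degree[OF root(1)] by linarith

section \<open>Weight from a vertex into a set\<close>

lemma Sp_count:
  assumes "u \<in> V" "R \<subseteq> V"
  shows "(\<Sum>z\<in>R. of_bool (Sp u z)) \<le> D"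
proof -
  have fR: "finite R" using finite_subset[OF assms(2) fin] .
  have "(\<Sum>z\<in>R. of_bool (Sp u z)) = real (card {z \<in> R. Sp u z})"
    using fR by (simp add: of_bool_def sum.If_cases Int_def)
  also have "\<dots> \<le> real (card {v \<in> V. Sp u v})"
    using assms(2) fin by (intro of_nat_mono card_mono) auto
  finally show ?thesis using degree[OF assms(1)] by simp
qed

lemma W_le: "W u v \<le> 1 + B * of_bool (Sp u v)"
  using W_eq[of u v] W_self[of u] B_pos by (cases "u = v") auto

lemma W_le1: "B \<le> 1 \<or> \<not> Sp u v \<Longrightarrow> W u v \<le> 1"
  using W_eq[of u v] W_self[of u] B_pos by (cases "u = v") auto

lemma W_ge: "u \<noteq> v \<Longrightarrow> W u v \<ge> 1 - of_bool (Sp u v)"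
  using W_eq[of u v] B_pos by auto

lemma W_ge1: "u \<noteq> v \<Longrightarrow> B \<ge> 1 \<Longrightarrow> W u v \<ge> 1"
  using W_eq[of u v] by auto

lemma W_root: "v \<noteq> r \<Longrightarrow> W v r = 1"
  using W_eq[of v r] Sp_sym root by auto

lemma sum_W_le:
  assumes "u \<in> V" "R \<subseteq> V"
  shows "(\<Sum>z\<in>R. W u z) \<le> real (card R) + B * D"
proof -
  have "(\<Sum>z\<in>R. W u z) \<le> (\<Sum>z\<in>R. 1 + B * of_bool (Sp u z))" by (intro sum_mono W_le)
  also have "\<dots> = real (card R) + B * (\<Sum>z\<in>R. of_bool (Sp u z))"
    by (simp only: sum.distrib sum_distrib_left[symmetric]) simp
  also have "\<dots> \<le> real (card R) + B * D" using Sp_count[OF assms] B_pos by simp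
  finally show ?thesis .
qed

lemma sum_W_ge:
  assumes "u \<in> V" "R \<subseteq> V" "u \<notin> R"
  shows "(\<Sum>z\<in>R. W u z) \<ge> real (card R) - D"
proof -
  have "real (card R) - D \<le> real (card R) - (\<Sum>z\<in>R. of_bool (Sp u z))"
    using Sp_count[OF assms(1,2)] by simp
  also have "\<dots> = (\<Sum>z\<in>R. 1 - of_bool (Sp u z))" by (simp only: sum_subtractf) simp
  also have "\<dots> \<le> (\<Sum>z\<in>R. W u z)" using assms(3) by (intro sum_mono W_ge) auto
  finally show ?thesis .
qed

lemma sum_W_ge_half:
  assumes "u \<in> V" "R \<subseteq> V" "u \<notin> R" "2 * D \<le> real (card R)"
  shows "(\<Sum>z\<in>R. W u z) \<ge> real (card R) / 2"
  using sum_W_ge[OF assms(1-3)] assms(4) by linarith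

lemma sum_W_ge1:
  assumes "R \<subseteq> V" "u \<notin> R" "B \<ge> 1"
  shows "(\<Sum>z\<in>R. W u z) \<ge> real (card R)"
proof -
  have "(\<Sum>z\<in>R. W u z) \<ge> (\<Sum>z\<in>R. 1)" using assms(2,3) by (intro sum_mono W_ge1) auto
  then show ?thesis by simp
qed

lemma conductance_le: "u \<in> V \<Longrightarrow> B * D \<le> n \<Longrightarrow> conductance u \<le> 2 * n"
  unfolding conductance_def using sum_W_le[of u V] by simp

section \<open>Upper tails of path lengths\<close>

text \<open>Each step enters \<open>R\<close> with probability at least
  \<open>(card R / 2) / (2 * n)\<close>: the numerator bounds the weight into \<open>R\<close> from
  below, and the denominator bounds the normalising sum by the conductance.\<close>

lemma hit_decay:
  assumes R: "R \<subseteq> V" and v: "v \<in> V" and s: "2 * D \<le> real (card R)" and BD: "B * D \<le> n"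
  shows "mass R (\<lambda>f. (f ^^ j) v \<notin> R) \<le> (1 - real (card R) / (4 * n)) ^ j * Z R"
proof (induction j)
  case 0
  then show ?case using mass_le_Z by simp
next
  case (Suc j)
  let ?\<theta> = "real (card R) / (4 * n)"
  have "mass R (\<lambda>f. (f ^^ Suc j) v \<notin> R) \<le> (1 - ?\<theta>) * mass R (\<lambda>f. (f ^^ j) v \<notin> R)"
  proof (rule mass_decay[OF R v])
    fix P u assume P: "P \<subseteq> V - R" "u \<in> P" "card P = Suc j"
    have u: "u \<in> V" "u \<notin> R" using P by auto
    have "(\<Sum>x\<in>V. W u x * mass (R \<union> P) (\<lambda>g. reaches g R x)) \<le> (\<Sum>x\<in>V. W u x * Z (R \<union> P))"
      using u W_nonneg by (intro sum_mono mult_left_mono mass_le_Z) auto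
    also have "\<dots> = conductance u * Z (R \<union> P)" unfolding conductance_def by (simp add: sum_distrib_right)
    also have "\<dots> \<le> 2 * n * Z (R \<union> P)" using conductance_le[OF u(1) BD] by (intro mult_right_mono) auto
    finally have "?\<theta> * (\<Sum>x\<in>V. W u x * mass (R \<union> P) (\<lambda>g. reaches g R x)) \<le> ?\<theta> * (2 * n * Z (R \<union> P))"
      by (intro mult_left_mono) auto
    also have "\<dots> = Z (R \<union> P) * (real (card R) / 2)" using n_pos by simp
    also have "\<dots> \<le> Z (R \<union> P) * (\<Sum>x\<in>R. W u x)"
      using sum_W_ge_half[OF u(1) R u(2) s] by (intro mult_left_mono) auto
    finally show "?\<theta> * (\<Sum>x\<in>V. W u x * mass (R \<union> P) (\<lambda>g. reaches g R x)) \<le> Z (R \<union> P) * (\<Sum>x\<in>R. W u x)" .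
  qed
  also have "\<dots> \<le> (1 - ?\<theta>) * ((1 - ?\<theta>) ^ j * Z R)"
  proof (rule mult_left_mono[OF Suc])
    have "real (card R) \<le> n" using card_mono[OF fin R] by simp
    then show "0 \<le> 1 - ?\<theta>" using n_pos by (simp add: divide_simps)
  qed
  finally show ?case by simp
qed

text \<open>Once the path has \<open>j\<close> vertices, any other vertex is joined to \<open>r\<close> rather than to the path
  with probability at most of order \<open>1 / j\<close>, so the step to \<open>r\<close> has probability of order \<open>j / n\<close>.\<close>

lemma root_decay:
  assumes v: "v \<in> V" and BD: "B * D \<le> n" and j: "2 * D \<le> real (Suc (Suc j))" "sqrt n \<le> real (Suc (Suc j))"
    and n1: "n \<ge> 1"
  shows "mass {r} (\<lambda>f. (f ^^ Suc j) v \<notin> {r}) \<le> (1 - 1 / (5 * sqrt n)) * mass {r} (\<lambda>f. (f ^^ j) v \<notin> {r})"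
proof (rule mass_decay[OF _ v])
  show "{r} \<subseteq> V" using root by simp
  fix P u assume P: "P \<subseteq> V - {r}" "u \<in> P" "card P = Suc j"
  let ?R = "{r} \<union> P"
  let ?h = "\<lambda>x. mass ?R (\<lambda>g. exits_via (\<lambda>_ z. z \<in> {r}) ?R g x)"
  have u: "u \<in> V" "u \<noteq> r" using P by auto
  have R: "?R \<subseteq> V" "?R \<noteq> {}" using P root by auto
  have fP: "finite P" using P(3) card.infinite by fastforce
  have cR: "card ?R = Suc (Suc j)" using P fP by (auto simp: card_insert_if)
  have sn1: "sqrt n \<ge> 1" using real_sqrt_ge_one[OF n1] .
  then have sn: "sqrt n > 0" by linarith
  \<comment> \<open>The weight from \<open>x\<close> to \<open>r\<close> is 1 out of a total of at
    least \<open>sqrt n / 2\<close> into \<open>?R\<close>. The normalising sum is then at most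
    \<open>1 + 2 * n * (2 / sqrt n) \<le> 5 * sqrt n\<close>, against weight 1 for the step to
    \<open>r\<close>.\<close>
  have h: "?h x \<le> 2 / sqrt n * Z ?R" if x: "x \<in> V - ?R" for x
  proof (rule exits_via_le[OF R _ x])
    fix x assume x: "x \<in> V - ?R"
    have "exit_weight (\<lambda>_ z. z \<in> {r}) ?R x = (\<Sum>y\<in>{r}. W x y)"
      unfolding exit_weight_def using P fP by (intro sum.mono_neutral_cong_right) auto
    also have "\<dots> = 1" using W_root[of x] x by auto
    also have "\<dots> \<le> 2 / sqrt n * (real (Suc (Suc j)) / 2)"
      using j(2) sn by (simp add: divide_simps)
    also have "\<dots> \<le> 2 / sqrt n * (\<Sum>z\<in>?R. W x z)"
      using sum_W_ge_half[of x ?R] x R cR j(1) sn by (intro mult_left_mono) auto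
    finally show "exit_weight (\<lambda>_ z. z \<in> {r}) ?R x \<le> 2 / sqrt n * (\<Sum>z\<in>?R. W x z)" .
  qed
  have "(\<Sum>x\<in>V - ?R. W u x * ?h x) \<le> (\<Sum>x\<in>V - ?R. W u x * (2 / sqrt n * Z ?R))"
    using u W_nonneg by (intro sum_mono mult_left_mono h) auto
  also have "\<dots> = (\<Sum>x\<in>V - ?R. W u x) * (2 / sqrt n * Z ?R)" by (rule sum_distrib_right[symmetric])
  also have "\<dots> \<le> 2 * n * (2 / sqrt n * Z ?R)"
  proof (rule mult_right_mono)
    have "(\<Sum>x\<in>V - ?R. W u x) \<le> conductance u"
      unfolding conductance_def using u W_nonneg fin by (intro sum_mono2) auto
    then show "(\<Sum>x\<in>V - ?R. W u x) \<le> 2 * n" using conductance_le[OF u(1) BD] by simp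
  qed (use sn in simp)
  also have "\<dots> = 4 * sqrt n * Z ?R"
    using sn by (simp add: field_simps real_sqrt_mult_self)
  finally have *: "(\<Sum>x\<in>V - ?R. W u x * ?h x) \<le> 4 * sqrt n * Z ?R" .
  have Wur: "(\<Sum>x\<in>{r}. W u x) = 1" using W_root[of u] u by simp
  have "(\<Sum>x\<in>V. W u x * mass ?R (\<lambda>g. reaches g {r} x)) \<le> (1 + 4 * sqrt n) * Z ?R"
    using * reaches_weights[of "{r}" P "W u"] P root Wur by (simp add: algebra_simps)
  also have "\<dots> \<le> 5 * sqrt n * Z ?R" using sn1 by (intro mult_right_mono mass_nonneg) linarith
  finally have "1 / (5 * sqrt n) * (\<Sum>x\<in>V. W u x * mass ?R (\<lambda>g. reaches g {r} x))
    \<le> 1 / (5 * sqrt n) * (5 * sqrt n * Z ?R)" using sn by (intro mult_left_mono) auto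
  also have "\<dots> = Z ?R * (\<Sum>x\<in>{r}. W u x)" using sn Wur by simp
  finally show "1 / (5 * sqrt n) * (\<Sum>x\<in>V. W u x * mass ?R (\<lambda>g. reaches g {r} x)) \<le> Z ?R * (\<Sum>x\<in>{r}. W u x)" .
qed

text \<open>The first \<open>a\<close> steps only make the path long enough for
  \<open>root_decay\<close>; every later step contributes a factor.\<close>

lemma root_dist_tail:
  assumes v: "v \<in> V" and BD: "B * D \<le> n" and D: "2 * D \<le> sqrt n" and n1: "n \<ge> 1" and a: "sqrt n \<le> real a"
  shows "mass {r} (\<lambda>f. (f ^^ (a + t)) v \<notin> {r}) \<le> (1 - 1 / (5 * sqrt n)) ^ t * Z {r}"
proof (induction t)
  case (Suc t)
  have "mass {r} (\<lambda>f. (f ^^ Suc (a + t)) v \<notin> {r}) \<le> (1 - 1 / (5 * sqrt n)) * mass {r} (\<lambda>f. (f ^^ (a + t)) v \<notin> {r})"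
    by (rule root_decay[OF v BD _ _ n1]) (use D a in auto)
  also have "\<dots> \<le> (1 - 1 / (5 * sqrt n)) * ((1 - 1 / (5 * sqrt n)) ^ t * Z {r})"
  proof (rule mult_left_mono[OF Suc])
    have "5 * sqrt n \<ge> 1" using real_sqrt_ge_one[OF n1] by linarith
    then show "0 \<le> 1 - 1 / (5 * sqrt n)" using divide_le_eq_1_pos[of "5 * sqrt n" 1] by linarith
  qed
  finally show ?case by simp
qed (use mass_le_Z in simp)

section \<open>Lower bounds on path lengths\<close>

lemma exit_weight_mem:
  assumes "R \<subseteq> R'" "finite R'"
  shows "exit_weight (\<lambda>_ z. z \<in> R) R' x = (\<Sum>y\<in>R. W x y)"
  unfolding exit_weight_def using assms by (intro sum.mono_neutral_cong_right) auto

text \<open>For \<open>B \<ge> 1\<close> the bound is derived for the target \<open>r\<close> alone, where no heavy edge can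
  distort the hitting probabilities, and transferred to \<open>R\<close> by the comparison principle.\<close>

lemma escape_sum_ge:
  assumes R: "R \<subseteq> V" "r \<in> R" and P: "P \<subseteq> V - R"
    and s': "real (card (R \<union> P)) + D + B * D \<le> n / 2"
  shows "(\<Sum>x\<in>V - (R \<union> P). mass (R \<union> P) (\<lambda>g. exits_via (\<lambda>_ z. z \<in> R) (R \<union> P) g x))
    \<ge> real (card R) * n / (2 * real (card (R \<union> P))) * Z (R \<union> P)"
proof -
  define R' where "R' = R \<union> P"
  define s where "s = real (card R)"
  define s' where "s' = real (card R')"
  let ?h = "\<lambda>R x. mass R' (\<lambda>g. exits_via (\<lambda>_ z. z \<in> R) R' g x)"
  have R': "R' \<subseteq> V" "R \<subseteq> R'" "R' \<noteq> {}" "finite R'" "r \<in> R'"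
    unfolding R'_def using R P finite_subset[OF _ fin] by (blast, blast, blast, blast, blast)
  have fR: "finite R" using R' finite_subset by blast
  have cV: "real (card (V - R')) = n - s'"
    unfolding s'_def using R' fin card_mono[OF fin R'(1)] by (simp add: card_Diff_subset of_nat_diff)
  have s'0: "s' > 0" unfolding s'_def using R' by (simp add: card_gt_0_iff)
  have s0: "s > 0" unfolding s_def using fR R by (auto simp: card_gt_0_iff)
  have cond: "s' + D + B * D \<le> n / 2" using s' unfolding s'_def R'_def .
  have BD0: "B * D \<ge> 0" using B_pos D_nonneg by simp
  have "s * (n / 2) * Z R' \<le> s' * (\<Sum>x\<in>V - R'. ?h R x)"
  proof (cases "B \<le> 1")
    case True
    \<comment> \<open>With all weights at most 1 the flux identity suffices: the total weight
      between \<open>R\<close> and the outside is at least \<open>s * (n - s' - D)\<close>, while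
      each \<open>y\<close> sends at most \<open>s'\<close> into \<open>R'\<close>.\<close>
    have "s * (n / 2) \<le> s * (n - s' - D)"
      using cond BD0 s0 by (intro mult_left_mono) auto
    also have "\<dots> = (\<Sum>y\<in>R. n - s' - D)" unfolding s_def by simp
    also have "\<dots> \<le> (\<Sum>y\<in>R. \<Sum>x\<in>V - R'. W y x)"
      using sum_W_ge[of _ "V - R'"] R R' cV by (intro sum_mono) (fastforce simp: subset_iff)
    also have "\<dots> = (\<Sum>x\<in>V - R'. \<Sum>y\<in>R. W x y)"
      by (subst sum.swap) (intro sum.cong refl W_sym)
    finally have "Z R' * (s * (n / 2)) \<le> Z R' * (\<Sum>x\<in>V - R'. \<Sum>y\<in>R. W x y)"
      by (rule mult_left_mono) simp
    then have "s * (n / 2) * Z R' \<le> Z R' * (\<Sum>x\<in>V - R'. exit_weight (\<lambda>_ z. z \<in> R) R' x)"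
      using exit_weight_mem[OF R'(2,4)] by (simp add: mult.commute)
    also have "\<dots> = (\<Sum>y\<in>V - R'. ?h R y * (\<Sum>z\<in>R'. W y z))"
      by (rule exits_via_flux[OF R'(1), symmetric])
    also have "\<dots> \<le> (\<Sum>y\<in>V - R'. ?h R y * s')"
    proof (intro sum_mono mult_left_mono)
      fix y
      have "(\<Sum>z\<in>R'. W y z) \<le> (\<Sum>z\<in>R'. 1)" using True by (intro sum_mono W_le1) auto
      then show "(\<Sum>z\<in>R'. W y z) \<le> s'" unfolding s'_def by simp
    qed simp
    finally show ?thesis by (simp add: sum_distrib_left mult.commute)
  next
    case False
    then have B1: "B \<ge> 1" by simp
    have ex_r: "exit_weight (\<lambda>_ z. z \<in> {r}) R' x = 1" if "x \<in> V - R'" for x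
      using exit_weight_mem[of "{r}" R' x] R' that W_root[of x] by auto
    \<comment> \<open>This pointwise bound tames the heavy terms in the flux identity below: each of
      the \<open>s'\<close> vertices of \<open>R'\<close> has at most \<open>D\<close> heavy edges,
      so they sum to at most \<open>1 / s' * s' * B * D\<close> times \<open>Z R'\<close>.\<close>
    have hr: "?h {r} x \<le> 1 / s' * Z R'" if x: "x \<in> V - R'" for x
    proof (rule exits_via_le[OF R'(1,3) _ x])
      fix x assume x: "x \<in> V - R'"
      have "1 \<le> 1 / s' * s'" using s'0 by simp
      also have "\<dots> \<le> 1 / s' * (\<Sum>z\<in>R'. W x z)"
        using sum_W_ge1[OF R'(1) _ B1, of x] x s'0 unfolding s'_def by (intro mult_left_mono) auto
      finally show "exit_weight (\<lambda>_ z. z \<in> {r}) R' x \<le> 1 / s' * (\<Sum>z\<in>R'. W x z)" using ex_r[OF x] by simp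
    qed
    have "Z R' * (n - s') = Z R' * (\<Sum>x\<in>V - R'. exit_weight (\<lambda>_ z. z \<in> {r}) R' x)"
      using ex_r cV by simp
    also have "\<dots> = (\<Sum>y\<in>V - R'. ?h {r} y * (\<Sum>z\<in>R'. W y z))"
      by (rule exits_via_flux[OF R'(1), symmetric])
    also have "\<dots> \<le> (\<Sum>y\<in>V - R'. ?h {r} y * (\<Sum>z\<in>R'. 1 + B * of_bool (Sp y z)))"
      by (intro sum_mono mult_left_mono W_le) simp
    also have "\<dots> = (\<Sum>y\<in>V - R'. s' * ?h {r} y + ?h {r} y * (B * (\<Sum>z\<in>R'. of_bool (Sp y z))))"
      unfolding s'_def by (intro sum.cong refl) (simp add: sum.distrib sum_distrib_left[symmetric] distrib_left)
    also have "\<dots> \<le> (\<Sum>y\<in>V - R'. s' * ?h {r} y + 1 / s' * Z R' * (B * (\<Sum>z\<in>R'. of_bool (Sp y z))))"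
      using hr B_pos by (intro sum_mono add_left_mono mult_right_mono) (auto intro!: mult_nonneg_nonneg sum_nonneg)
    also have "\<dots> = s' * (\<Sum>y\<in>V - R'. ?h {r} y) + 1 / s' * Z R' * B * (\<Sum>y\<in>V - R'. \<Sum>z\<in>R'. of_bool (Sp y z))"
      by (simp add: sum.distrib sum_distrib_left mult.assoc)
    also have "(\<Sum>y\<in>V - R'. \<Sum>z\<in>R'. of_bool (Sp y z)) = (\<Sum>z\<in>R'. \<Sum>y\<in>V - R'. of_bool (Sp z y) :: real)"
      by (subst sum.swap, subst Sp_sym) (rule refl)
    also have "1 / s' * Z R' * B * (\<Sum>z\<in>R'. \<Sum>y\<in>V - R'. of_bool (Sp z y)) \<le> 1 / s' * Z R' * B * (\<Sum>z\<in>R'. D)"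
      using s'0 B_pos R' Sp_count[of _ "V - R'"] by (intro mult_left_mono sum_mono) (auto simp: subset_iff)
    also have "\<dots> = Z R' * (B * D)" using s'0 unfolding s'_def by simp
    finally have "Z R' * (n - s' - B * D) \<le> s' * (\<Sum>y\<in>V - R'. ?h {r} y)" by (simp add: algebra_simps)
    moreover have "Z R' * (n / 2) \<le> Z R' * (n - s' - B * D)"
      using cond D_nonneg by (intro mult_left_mono) auto
    ultimately have "s * (Z R' * (n / 2)) \<le> s * (s' * (\<Sum>y\<in>V - R'. ?h {r} y))"
      using s0 by (intro mult_left_mono) auto
    also have "\<dots> = s' * (\<Sum>y\<in>V - R'. s * ?h {r} y)"
      unfolding sum_distrib_left[of s, symmetric] by (rule mult.left_commute)
    \<comment> \<open>A vertex outside \<open>R'\<close> has weight 1 to \<open>r\<close> and at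
      least \<open>s\<close> to \<open>R\<close>, so the comparison principle gains the factor
      \<open>s\<close>.\<close>
    also have "\<dots> \<le> s' * (\<Sum>y\<in>V - R'. ?h R y)"
    proof (intro mult_left_mono sum_mono exits_via_compare[OF R'(1,3)])
      fix x assume "x \<in> V - R'"
      then show "s * exit_weight (\<lambda>_ z. z \<in> {r}) R' x \<le> exit_weight (\<lambda>_ z. z \<in> R) R' x"
        using ex_r exit_weight_mem[OF R'(2,4)] sum_W_ge1[OF R(1) _ B1, of x] R' unfolding s_def by auto
    qed (use s'0 in auto)
    finally show ?thesis by (simp add: algebra_simps)
  qed
  then have "s * n / (2 * s') * Z R' \<le> (\<Sum>x\<in>V - R'. ?h R x)"
    using s'0 by (simp add: divide_simps mult.commute)
  then show ?thesis unfolding s_def s'_def R'_def .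
qed

text \<open>Designed so that a light step has weight at most 1. Light steps admit a bound from every
  starting vertex; the remaining ones are treated on average.\<close>

definition light :: "'a \<Rightarrow> 'a \<Rightarrow> bool" where "light u x \<longleftrightarrow> B \<le> 1 \<or> \<not> Sp u x"

text \<open>The light weight into \<open>R\<close> is at most \<open>card R\<close>, and by
  \<open>escape_sum_ge\<close> the normalising sum is at least
  \<open>card R * n / (4 * (card R + Suc j))\<close>. In the quotient \<open>card R\<close>
  cancels.\<close>

lemma light_hit_le:
  assumes R: "R \<subseteq> V" "r \<in> R" and v: "v \<in> V"
    and c: "real (card R + Suc j) + D + B * D \<le> n / 2" "4 * D * real (card R + Suc j) \<le> n"
  shows "mass R (\<lambda>f. (f ^^ j) v \<notin> R \<and> (f ^^ Suc j) v \<in> R \<and> light ((f ^^ j) v) ((f ^^ Suc j) v))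
    \<le> 4 * real (card R + Suc j) / n * Z R"
proof -
  let ?\<theta> = "4 * real (card R + Suc j) / n"
  have fR: "finite R" using finite_subset[OF R(1) fin] .
  have "card R > 0" using fR R by (auto simp: card_gt_0_iff)
  then have s0: "real (card R) \<ge> 1" by linarith
  have "wsum R (\<lambda>f. of_bool ((f ^^ j) v \<notin> R) * of_bool ((f ^^ Suc j) v \<in> R \<and> light ((f ^^ j) v) ((f ^^ Suc j) v)))
    \<le> wsum R (\<lambda>f. of_bool ((f ^^ j) v \<notin> R) * ?\<theta>)"
  proof (rule hazard_compare[OF R(1) v, of j "\<lambda>u x. of_bool (x \<in> R \<and> light u x)" "\<lambda>_ _. ?\<theta>"])
    fix P u assume P: "P \<subseteq> V - R" "u \<in> P" "card P = Suc j"
    let ?R = "R \<union> P"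
    let ?h = "\<lambda>x. mass ?R (\<lambda>g. exits_via (\<lambda>_ z. z \<in> R) ?R g x)"
    have u: "u \<in> V" "u \<notin> R" using P by auto
    have fP: "finite P" using P(3) card.infinite by fastforce
    have cR: "card ?R = card R + Suc j" using P fP fR by (subst card_Un_disjoint) auto
    have "(\<Sum>x\<in>V. W u x * of_bool (x \<in> R \<and> light u x) * mass ?R (\<lambda>g. reaches g R x))
      = Z ?R * (\<Sum>x\<in>R. W u x * of_bool (x \<in> R \<and> light u x))"
      unfolding reaches_weights[OF R(1) P(1), of "\<lambda>x. W u x * of_bool (x \<in> R \<and> light u x)"]
      by (auto intro!: sum.neutral)
    also have "\<dots> \<le> Z ?R * (\<Sum>x\<in>R. 1)"
      by (intro mult_left_mono sum_mono) (use W_le1 in \<open>auto simp: light_def\<close>)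
    also have "\<dots> = real (card R) * Z ?R" by simp
    also have "\<dots> = ?\<theta> * (real (card R) * n / (4 * real (card R + Suc j)) * Z ?R)"
    proof -
      have "s * z = 4 * a / m * (s * m / (4 * a) * z)" if "a > 0" "m > 0" for s z a m :: real
        using that by simp
      then show ?thesis using n_pos by simp
    qed
    also have "\<dots> \<le> ?\<theta> * (\<Sum>x\<in>V - ?R. W u x * ?h x)"
    proof (rule mult_left_mono)
      have esc: "(\<Sum>x\<in>V - ?R. ?h x) \<ge> real (card R) * n / (2 * real (card R + Suc j)) * Z ?R"
        using escape_sum_ge[OF R P(1)] c(1) unfolding cR by simp
      have "D \<le> real (card R) * n / (4 * real (card R + Suc j))"
      proof -
        have "4 * D * real (card R + Suc j) \<le> real (card R) * n"
          using c(2) s0 n_pos mult_right_mono[of 1 "real (card R)" n] by linarith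
        then show ?thesis by (simp add: field_simps)
      qed
      then have DZ: "D * Z ?R \<le> real (card R) * n / (4 * real (card R + Suc j)) * Z ?R"
        by (intro mult_right_mono) auto
      \<comment> \<open>Edges of weight \<open>B\<close> may be arbitrarily light, so their
        endpoints are discarded: there are at most \<open>D\<close> of them, each worth at most
        \<open>Z ?R\<close>.\<close>
      have "(\<Sum>x\<in>V - ?R. ?h x) - D * Z ?R \<le> (\<Sum>x\<in>V - ?R. ?h x) - (\<Sum>x\<in>V - ?R. of_bool (Sp u x)) * Z ?R"
        using Sp_count[OF u(1), of "V - ?R"] by (intro diff_left_mono mult_right_mono) auto
      also have "\<dots> = (\<Sum>x\<in>V - ?R. ?h x - of_bool (Sp u x) * Z ?R)"
        by (simp only: sum_subtractf sum_distrib_right)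
      also have "\<dots> \<le> (\<Sum>x\<in>V - ?R. W u x * ?h x)"
      proof (intro sum_mono)
        fix x assume x: "x \<in> V - ?R"
        have "?h x - of_bool (Sp u x) * Z ?R \<le> (1 - of_bool (Sp u x)) * ?h x"
          using mass_le_Z[of ?R] by auto
        also have "\<dots> \<le> W u x * ?h x" using W_ge[of u x] \<open>u \<in> P\<close> x by (intro mult_right_mono mass_nonneg) blast
        finally show "?h x - of_bool (Sp u x) * Z ?R \<le> W u x * ?h x" .
      qed
      finally have A: "(\<Sum>x\<in>V - ?R. ?h x) - D * Z ?R \<le> (\<Sum>x\<in>V - ?R. W u x * ?h x)" .
      have eq: "real (card R) * n / (2 * real (card R + Suc j)) * Z ?R
        = 2 * (real (card R) * n / (4 * real (card R + Suc j)) * Z ?R)"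
      proof -
        have "x / (2 * a) * z = 2 * (x / (4 * a) * z)" for x a z :: real by simp
        then show ?thesis .
      qed
      have "b \<le> X" if "a \<le> H" "a = 2 * b" "d \<le> b" "H - d \<le> X" for a b d H X :: real
        using that by linarith
      from this[OF esc eq DZ A]
      show "real (card R) * n / (4 * real (card R + Suc j)) * Z ?R \<le> (\<Sum>x\<in>V - ?R. W u x * ?h x)" .
    qed (use n_pos in simp)
    also have "\<dots> \<le> ?\<theta> * (\<Sum>x\<in>V. W u x * mass ?R (\<lambda>g. reaches g R x))"
    proof (rule mult_left_mono)
      have "0 \<le> Z ?R * (\<Sum>x\<in>R. W u x)"
        using u R W_nonneg by (intro mult_nonneg_nonneg sum_nonneg) auto
      then show "(\<Sum>x\<in>V - ?R. W u x * ?h x) \<le> (\<Sum>x\<in>V. W u x * mass ?R (\<lambda>g. reaches g R x))"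
        unfolding reaches_weights[OF R(1) P(1)] by simp
    qed (use n_pos in simp)
    also have "\<dots> = (\<Sum>x\<in>V. W u x * ?\<theta> * mass ?R (\<lambda>g. reaches g R x))"
      unfolding sum_distrib_left by (intro sum.cong refl) (simp only: mult.assoc mult.left_commute)
    finally show "(\<Sum>x\<in>V. W u x * of_bool (x \<in> R \<and> light u x) * mass ?R (\<lambda>g. reaches g R x))
      \<le> (\<Sum>x\<in>V. W u x * ?\<theta> * mass ?R (\<lambda>g. reaches g R x))" .
  qed
  also have "\<dots> = ?\<theta> * mass R (\<lambda>f. (f ^^ j) v \<notin> R)"
    unfolding mass_def wsum_cmult[symmetric] by (simp add: mult.commute)
  also have "\<dots> \<le> ?\<theta> * Z R" using n_pos by (intro mult_left_mono mass_le_Z) auto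
  finally show ?thesis unfolding mass_def by (simp add: of_bool_conj)
qed

lemma light_short_le:
  assumes R: "R \<subseteq> V" "r \<in> R" and v: "v \<in> V"
    and c: "real (card R + L) + D + B * D \<le> n / 2" "4 * D * real (card R + L) \<le> n"
  shows "mass R (\<lambda>f. \<exists>j<L. (f ^^ j) v \<notin> R \<and> (f ^^ Suc j) v \<in> R \<and> light ((f ^^ j) v) ((f ^^ Suc j) v))
    \<le> 4 * real L * real (card R + L) / n * Z R"
proof -
  let ?P = "\<lambda>j f. (f ^^ j) v \<notin> R \<and> (f ^^ Suc j) v \<in> R \<and> light ((f ^^ j) v) ((f ^^ Suc j) v)"
  have "mass R (\<lambda>f. \<exists>j<L. ?P j f) = mass R (\<lambda>f. \<exists>j\<in>{..<L}. ?P j f)" by (simp only: Bex_def lessThan_iff)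
  also have "\<dots> \<le> (\<Sum>j<L. mass R (?P j))" by (rule mass_Bex) simp
  also have "\<dots> \<le> (\<Sum>j<L. 4 * real (card R + L) / n * Z R)"
  proof (rule sum_mono)
    fix j assume "j \<in> {..<L}"
    then have le: "real (card R + Suc j) \<le> real (card R + L)" by simp
    then have "4 * D * real (card R + Suc j) \<le> 4 * D * real (card R + L)"
      using D_nonneg by (intro mult_left_mono) auto
    then have "mass R (?P j) \<le> 4 * real (card R + Suc j) / n * Z R"
      using le c by (intro light_hit_le[OF R v]) linarith+
    also have "\<dots> \<le> 4 * real (card R + L) / n * Z R"
      using le n_pos by (intro mult_right_mono divide_right_mono) auto
    finally show "mass R (?P j) \<le> 4 * real (card R + L) / n * Z R" .
  qed
  also have "\<dots> = 4 * real L * real (card R + L) / n * Z R" by simp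
  finally show ?thesis .
qed

text \<open>A single vertex may well leave through a heavy edge, but the flux identity bounds the
  sum over all starting vertices. For \<open>B > 1\<close> every vertex sends at least
  \<open>card R\<close> into \<open>R\<close>, and the heavy weight into \<open>R\<close> is at most
  \<open>card R * B * D\<close>, so \<open>card R\<close> cancels.\<close>

lemma heavy_exit_le:
  assumes R: "R \<subseteq> V" "r \<in> R"
  shows "(\<Sum>v\<in>V - R. mass R (\<lambda>f. exits_via (\<lambda>u x. \<not> light u x) R f v)) \<le> B * D * Z R"
proof (cases "B \<le> 1")
  case True
  then have "(\<Sum>v\<in>V - R. mass R (\<lambda>f. exits_via (\<lambda>u x. \<not> light u x) R f v)) = 0"
    by (simp add: exits_via_def light_def mass_def wsum_def)
  moreover have "0 \<le> B * D * Z R" using B_pos D_nonneg by simp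
  ultimately show ?thesis by simp
next
  case False
  let ?h = "\<lambda>v. mass R (\<lambda>f. exits_via (\<lambda>u x. \<not> light u x) R f v)"
  have fR: "finite R" using finite_subset[OF R(1) fin] .
  have s0: "real (card R) > 0" using fR R by (auto simp: card_gt_0_iff)
  have "real (card R) * (\<Sum>v\<in>V - R. ?h v) \<le> (\<Sum>v\<in>V - R. ?h v * (\<Sum>z\<in>R. W v z))"
    unfolding sum_distrib_left[of "real (card R)"]
  proof (rule sum_mono)
    fix v assume "v \<in> V - R"
    then have "?h v * real (card R) \<le> ?h v * (\<Sum>z\<in>R. W v z)"
      using sum_W_ge1[OF R(1), of v] False by (intro mult_left_mono) auto
    then show "real (card R) * ?h v \<le> ?h v * (\<Sum>z\<in>R. W v z)" by (simp only: mult.commute)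
  qed
  also have "\<dots> = Z R * (\<Sum>x\<in>V - R. exit_weight (\<lambda>u x. \<not> light u x) R x)" by (rule exits_via_flux[OF R(1)])
  also have "\<dots> \<le> Z R * (\<Sum>x\<in>V - R. \<Sum>y\<in>R. B * of_bool (Sp x y))"
    unfolding exit_weight_def
  proof (intro mult_left_mono sum_mono)
    fix x y assume "x \<in> V - R" "y \<in> R"
    then show "W x y * of_bool (\<not> light x y) \<le> B * of_bool (Sp x y)"
      using W_eq[of x y] B_pos by (cases "x = y") (auto simp: light_def)
  qed simp
  also have "(\<Sum>x\<in>V - R. \<Sum>y\<in>R. B * of_bool (Sp x y)) = (\<Sum>y\<in>R. B * (\<Sum>x\<in>V - R. of_bool (Sp y x)))"
    unfolding sum_distrib_left by (subst sum.swap, subst Sp_sym) (rule refl)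
  also have "Z R * \<dots> \<le> Z R * (\<Sum>y\<in>R. B * D)"
    using Sp_count[of _ "V - R"] R B_pos by (intro mult_left_mono sum_mono) (auto simp: subset_iff)
  also have "\<dots> = real (card R) * (B * D * Z R)" by simp
  finally show ?thesis using s0 by simp
qed

text \<open>A path is in \<open>R\<close> after \<open>L\<close> steps because it enters by a heavy
  edge, starts in \<open>R\<close>, or enters by a light edge; these are the three terms.\<close>

lemma average_short_le:
  assumes R: "R \<subseteq> V" "r \<in> R" and S: "real (card R) \<le> S"
    and c: "S + real L + D + B * D \<le> n / 2" "4 * D * (S + real L) \<le> n"
  shows "(\<Sum>v\<in>V. mass R (\<lambda>f. (f ^^ L) v \<in> R)) \<le> (B * D + S + 4 * real L * (S + real L)) * Z R"
proof -
  let ?lt = "\<lambda>v f. \<exists>j<L. (f ^^ j) v \<notin> R \<and> (f ^^ Suc j) v \<in> R \<and> light ((f ^^ j) v) ((f ^^ Suc j) v)"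
  let ?hv = "\<lambda>v f. exits_via (\<lambda>u x. \<not> light u x) R f v"
  have le: "real (card R + L) \<le> S + real L" using S by simp
  then have "4 * D * real (card R + L) \<le> 4 * D * (S + real L)"
    using D_nonneg by (intro mult_left_mono) auto
  then have c': "real (card R + L) + D + B * D \<le> n / 2" "4 * D * real (card R + L) \<le> n"
    using c le by linarith+
  have "mass R (\<lambda>f. (f ^^ L) v \<in> R) \<le> 4 * real L * (S + real L) / n * Z R + mass R (?hv v)"
    if v: "v \<in> V - R" for v
  proof -
    have "mass R (\<lambda>f. (f ^^ L) v \<in> R) \<le> mass R (\<lambda>f. ?lt v f \<or> ?hv v f)"
    proof (rule mass_mono)
      fix f assume f: "f \<in> forests R" "(f ^^ L) v \<in> R"
      define m where "m = (LEAST m. (f ^^ m) v \<in> R)"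
      have m: "(f ^^ m) v \<in> R" "m \<le> L" unfolding m_def using f(2) by (auto intro: LeastI Least_le)
      have "m \<noteq> 0" using m v by (metis DiffE funpow_0)
      then obtain k where k: "m = Suc k" using not0_implies_Suc by blast
      have "(f ^^ k) v \<notin> R" using not_less_Least[of k "\<lambda>m. (f ^^ m) v \<in> R"] k unfolding m_def by simp
      then show "?lt v f \<or> ?hv v f" using m k unfolding exits_via_def by (metis Suc_le_lessD)
    qed
    also have "\<dots> \<le> mass R (?lt v) + mass R (?hv v)" by (rule mass_disj)
    also have "mass R (?lt v) \<le> 4 * real L * real (card R + L) / n * Z R"
      using v by (intro light_short_le[OF R _ c']) auto
    also have "\<dots> \<le> 4 * real L * (S + real L) / n * Z R"
      using le n_pos by (intro mult_right_mono divide_right_mono mult_left_mono) auto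
    finally show ?thesis by simp
  qed
  then have "(\<Sum>v\<in>V - R. mass R (\<lambda>f. (f ^^ L) v \<in> R)) \<le>
    (\<Sum>v\<in>V - R. 4 * real L * (S + real L) / n * Z R + mass R (?hv v))" by (rule sum_mono)
  also have "\<dots> = real (card (V - R)) * (4 * real L * (S + real L) / n * Z R) + (\<Sum>v\<in>V - R. mass R (?hv v))"
    by (simp add: sum.distrib)
  also have "\<dots> \<le> n * (4 * real L * (S + real L) / n * Z R) + B * D * Z R"
  proof (intro add_mono mult_right_mono heavy_exit_le[OF R])
    show "real (card (V - R)) \<le> n" using fin by (intro of_nat_mono card_mono) auto
    have "S \<ge> 0" using S by linarith
    then show "0 \<le> 4 * real L * (S + real L) / n * Z R" using n_pos by simp
  qed
  also have "\<dots> = (B * D + 4 * real L * (S + real L)) * Z R" using n_pos by (simp add: field_simps)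
  finally have 1: "(\<Sum>v\<in>V - R. mass R (\<lambda>f. (f ^^ L) v \<in> R)) \<le> (B * D + 4 * real L * (S + real L)) * Z R" .
  have "(\<Sum>v\<in>R. mass R (\<lambda>f. (f ^^ L) v \<in> R)) \<le> (\<Sum>v\<in>R. Z R)" by (intro sum_mono mass_le_Z)
  also have "\<dots> \<le> S * Z R" using S by (simp add: mult_right_mono)
  finally have 2: "(\<Sum>v\<in>R. mass R (\<lambda>f. (f ^^ L) v \<in> R)) \<le> S * Z R" .
  show ?thesis using 1 2 sum.subset_diff[OF R(1) fin, of "\<lambda>v. mass R (\<lambda>f. (f ^^ L) v \<in> R)"]
    by (simp add: algebra_simps)
qed

text \<open>Every step into \<open>r\<close> is light, so for this target the bound holds for each
  starting vertex and not only on average.\<close>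

lemma root_short_le:
  assumes v: "v \<in> V" "v \<noteq> r"
    and c: "real (1 + L) + D + B * D \<le> n / 2" "4 * D * real (1 + L) \<le> n"
  shows "mass {r} (\<lambda>f. (f ^^ L) v \<in> {r}) \<le> 4 * real L * real (1 + L) / n * Z {r}"
proof -
  have "mass {r} (\<lambda>f. (f ^^ L) v \<in> {r}) \<le>
    mass {r} (\<lambda>f. \<exists>j<L. (f ^^ j) v \<notin> {r} \<and> (f ^^ Suc j) v \<in> {r} \<and> light ((f ^^ j) v) ((f ^^ Suc j) v))"
  proof (rule mass_mono)
    fix f assume f: "f \<in> forests {r}" "(f ^^ L) v \<in> {r}"
    define m where "m = (LEAST m. (f ^^ m) v \<in> {r})"
    have m: "(f ^^ m) v \<in> {r}" "m \<le> L" unfolding m_def using f(2) by (auto intro: LeastI Least_le)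
    have "m \<noteq> 0" using m v by (metis funpow_0 singletonD)
    then obtain k where k: "m = Suc k" using not0_implies_Suc by blast
    have "(f ^^ k) v \<notin> {r}" using not_less_Least[of k "\<lambda>m. (f ^^ m) v \<in> {r}"] k unfolding m_def by simp
    moreover have "light ((f ^^ k) v) ((f ^^ Suc k) v)"
      using m(1) k root Sp_sym unfolding light_def by (metis singletonD)
    ultimately show "\<exists>j<L. (f ^^ j) v \<notin> {r} \<and> (f ^^ Suc j) v \<in> {r} \<and> light ((f ^^ j) v) ((f ^^ Suc j) v)"
      using m k by (intro exI[of _ k]) (auto simp del: funpow.simps)
  qed
  also have "\<dots> \<le> 4 * real L * real (card {r} + L) / n * Z {r}"
    using root c v by (intro light_short_le) auto
  finally show ?thesis by simp
qed


section \<open>Chaining\<close>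

text \<open>The subtree spanned by \<open>r\<close> and \<open>U\<close>. Inserting \<open>r\<close>
  makes it a root set even for \<open>U = {}\<close>, where the greedy selection starts.\<close>

definition path_hull :: "('a \<Rightarrow> 'a) \<Rightarrow> 'a set \<Rightarrow> 'a set" where
  "path_hull f U = insert r (\<Union>v\<in>U. range (\<lambda>k. (f ^^ k) v))"

lemma path_hull_props:
  assumes f: "f \<in> forests {r}" and U: "U \<subseteq> V"
  shows "{r} \<subseteq> path_hull f U" "path_hull f U \<subseteq> V" "\<And>x. x \<in> path_hull f U \<Longrightarrow> f x \<in> path_hull f U"
proof -
  show "{r} \<subseteq> path_hull f U" unfolding path_hull_def by auto
  show "path_hull f U \<subseteq> V" unfolding path_hull_def using root forests_funpow_in[OF f] U by auto
  fix x assume "x \<in> path_hull f U"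
  then consider "x = r" | v k where "v \<in> U" "x = (f ^^ k) v" unfolding path_hull_def by auto
  then show "f x \<in> path_hull f U"
  proof cases
    case 1
    then show ?thesis using forestsD(2)[OF f] unfolding path_hull_def by simp
  next
    case 2
    then have "f x = (f ^^ Suc k) v" by simp
    then show ?thesis using 2(1) unfolding path_hull_def by blast
  qed
qed

lemma path_hull_funpow:
  assumes f: "f \<in> forests {r}" and U: "U \<subseteq> V" and x: "x \<in> path_hull f U"
  shows "(f ^^ k) x \<in> path_hull f U"
  using x by (induction k) (auto intro: path_hull_props(3)[OF f U])

text \<open>The hull is read off from the values of \<open>f\<close> on the hull itself, which is
  the stopping property that \<open>wsum_domain_markov\<close> asks for.\<close>

lemma path_hull_glue:
  assumes f: "f \<in> forests {r}" and U: "U \<subseteq> V"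
  shows "path_hull (glue (path_hull f U) f g) U = path_hull f U"
proof -
  have "(glue (path_hull f U) f g ^^ k) v = (f ^^ k) v" if "v \<in> U" for v k
  proof (rule funpow_cong_orbit)
    fix i
    have "(f ^^ i) v \<in> path_hull f U" using that unfolding path_hull_def by blast
    then show "glue (path_hull f U) f g ((f ^^ i) v) = f ((f ^^ i) v)" by (simp add: glue_def)
  qed
  then show ?thesis unfolding path_hull_def by auto
qed

lemma trim_hit:
  assumes cl: "\<And>x. x \<in> C \<Longrightarrow> f x \<in> C"
  shows "(trim C f ^^ k) v \<in> C \<longleftrightarrow> (f ^^ k) v \<in> C"
proof (induction k arbitrary: v)
  case (Suc k)
  have fC: "(f ^^ i) x \<in> C" if "x \<in> C" for i x using that cl by (induction i) auto
  show ?case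
  proof (cases "v \<in> C")
    case True
    have "(trim C f ^^ i) v = v" for i using True by (induction i) (auto simp: trim_def)
    then show ?thesis using True fC by metis
  next
    case False
    then show ?thesis using Suc[of "f v"] unfolding funpow_Suc_right o_apply by (simp add: trim_def)
  qed
qed simp

lemma trim_path_hull_hit:
  "f \<in> forests {r} \<Longrightarrow> U \<subseteq> V \<Longrightarrow> (trim (path_hull f U) f ^^ k) v \<in> path_hull f U \<longleftrightarrow> (f ^^ k) v \<in> path_hull f U"
  by (rule trim_hit) (rule path_hull_props(3))

text \<open>Once the paths from \<open>U\<close> are explored, the remaining tree is a forest rooted
  at the explored subtree. This is the counterpart of running Wilson's algorithm from
  \<open>U\<close> first.\<close>

lemma wsum_path_hull_markov:
  fixes \<phi> :: "'a set \<Rightarrow> ('a \<Rightarrow> 'a) \<Rightarrow> real"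
  assumes U: "U \<subseteq> V"
    and bound: "\<And>C. C \<subseteq> V \<Longrightarrow> r \<in> C \<Longrightarrow> wsum C (\<phi> C) \<le> q * Z C"
  shows "wsum {r} (\<lambda>f. \<phi> (path_hull f U) (trim (path_hull f U) f)) \<le> q * Z {r}"
proof (rule wsum_domain_markov)
  fix f assume f: "f \<in> forests {r}"
  show "{r} \<subseteq> path_hull f U" "path_hull f U \<subseteq> V" by (rule path_hull_props[OF f U])+
  show "f x \<in> path_hull f U" if "x \<in> path_hull f U" for x by (rule path_hull_props(3)[OF f U that])
  show "path_hull (glue (path_hull f U) f g) U = path_hull f U" for g by (rule path_hull_glue[OF f U])
  show "wsum (path_hull f U) (\<phi> (path_hull f U)) \<le> q * Z (path_hull f U)"
    using path_hull_props(1,2)[OF f U] by (intro bound) auto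
qed

lemma mass_path_hull_far:
  assumes U: "U \<subseteq> V" and v: "v \<in> V" and S: "2 * D \<le> S" and BD: "B * D \<le> n"
  shows "mass {r} (\<lambda>f. S < real (card (path_hull f U)) \<and> (f ^^ L) v \<notin> path_hull f U) \<le> exp (- S * real L / (4 * n)) * Z {r}"
proof -
  define \<phi> where "\<phi> C g = (of_bool (S < real (card C)) * of_bool ((g ^^ L) v \<notin> C) :: real)" for C and g :: "'a \<Rightarrow> 'a"
  have "wsum {r} (\<lambda>f. \<phi> (path_hull f U) (trim (path_hull f U) f)) \<le> exp (- S * real L / (4 * n)) * Z {r}"
  proof (rule wsum_path_hull_markov[OF U])
    fix C assume C: "C \<subseteq> V" "r \<in> C"
    show "wsum C (\<phi> C) \<le> exp (- S * real L / (4 * n)) * Z C"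
    proof (cases "S < real (card C)")
      case True
      have "wsum C (\<phi> C) = mass C (\<lambda>g. (g ^^ L) v \<notin> C)" unfolding \<phi>_def mass_def using True by simp
      also have "\<dots> \<le> (1 - real (card C) / (4 * n)) ^ L * Z C"
        using True S by (intro hit_decay[OF C(1) v _ BD]) auto
      also have "\<dots> \<le> exp (- S * real L / (4 * n)) * Z C"
      proof (rule mult_right_mono)
        have cn: "real (card C) \<le> n" using card_mono[OF fin C(1)] by simp
        have "(1 - real (card C) / (4 * n)) ^ L \<le> exp (- (real (card C) / (4 * n) * real L))"
          using cn n_pos by (intro power_exp_le) (auto simp: divide_simps)
        also have "\<dots> = exp (- (real (card C) * real L / (4 * n)))" by simp
        also have "\<dots> \<le> exp (- S * real L / (4 * n))"
        proof -
          have "S * real L / (4 * n) \<le> real (card C) * real L / (4 * n)"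
            using True n_pos by (intro divide_right_mono mult_right_mono) auto
          then show ?thesis by simp
        qed
        finally show "(1 - real (card C) / (4 * n)) ^ L \<le> exp (- S * real L / (4 * n))" .
      qed simp
      finally show ?thesis .
    qed (simp add: \<phi>_def wsum_def)
  qed
  also have "wsum {r} (\<lambda>f. \<phi> (path_hull f U) (trim (path_hull f U) f)) =
    mass {r} (\<lambda>f. S < real (card (path_hull f U)) \<and> (f ^^ L) v \<notin> path_hull f U)"
    unfolding mass_def \<phi>_def
    using trim_path_hull_hit[OF _ U] by (intro wsum_cong) (simp add: of_bool_conj)
  finally show ?thesis .
qed

text \<open>The hull is closed under \<open>f\<close>, so none of the vertices visited at times
  \<open>0, ..., L - 1\<close> lies in it; they are distinct because the forest has no
  cycles.\<close>

lemma card_path_hull_step: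
  assumes f: "f \<in> forests {r}" and U: "U \<subseteq> V" and v: "v \<in> V" and L: "(f ^^ L) v \<notin> path_hull f U"
  shows "card (path_hull f U) + L \<le> card (path_hull f (insert v U))"
proof -
  define p where "p i = (f ^^ i) v" for i
  have pn: "p i \<notin> path_hull f U" if "i < L" for i
  proof
    assume "p i \<in> path_hull f U"
    then have "(f ^^ (L - i)) (p i) \<in> path_hull f U" by (rule path_hull_funpow[OF f U])
    moreover have "(f ^^ (L - i)) (p i) = (f ^^ L) v"
      using that funpow_add[of "L - i" i f] unfolding p_def by (simp add: fun_eq_iff)
    ultimately show False using L by simp
  qed
  have pne: False if "a < b" "b < L" "p a = p b" for a b
  proof -
    obtain d where d: "b = Suc d + a" using less_imp_Suc_add[OF \<open>a < b\<close>] by auto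
    have "(f ^^ Suc d) (p a) = p b" unfolding p_def d funpow_add o_apply ..
    then have "p a \<in> {r}"
      using forests_no_cycle[OF f, of "p a" d] that(3) forests_funpow_in[OF f v] unfolding p_def by simp
    then show False using pn[of a] that unfolding path_hull_def by auto
  qed
  then have inj: "inj_on p {..<L}" by (intro inj_onI) (metis lessThan_iff linorder_neqE_nat)
  have fin1: "finite (path_hull f W)" if "W \<subseteq> V" for W using path_hull_props(2)[OF f that] finite_subset fin by blast
  have "card (path_hull f U \<union> p ` {..<L}) = card (path_hull f U) + L"
    using fin1[OF U] pn inj by (subst card_Un_disjoint) (auto simp: card_image)
  moreover have "card (path_hull f U \<union> p ` {..<L}) \<le> card (path_hull f (insert v U))"
    using fin1[of "insert v U"] U v by (intro card_mono) (auto simp: path_hull_def p_def)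
  ultimately show ?thesis by simp
qed

text \<open>If every \<open>v\<close> violated the bound, the sum over \<open>V\<close> would exceed
  \<open>n * q * Z {r}\<close>. The averaging is over masses, so the chosen vertex does not depend
  on the forest although the hull does.\<close>

lemma exists_far_vertex:
  assumes U: "U \<subseteq> V" and q: "q \<ge> 0"
    and avg: "\<And>R. R \<subseteq> V \<Longrightarrow> r \<in> R \<Longrightarrow> real (card R) \<le> S \<Longrightarrow> (\<Sum>v\<in>V. mass R (\<lambda>f. (f ^^ L) v \<in> R)) \<le> n * q * Z R"
  shows "\<exists>v\<in>V. mass {r} (\<lambda>f. real (card (path_hull f U)) \<le> S \<and> (f ^^ L) v \<in> path_hull f U) \<le> q * Z {r}"
proof (rule ccontr)
  assume neg: "\<not> ?thesis"
  define \<phi> where "\<phi> C g = (\<Sum>v\<in>V. of_bool (real (card C) \<le> S) * of_bool ((g ^^ L) v \<in> C) :: real)" for C and g :: "'a \<Rightarrow> 'a"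
  have "wsum {r} (\<lambda>f. \<phi> (path_hull f U) (trim (path_hull f U) f)) \<le> n * q * Z {r}"
  proof (rule wsum_path_hull_markov[OF U])
    fix C assume C: "C \<subseteq> V" "r \<in> C"
    show "wsum C (\<phi> C) \<le> n * q * Z C"
    proof (cases "real (card C) \<le> S")
      case True
      have "wsum C (\<phi> C) = (\<Sum>v\<in>V. mass C (\<lambda>g. (g ^^ L) v \<in> C))"
        unfolding \<phi>_def mass_def wsum_sum[symmetric] using True by simp
      then show ?thesis using avg[OF C True] by simp
    next
      case False
      then show ?thesis using q by (simp add: \<phi>_def wsum_def mult_nonneg_nonneg)
    qed
  qed
  moreover have "wsum {r} (\<lambda>f. \<phi> (path_hull f U) (trim (path_hull f U) f)) =
    (\<Sum>v\<in>V. mass {r} (\<lambda>f. real (card (path_hull f U)) \<le> S \<and> (f ^^ L) v \<in> path_hull f U))"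
    unfolding mass_def \<phi>_def wsum_sum[symmetric]
    using trim_path_hull_hit[OF _ U] by (intro wsum_cong sum.cong) (simp_all add: of_bool_conj)
  moreover have "(\<Sum>v\<in>V. q * Z {r}) < (\<Sum>v\<in>V. mass {r} (\<lambda>f. real (card (path_hull f U)) \<le> S \<and> (f ^^ L) v \<in> path_hull f U))"
    using neg root(1) by (intro sum_strict_mono fin) auto
  ultimately show False by simp
qed

text \<open>A path shorter than \<open>L\<close> raises the potential by at most one, and a longer one does not
  raise it at all.\<close>

lemma greedy_path_hull:
  assumes q: "q \<ge> 0" and L: "L > 0"
    and avg: "\<And>R. R \<subseteq> V \<Longrightarrow> r \<in> R \<Longrightarrow> real (card R) \<le> S \<Longrightarrow> (\<Sum>v\<in>V. mass R (\<lambda>f. (f ^^ L) v \<in> R)) \<le> n * q * Z R"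
  shows "\<exists>U. U \<subseteq> V \<and> card U \<le> m \<and>
    wsum {r} (\<lambda>f. of_bool (real (card (path_hull f U)) \<le> S) * max 0 (real m - real (card (path_hull f U)) / real L))
      \<le> real m * q * Z {r}"
proof (induction m)
  case 0
  have "max 0 (- (real (card (path_hull f {})) / real L)) = 0" for f
    by (rule max_absorb1) simp
  then show ?case by (intro exI[of _ "{}"]) (simp add: wsum_def)
next
  case (Suc m)
  then obtain U where U: "U \<subseteq> V" "card U \<le> m"
    "wsum {r} (\<lambda>f. of_bool (real (card (path_hull f U)) \<le> S) * max 0 (real m - real (card (path_hull f U)) / real L))
      \<le> real m * q * Z {r}" by blast
  obtain v where v: "v \<in> V" "mass {r} (\<lambda>f. real (card (path_hull f U)) \<le> S \<and> (f ^^ L) v \<in> path_hull f U) \<le> q * Z {r}"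
    using exists_far_vertex[OF U(1) q avg] by blast
  let ?U = "insert v U"
  have "wsum {r} (\<lambda>f. of_bool (real (card (path_hull f ?U)) \<le> S) * max 0 (real (Suc m) - real (card (path_hull f ?U)) / real L))
    \<le> wsum {r} (\<lambda>f. of_bool (real (card (path_hull f U)) \<le> S) * max 0 (real m - real (card (path_hull f U)) / real L)
      + of_bool (real (card (path_hull f U)) \<le> S \<and> (f ^^ L) v \<in> path_hull f U))"
  proof (rule wsum_mono)
    fix f assume f: "f \<in> forests {r}"
    define c c' where "c = real (card (path_hull f U))" and "c' = real (card (path_hull f ?U))"
    have vU: "?U \<subseteq> V" using U v by auto
    have "card (path_hull f U) \<le> card (path_hull f ?U)"
      using finite_subset[OF path_hull_props(2)[OF f vU] fin] by (intro card_mono) (auto simp: path_hull_def)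
    then have cc: "c \<le> c'" unfolding c_def c'_def by simp
    show "of_bool (c' \<le> S) * max 0 (real (Suc m) - c' / real L)
      \<le> of_bool (c \<le> S) * max 0 (real m - c / real L) + of_bool (c \<le> S \<and> (f ^^ L) v \<in> path_hull f U)"
    proof (cases "c' \<le> S")
      case True
      then have cS: "c \<le> S" using cc by simp
      have d: "c / real L \<le> c' / real L" using cc by (simp add: divide_right_mono)
      show ?thesis
      proof (cases "(f ^^ L) v \<in> path_hull f U")
        case True
        then show ?thesis using d cS \<open>c' \<le> S\<close> by simp
      next
        case False
        have "c + real L \<le> c'"
          using card_path_hull_step[OF f U(1) v(1) False] unfolding c_def c'_def by linarith
        then have "(c + real L) / real L \<le> c' / real L" by (rule divide_right_mono) simp
        then have "c / real L + 1 \<le> c' / real L" using L by (simp add: add_divide_distrib)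
        then show ?thesis using False cS True by simp
      qed
    qed simp
  qed
  also have "\<dots> \<le> real m * q * Z {r} + q * Z {r}"
    unfolding wsum_add using U(3) v(2) unfolding mass_def by (rule add_mono)
  also have "\<dots> = real (Suc m) * q * Z {r}" by (simp add: algebra_simps)
  finally show ?case
    using U v(1) card_insert_le_m1[of "Suc m" U v] by (intro exI[of _ ?U]) auto
qed

text \<open>Markov's inequality for the potential of \<open>greedy_path_hull\<close>: on the event
  that the hull is small, \<open>S \<le> real m * real L / 2\<close> makes the potential at least
  \<open>m / 2\<close>.\<close>

lemma large_path_hull:
  assumes q: "q \<ge> 0" and L: "L > 0" and m: "m > 0" and S: "S \<le> real m * real L / 2"
    and avg: "\<And>R. R \<subseteq> V \<Longrightarrow> r \<in> R \<Longrightarrow> real (card R) \<le> S \<Longrightarrow> (\<Sum>v\<in>V. mass R (\<lambda>f. (f ^^ L) v \<in> R)) \<le> n * q * Z R"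
  shows "\<exists>U. U \<subseteq> V \<and> card U \<le> m \<and> mass {r} (\<lambda>f. real (card (path_hull f U)) \<le> S) \<le> 2 * q * Z {r}"
proof -
  have "\<exists>U. U \<subseteq> V \<and> card U \<le> m \<and>
    wsum {r} (\<lambda>f. of_bool (real (card (path_hull f U)) \<le> S) * max 0 (real m - real (card (path_hull f U)) / real L))
      \<le> real m * q * Z {r}"
    by (rule greedy_path_hull[OF q L avg])
  then obtain U where U: "U \<subseteq> V" "card U \<le> m"
    "wsum {r} (\<lambda>f. of_bool (real (card (path_hull f U)) \<le> S) * max 0 (real m - real (card (path_hull f U)) / real L))
      \<le> real m * q * Z {r}"
    by (elim exE conjE) (rule that)
  have "real m / 2 * mass {r} (\<lambda>f. real (card (path_hull f U)) \<le> S) =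
      wsum {r} (\<lambda>f. real m / 2 * of_bool (real (card (path_hull f U)) \<le> S))"
    unfolding mass_def wsum_cmult ..
  also have "\<dots> \<le> wsum {r} (\<lambda>f. of_bool (real (card (path_hull f U)) \<le> S) * max 0 (real m - real (card (path_hull f U)) / real L))"
  proof (rule wsum_mono)
    fix f
    show "real m / 2 * of_bool (real (card (path_hull f U)) \<le> S) \<le>
      of_bool (real (card (path_hull f U)) \<le> S) * max 0 (real m - real (card (path_hull f U)) / real L)"
    proof (cases "real (card (path_hull f U)) \<le> S")
      case True
      then have "real (card (path_hull f U)) \<le> real m * real L / 2" using S by simp
      then have "real (card (path_hull f U)) / real L \<le> real m * real L / 2 / real L"
        by (rule divide_right_mono) simp
      also have "real m * real L / 2 / real L = real m / 2" using L by simp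
      finally have "real m / 2 \<le> max 0 (real m - real (card (path_hull f U)) / real L)" by linarith
      then show ?thesis using True by simp
    qed simp
  qed
  also have "\<dots> \<le> real m * q * Z {r}" by (rule U(3))
  finally show ?thesis using U m by (intro exI[of _ U]) simp
qed

text \<open>Outside four bad events every vertex reaches the hull of level \<open>K\<close> in
  \<open>L K\<close> steps, passes from level \<open>k + 1\<close> to level \<open>k\<close> in
  \<open>L k\<close> steps and from level 0 to \<open>r\<close> in \<open>H\<close> steps. In the
  same order as the summands, the events are: a small hull, a bad vertex in \<open>U 0\<close>, a
  bad vertex of some \<open>U (Suc k)\<close>, a bad vertex anywhere.\<close>

lemma chaining:
  assumes U: "\<And>k. k \<le> K \<Longrightarrow> U k \<subseteq> V \<and> card (U k) \<le> m k"
    and p: "\<And>k. k \<le> K \<Longrightarrow> mass {r} (\<lambda>f. real (card (path_hull f (U k))) \<le> S k) \<le> p k * Z {r}"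
    and \<tau>: "\<And>v. v \<in> V \<Longrightarrow> mass {r} (\<lambda>f. (f ^^ H) v \<notin> {r}) \<le> \<tau> * Z {r}" "\<tau> \<ge> 0"
    and S: "\<And>k. k \<le> K \<Longrightarrow> 2 * D \<le> S k" and BD: "B * D \<le> n"
  shows "mass {r} (\<lambda>f. \<exists>v\<in>V. (f ^^ (H + (\<Sum>k<K. L k) + L K)) v \<noteq> r) \<le>
    ((\<Sum>k\<le>K. p k) + real (m 0) * \<tau> + (\<Sum>k<K. real (m (Suc k)) * exp (- S k * real (L k) / (4 * n)))
      + n * exp (- S K * real (L K) / (4 * n))) * Z {r}"
proof -
  let ?A = "\<lambda>k f. real (card (path_hull f (U k))) \<le> S k"
  let ?F = "\<lambda>k v f. S k < real (card (path_hull f (U k))) \<and> (f ^^ L k) v \<notin> path_hull f (U k)"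
  let ?E1 = "\<lambda>f. \<exists>k\<in>{..K}. ?A k f"
  let ?E2 = "\<lambda>f. \<exists>v\<in>U 0. (f ^^ H) v \<notin> {r}"
  let ?E3 = "\<lambda>f. \<exists>k\<in>{..<K}. \<exists>v\<in>U (Suc k). ?F k v f"
  let ?E4 = "\<lambda>f. \<exists>v\<in>V. ?F K v f"
  have finU: "finite (U k)" if "k \<le> K" for k using U[OF that] finite_subset fin by blast
  have "mass {r} (\<lambda>f. \<exists>v\<in>V. (f ^^ (H + (\<Sum>k<K. L k) + L K)) v \<noteq> r)
    \<le> mass {r} (\<lambda>f. ?E1 f \<or> ?E2 f \<or> ?E3 f \<or> ?E4 f)"
  proof (rule mass_mono, rule ccontr)
    fix f assume f: "f \<in> forests {r}"
      and bad: "\<exists>v\<in>V. (f ^^ (H + (\<Sum>k<K. L k) + L K)) v \<noteq> r"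
      and "\<not> (?E1 f \<or> ?E2 f \<or> ?E3 f \<or> ?E4 f)"
    then have g: "\<And>k. k \<le> K \<Longrightarrow> S k < real (card (path_hull f (U k)))"
      "\<And>v. v \<in> U 0 \<Longrightarrow> (f ^^ H) v = r"
      "\<And>k v. k < K \<Longrightarrow> v \<in> U (Suc k) \<Longrightarrow> (f ^^ L k) v \<in> path_hull f (U k)"
      "\<And>v. v \<in> V \<Longrightarrow> (f ^^ L K) v \<in> path_hull f (U K)"
      by (fastforce simp: not_le)+
    have fr: "(f ^^ i) r = r" for i using forestsD(2)[OF f, of r] by (induction i) auto
    \<comment> \<open>A number of steps sufficient for the generating vertices is sufficient for the
      whole hull: its other vertices lie further along the same paths, and \<open>r\<close> is
      absorbing.\<close>
    have ext: "(f ^^ h) x = r" if "\<And>v. v \<in> U' \<Longrightarrow> (f ^^ h) v = r" "x \<in> path_hull f U'" for h x U'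
    proof -
      from that(2) consider "x = r" | v i where "v \<in> U'" "x = (f ^^ i) v" unfolding path_hull_def by auto
      then show ?thesis
      proof cases
        case 2
        have "(f ^^ h) x = (f ^^ i) ((f ^^ h) v)"
          unfolding 2(2) by (metis add.commute funpow_add o_apply)
        then show ?thesis using that(1)[OF 2(1)] fr by simp
      qed (use fr in simp)
    qed
    have lev: "(f ^^ (H + (\<Sum>j<k. L j))) x = r" if "k \<le> K" "x \<in> path_hull f (U k)" for k x
      using that
    proof (induction k arbitrary: x)
      case 0
      then show ?case using ext[of "U 0" H x] g(2) by simp
    next
      case (Suc k)
      have "(f ^^ (H + (\<Sum>j<Suc k. L j))) v = r" if "v \<in> U (Suc k)" for v
      proof -
        have "(f ^^ (H + (\<Sum>j<k. L j))) ((f ^^ L k) v) = r"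
          using Suc.IH g(3)[of k v] Suc.prems that by simp
        then have "(f ^^ (H + (\<Sum>j<k. L j) + L k)) v = r" by (simp only: funpow_add o_apply)
        then show ?thesis by (simp add: add.assoc)
      qed
      then show ?case using ext Suc.prems(2) by blast
    qed
    obtain v where v: "v \<in> V" "(f ^^ (H + (\<Sum>k<K. L k) + L K)) v \<noteq> r" using bad by blast
    have "(f ^^ (H + (\<Sum>k<K. L k))) ((f ^^ L K) v) = r" using lev[of K] g(4)[OF v(1)] by simp
    then have "(f ^^ (H + (\<Sum>k<K. L k) + L K)) v = r" by (simp only: funpow_add o_apply)
    then show False using v(2) by simp
  qed
  also have "\<dots> \<le> mass {r} ?E1 + (mass {r} ?E2 + (mass {r} ?E3 + mass {r} ?E4))"
    by (intro order_trans[OF mass_disj] add_left_mono order_refl)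
  also have "mass {r} ?E1 \<le> (\<Sum>k\<le>K. p k * Z {r})"
    using p by (intro order_trans[OF mass_Bex] sum_mono) auto
  also have "mass {r} ?E2 \<le> real (m 0) * \<tau> * Z {r}"
  proof -
    have "mass {r} ?E2 \<le> (\<Sum>v\<in>U 0. \<tau> * Z {r})"
      using U[of 0] by (intro order_trans[OF mass_Bex[OF finU]] sum_mono \<tau>) auto
    also have "\<dots> = real (card (U 0)) * (\<tau> * Z {r})" by simp
    also have "\<dots> \<le> real (m 0) * (\<tau> * Z {r})" using U[of 0] \<tau>(2) by (intro mult_right_mono) auto
    finally show ?thesis by (simp add: mult.assoc)
  qed
  also have "mass {r} ?E3 \<le> (\<Sum>k<K. real (m (Suc k)) * exp (- S k * real (L k) / (4 * n)) * Z {r})"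
  proof (rule order_trans[OF mass_Bex], simp, rule sum_mono)
    fix k assume k: "k \<in> {..<K}"
    have "mass {r} (\<lambda>f. \<exists>v\<in>U (Suc k). ?F k v f) \<le> (\<Sum>v\<in>U (Suc k). exp (- S k * real (L k) / (4 * n)) * Z {r})"
      using U[of k] U[of "Suc k"] k
      by (intro order_trans[OF mass_Bex[OF finU]] sum_mono mass_path_hull_far S BD) auto
    also have "\<dots> = real (card (U (Suc k))) * (exp (- S k * real (L k) / (4 * n)) * Z {r})" by simp
    also have "\<dots> \<le> real (m (Suc k)) * (exp (- S k * real (L k) / (4 * n)) * Z {r})"
      using U[of "Suc k"] k by (intro mult_right_mono mult_nonneg_nonneg) auto
    finally show "mass {r} (\<lambda>f. \<exists>v\<in>U (Suc k). ?F k v f)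
      \<le> real (m (Suc k)) * exp (- S k * real (L k) / (4 * n)) * Z {r}" by (simp add: mult.assoc)
  qed
  also have "mass {r} ?E4 \<le> n * exp (- S K * real (L K) / (4 * n)) * Z {r}"
  proof -
    have "mass {r} ?E4 \<le> (\<Sum>v\<in>V. exp (- S K * real (L K) / (4 * n)) * Z {r})"
      using U[of K] by (intro order_trans[OF mass_Bex[OF fin]] sum_mono mass_path_hull_far S BD) auto
    then show ?thesis by (simp add: mult.assoc)
  qed
  finally show ?thesis by (simp add: algebra_simps sum_distrib_left sum_distrib_right)
qed


section \<open>Choice of the scales\<close>

text \<open>The parameter \<open>l\<close> will be \<open>ln n\<close>. A path has length less than
  \<open>L\<close> with average probability about \<open>4 * L * S / n\<close>, which for
  \<open>L\<close> near \<open>2 * S / 32 ^ k\<close> is of order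
  \<open>\<sigma>^2 * 16^k / 32^k\<close>. The terms \<open>B * D\<close> and \<open>S\<close> bring
  no factor \<open>2^-k\<close> of their own, but \<open>2 ^ k \<le> 4 * l / \<sigma>\<close>, so
  \<open>c3\<close> can supply it.\<close>

lemma level_path_hull:
  assumes \<sigma>: "0 < \<sigma>" "\<sigma> \<le> 1" and l: "l > 0" and K: "4 ^ K * \<sigma> \<le> 4 * l" and k: "k \<le> K"
    and c1: "20 * sqrt n * l + D + B * D \<le> n / 2"
    and c2: "80 * D * sqrt n * l \<le> n"
    and c3: "4 * l * (B * D + 4 * sqrt n * l) \<le> \<sigma> ^ 3 * n"
    and c4: "(4 * l)\<^sup>2 \<le> 2 * \<sigma> ^ 3 * sqrt n"
  shows "\<exists>U. U \<subseteq> V \<and> card U \<le> 32 ^ k \<and>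
    mass {r} (\<lambda>f. real (card (path_hull f U)) \<le> 4 ^ k * \<sigma> * sqrt n) \<le> 162 * \<sigma>\<^sup>2 * (1 / 2) ^ k * Z {r}"
proof -
  define S where "S = 4 ^ k * \<sigma> * sqrt n"
  \<comment> \<open>The length at which \<open>32 ^ k\<close> paths add up to \<open>2 * S\<close>,
    as \<open>large_path_hull\<close> demands.\<close>
  define y where "y = 2 * S / 32 ^ k"
  define L where "L = nat \<lceil>y\<rceil>"
  have sn: "sqrt n > 0" using n_pos by simp
  have S0: "S > 0" unfolding S_def using \<sigma> sn by simp
  have k4: "(4::real) ^ k \<le> 4 ^ K" using k by (intro power_increasing) auto
  then have "4 ^ k * \<sigma> \<le> 4 * l" using K \<sigma> mult_right_mono[of "4 ^ k" "4 ^ K" \<sigma>] by linarith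
  then have k4l: "4 ^ k \<le> 4 * l / \<sigma>" using \<sigma> by (simp add: divide_simps mult.commute)
  have Sl: "S \<le> 4 * l * sqrt n"
    unfolding S_def using \<open>4 ^ k * \<sigma> \<le> 4 * l\<close> sn by (intro mult_right_mono) auto
  \<comment> \<open>Rounding up then costs at most a factor 2. The bound holds because
    \<open>y * 8 ^ k = 2 * \<sigma> * sqrt n\<close>, whereas
    \<open>8 ^ k \<le> 16 ^ k \<le> (4 * l / \<sigma>)^2\<close>.\<close>
  have y1: "y \<ge> 1"
  proof -
    have "((4::real) ^ k)\<^sup>2 = 16 ^ k" by (simp add: power2_eq_square flip: power_mult_distrib)
    then have "(8::real) ^ k \<le> (4 ^ k) ^ 2" using power_mono[of "8::real" 16 k] by simp
    also have "\<dots> \<le> (4 * l / \<sigma>) ^ 2" using k4l by (intro power_mono) auto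
    also have "\<dots> = (4 * l)\<^sup>2 / \<sigma>\<^sup>2" by (simp add: power_divide)
    also have "\<dots> \<le> 2 * \<sigma> ^ 3 * sqrt n / \<sigma>\<^sup>2" using c4 by (rule divide_right_mono) simp
    also have "\<dots> = 2 * \<sigma> * sqrt n" using \<sigma> by (simp add: power3_eq_cube power2_eq_square)
    finally have "8 ^ k \<le> 2 * \<sigma> * sqrt n" .
    moreover have "y * 8 ^ k = 2 * \<sigma> * sqrt n"
    proof -
      have "(32::real) ^ k = 4 ^ k * 8 ^ k" by (simp flip: power_mult_distrib)
      then show ?thesis unfolding y_def S_def by simp
    qed
    ultimately have "1 * 8 ^ k \<le> y * 8 ^ k" by simp
    then show ?thesis by (rule mult_right_le_imp_le) simp
  qed
  have Ly: "y \<le> real L" "real L \<le> 2 * y" unfolding L_def using y1 by linarith+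
  have L0: "L > 0" using Ly y1 by linarith
  have y2: "y \<le> 2 * S"
    unfolding y_def using S0 mult_left_mono[of 1 "32 ^ k" "2 * S"] by (simp add: divide_simps)
  \<comment> \<open>80 comes from \<open>4 * L * (S + L) \<le> 4 * (2 * y) * (5 * S)\<close> with
    \<open>y = 2 * S / 32 ^ k\<close>, and 1 from \<open>B * D + S\<close>.\<close>
  define q where "q = 81 * \<sigma>\<^sup>2 * (1 / 2) ^ k"
  have k2: "2 ^ k \<le> 4 * l / \<sigma>" using k4l power_mono[of "2::real" 4 k] by linarith
  have avg: "(\<Sum>v\<in>V. mass R (\<lambda>f. (f ^^ L) v \<in> R)) \<le> n * q * Z R"
    if R: "R \<subseteq> V" "r \<in> R" "real (card R) \<le> S" for R
  proof -
    have SL: "S + real L \<le> 5 * S" using Ly y2 by linarith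
    then have SL2: "S + real L \<le> 20 * sqrt n * l" using Sl by (simp add: algebra_simps)
    have "4 * D * (S + real L) \<le> 4 * D * (20 * sqrt n * l)"
      using SL2 D_nonneg by (intro mult_left_mono) auto
    then have c2': "4 * D * (S + real L) \<le> n" using c2 by (simp add: algebra_simps)
    have "(\<Sum>v\<in>V. mass R (\<lambda>f. (f ^^ L) v \<in> R)) \<le> (B * D + S + 4 * real L * (S + real L)) * Z R"
      using c1 SL2 by (intro average_short_le R c2') linarith
    also have "\<dots> \<le> (n * q) * Z R"
    proof (rule mult_right_mono)
      have "4 * l * (B * D + S) \<le> 4 * l * (B * D + 4 * sqrt n * l)"
        using Sl l by (intro mult_left_mono) (auto simp: mult_ac)
      then have "(B * D + S) * (4 * l) \<le> \<sigma> ^ 3 * n" using c3 by (simp only: mult.commute)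
      then have "B * D + S \<le> \<sigma> ^ 3 * n / (4 * l)" using l by (subst pos_le_divide_eq) auto
      also have "\<dots> = \<sigma>\<^sup>2 * n / (4 * l / \<sigma>)" using \<sigma> l by (simp add: power3_eq_cube power2_eq_square)
      also have "\<dots> \<le> \<sigma>\<^sup>2 * n / 2 ^ k"
        using k2 n_pos l \<sigma> by (intro divide_left_mono) auto
      finally have 1: "B * D + S \<le> \<sigma>\<^sup>2 * n * (1 / 2) ^ k" by (simp add: power_divide)
      have "4 * real L * (S + real L) \<le> 4 * (2 * y) * (5 * S)"
        using Ly SL S0 y1 by (intro mult_mono) auto
      also have "\<dots> = 80 * S\<^sup>2 / 32 ^ k" unfolding y_def by (simp add: power2_eq_square)
      also have "S\<^sup>2 = 16 ^ k * \<sigma>\<^sup>2 * n"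
      proof -
        have "((4::real) ^ k)\<^sup>2 = 16 ^ k" by (simp add: power2_eq_square flip: power_mult_distrib)
        then show ?thesis unfolding S_def using n_pos by (simp add: power_mult_distrib)
      qed
      also have "80 * (16 ^ k * \<sigma>\<^sup>2 * n) / 32 ^ k = 80 * \<sigma>\<^sup>2 * n * (1 / 2) ^ k"
      proof -
        have "(32::real) ^ k = 16 ^ k * 2 ^ k" by (simp flip: power_mult_distrib)
        then show ?thesis by (simp add: power_divide)
      qed
      finally have 2: "4 * real L * (S + real L) \<le> 80 * \<sigma>\<^sup>2 * n * (1 / 2) ^ k" .
      have "n * q = \<sigma>\<^sup>2 * n * (1 / 2) ^ k + 80 * \<sigma>\<^sup>2 * n * (1 / 2) ^ k" unfolding q_def by simp
      then show "B * D + S + 4 * real L * (S + real L) \<le> n * q" using 1 2 by linarith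
    qed simp
    finally show ?thesis by simp
  qed
  have "S \<le> real (32 ^ k) * real L / 2"
    using mult_left_mono[OF Ly(1), of "32 ^ k"] unfolding y_def by simp
  then have "\<exists>U. U \<subseteq> V \<and> card U \<le> 32 ^ k \<and> mass {r} (\<lambda>f. real (card (path_hull f U)) \<le> S) \<le> 2 * q * Z {r}"
    by (intro large_path_hull[OF _ L0 _ _ avg]) (simp_all add: q_def)
  then show ?thesis unfolding S_def q_def by (simp add: mult.assoc)
qed

text \<open>At the top level the hull has more than \<open>sqrt n * ln n\<close> vertices, so that
  all vertices reach it within \<open>8 * sqrt n\<close> steps; the lengths between lower levels
  form a geometric series. The failure probability sums
  \<open>162 * \<sigma>^2 * (1 / 2) ^ k\<close> over the hulls, and adds \<open>\<delta>\<close> for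
  the way to \<open>r\<close>, \<open>2 * \<delta>\<close> for the links and \<open>\<delta>\<close>
  for the top.\<close>

lemma height_bound:
  assumes \<sigma>: "0 < \<sigma>" "\<sigma> \<le> 1" and \<delta>: "0 < \<delta>" "\<delta> \<le> 1"
    and n1: "n > 1" and K: "ln n \<le> 4 ^ K * \<sigma>" "4 ^ K * \<sigma> \<le> 4 * ln n"
    and c1: "20 * sqrt n * ln n + D + B * D \<le> n / 2"
    and c2: "80 * D * sqrt n * ln n \<le> n"
    and c3: "4 * ln n * (B * D + 4 * sqrt n * ln n) \<le> \<sigma> ^ 3 * n"
    and c4: "(4 * ln n)\<^sup>2 \<le> 2 * \<sigma> ^ 3 * sqrt n"
    and c5: "2 * D \<le> \<sigma> * sqrt n" and c6: "ln n \<le> ln (64 / \<delta>) * sqrt n" and c7: "1 / n \<le> \<delta>"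
  shows "\<exists>h. real h \<le> (12 + 5 * ln (1 / \<delta>) + 16 * ln (64 / \<delta>) / \<sigma>) * sqrt n \<and>
    mass {r} (\<lambda>f. \<exists>v\<in>V. (f ^^ h) v \<noteq> r) \<le> (324 * \<sigma>\<^sup>2 + 4 * \<delta>) * Z {r}"
proof -
  \<comment> \<open>The 64 makes \<open>32 * exp (- t) = \<delta> / 2\<close>, so the union bound
    over the \<open>32 ^ Suc k\<close> vertices of a level yields at most
    \<open>(\<delta> / 2) ^ Suc k\<close>.\<close>
  define t where "t = ln (64 / \<delta>)"
  define sn where "sn = sqrt n"
  have sn: "sn > 0" "sn * sn = n" "sn \<ge> 1" unfolding sn_def using n1 n_pos by auto
  have l: "ln n > 0" using n1 by simp
  have t0: "t > 0" unfolding t_def using \<delta> by (intro ln_gt_zero) (simp add: divide_simps)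
  define S where "S k = 4 ^ k * \<sigma> * sn" for k :: nat
  \<comment> \<open>Since \<open>S k * x k = 4 * n * (t * 2 ^ k)\<close>, missing the hull of level
    \<open>k\<close> for \<open>x k\<close> steps has probability at most
    \<open>exp (- t * 2 ^ k)\<close>, and \<open>2 ^ k \<ge> Suc k\<close>.\<close>
  define x where "x k = 4 * t / \<sigma> * sn * (1 / 2) ^ k" for k :: nat
  \<comment> \<open>At the top level all \<open>n\<close> vertices have to be served:
    \<open>S K \<ge> ln n * sqrt n\<close> and \<open>8 * sqrt n\<close> steps give failure at most
    \<open>1 / n^2\<close> for each.\<close>
  define L where "L k = (if k < K then nat \<lceil>x k\<rceil> else nat \<lceil>8 * sn\<rceil>)" for k
  \<comment> \<open>Solves \<open>exp (- T / (5 * sn)) = \<delta>\<close>, the rate being that of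
    \<open>root_dist_tail\<close>.\<close>
  define T where "T = 5 * sn * ln (1 / \<delta>)"
  define H where "H = nat \<lceil>sn\<rceil> + nat \<lceil>T\<rceil>"
  have ld: "ln (1 / \<delta>) \<ge> 0" using \<delta> by (intro ln_ge_zero) (simp add: divide_simps)
  then have T0: "T \<ge> 0" unfolding T_def using sn by simp
  have BDn: "B * D \<le> n"
    using c1 l sn(1) D_nonneg n_pos mult_pos_pos[of "sqrt n" "ln n"] unfolding sn_def by linarith
  have "\<forall>k\<in>{..K}. \<exists>U. U \<subseteq> V \<and> card U \<le> 32 ^ k \<and>
    mass {r} (\<lambda>f. real (card (path_hull f U)) \<le> 4 ^ k * \<sigma> * sqrt n) \<le> 162 * \<sigma>\<^sup>2 * (1 / 2) ^ k * Z {r}"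
    using level_path_hull[OF \<sigma> l K(2) _ c1 c2 c3 c4] by simp
  from bchoice[OF this] obtain U where U':
    "\<forall>k\<in>{..K}. U k \<subseteq> V \<and> card (U k) \<le> 32 ^ k \<and>
      mass {r} (\<lambda>f. real (card (path_hull f (U k))) \<le> 4 ^ k * \<sigma> * sqrt n) \<le> 162 * \<sigma>\<^sup>2 * (1 / 2) ^ k * Z {r}"
    by (rule exE)
  then have U: "U k \<subseteq> V \<and> card (U k) \<le> 32 ^ k"
    "mass {r} (\<lambda>f. real (card (path_hull f (U k))) \<le> S k) \<le> (162 * \<sigma>\<^sup>2 * (1 / 2) ^ k) * Z {r}" if "k \<le> K" for k
    using that unfolding S_def sn_def by simp_all
  have x1: "x k \<ge> 1" if "k < K" for k
  proof -
    have "(2::real) ^ k \<le> 4 ^ K"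
      using that power_mono[of "2::real" 4 k] power_increasing[of k K "4::real"] by linarith
    then have "2 ^ k * \<sigma> \<le> 4 ^ K * \<sigma>" using \<sigma> by (intro mult_right_mono) auto
    also have "\<dots> \<le> 4 * (t * sn)" using K(2) c6 unfolding t_def sn_def by linarith
    finally show ?thesis unfolding x_def using \<sigma> by (simp add: power_divide divide_simps mult_ac)
  qed
  have tail: "mass {r} (\<lambda>f. (f ^^ H) v \<notin> {r}) \<le> \<delta> * Z {r}" if v: "v \<in> V" for v
  proof -
    have "\<sigma> * sqrt n \<le> 1 * sqrt n" using \<sigma> by (intro mult_right_mono) auto
    then have "2 * D \<le> sqrt n" using c5 by simp
    then have "mass {r} (\<lambda>f. (f ^^ H) v \<notin> {r}) \<le> (1 - 1 / (5 * sqrt n)) ^ nat \<lceil>T\<rceil> * Z {r}"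
      unfolding H_def by (intro root_dist_tail[OF v BDn]) (use n1 sn in \<open>auto simp: sn_def\<close>)
    also have "\<dots> \<le> \<delta> * Z {r}"
    proof (rule mult_right_mono)
      have "(1 - 1 / (5 * sn)) ^ nat \<lceil>T\<rceil> \<le> exp (- (1 / (5 * sn) * real (nat \<lceil>T\<rceil>)))"
        using sn by (intro power_exp_le) (auto simp: divide_simps)
      also have "\<dots> \<le> exp (- (1 / (5 * sn) * T))"
        using sn T0 by (simp add: divide_right_mono)
      also have "1 / (5 * sn) * T = ln (1 / \<delta>)" unfolding T_def using sn by simp
      also have "exp (- ln (1 / \<delta>)) = \<delta>" using \<delta> by (simp add: ln_div)
      finally show "(1 - 1 / (5 * sqrt n)) ^ nat \<lceil>T\<rceil> \<le> \<delta>" unfolding sn_def .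
    qed simp
    finally show ?thesis .
  qed
  have SD: "2 * D \<le> S k" for k
  proof -
    have "1 * (\<sigma> * sn) \<le> 4 ^ k * (\<sigma> * sn)" using \<sigma> sn by (intro mult_right_mono) auto
    then show ?thesis unfolding S_def using c5 by (simp add: sn_def mult.assoc)
  qed
  have main: "mass {r} (\<lambda>f. \<exists>v\<in>V. (f ^^ (H + (\<Sum>k<K. L k) + L K)) v \<noteq> r) \<le>
    ((\<Sum>k\<le>K. 162 * \<sigma>\<^sup>2 * (1 / 2) ^ k) + real (32 ^ 0) * \<delta> + (\<Sum>k<K. real (32 ^ Suc k) * exp (- S k * real (L k) / (4 * n)))
      + n * exp (- S K * real (L K) / (4 * n))) * Z {r}"
    by (rule chaining[OF U tail _ SD BDn]) (use \<delta> in auto)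
  have e1: "(\<Sum>k\<le>K. 162 * \<sigma>\<^sup>2 * (1 / 2) ^ k) \<le> 324 * \<sigma>\<^sup>2"
    unfolding sum_distrib_left[symmetric] using mult_left_mono[OF sum_half_powers(1)[of K], of "162 * \<sigma>\<^sup>2"] by simp
  have e3: "(\<Sum>k<K. real (32 ^ Suc k) * exp (- S k * real (L k) / (4 * n))) \<le> 2 * \<delta>"
  proof -
    have "real (32 ^ Suc k) * exp (- S k * real (L k) / (4 * n)) \<le> \<delta> * (1 / 2) ^ k" if k: "k < K" for k
    proof -
      have "S k * x k = 4 * n * (t * 2 ^ k)"
      proof -
        have "(4::real) ^ k = 2 ^ k * 2 ^ k" by (simp flip: power_mult_distrib)
        then show ?thesis unfolding S_def x_def using \<sigma> sn by (simp add: power_divide field_simps)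
      qed
      moreover have "S k * x k \<le> S k * real (L k)"
        unfolding L_def using k \<sigma> sn by (intro mult_left_mono) (auto simp: S_def of_nat_ceiling)
      ultimately have "t * 2 ^ k \<le> S k * real (L k) / (4 * n)" using n_pos by (simp add: pos_le_divide_eq mult.commute)
      moreover have "t * real (Suc k) \<le> t * 2 ^ k"
      proof (rule mult_left_mono)
        have "Suc k \<le> 2 ^ k" by (induction k) auto
        then show "real (Suc k) \<le> 2 ^ k" by (metis of_nat_le_iff of_nat_numeral of_nat_power)
      qed (use t0 in simp)
      ultimately have "t * real (Suc k) \<le> S k * real (L k) / (4 * n)" by linarith
      then have "exp (- S k * real (L k) / (4 * n)) \<le> exp (- (real (Suc k) * t))"
        by (simp add: mult.commute)
      also have "\<dots> = exp (- t) ^ Suc k" using exp_of_nat_mult[of "Suc k" "- t"] by simp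
      also have "exp (- t) = \<delta> / 64" unfolding t_def using \<delta> by (simp add: ln_div exp_diff exp_minus divide_simps)
      finally have "real (32 ^ Suc k) * exp (- S k * real (L k) / (4 * n)) \<le> real (32 ^ Suc k) * (\<delta> / 64) ^ Suc k"
        by (intro mult_left_mono) auto
      also have "\<dots> = (\<delta> / 2) * (\<delta> / 2) ^ k"
        by (simp add: power_mult_distrib[symmetric] power_Suc[symmetric] del: power_Suc)
      also have "\<dots> \<le> \<delta> * (1 / 2) ^ k" using \<delta> by (intro mult_mono power_mono) auto
      finally show ?thesis .
    qed
    then have "(\<Sum>k<K. real (32 ^ Suc k) * exp (- S k * real (L k) / (4 * n))) \<le> (\<Sum>k<K. \<delta> * (1 / 2) ^ k)"
      by (intro sum_mono) auto
    also have "\<dots> \<le> 2 * \<delta>"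
      unfolding sum_distrib_left[symmetric] using mult_left_mono[OF sum_half_powers(2)[of K], of \<delta>] \<delta> by simp
    finally show ?thesis .
  qed
  have e4: "n * exp (- S K * real (L K) / (4 * n)) \<le> \<delta>"
  proof -
    have "ln n * sn * (8 * sn) \<le> S K * real (L K)"
      unfolding S_def L_def using K(1) sn l \<sigma> by (intro mult_mono) auto
    moreover have "ln n * sn * (8 * sn) = 8 * ln n * (sn * sn)" by (simp only: mult_ac)
    ultimately have "2 * ln n * (4 * n) \<le> S K * real (L K)" unfolding sn(2) by simp
    then have "2 * ln n \<le> S K * real (L K) / (4 * n)" using n_pos by (simp add: pos_le_divide_eq)
    then have "exp (- S K * real (L K) / (4 * n)) \<le> exp (- (2 * ln n))" by simp
    also have "\<dots> = 1 / n * (1 / n)" using n_pos by (simp add: exp_minus exp_double power2_eq_square divide_simps)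
    finally have "n * exp (- S K * real (L K) / (4 * n)) \<le> n * (1 / n * (1 / n))"
      by (intro mult_left_mono) auto
    then show ?thesis using c7 n_pos by simp
  qed
  have "mass {r} (\<lambda>f. \<exists>v\<in>V. (f ^^ (H + (\<Sum>k<K. L k) + L K)) v \<noteq> r) \<le> (324 * \<sigma>\<^sup>2 + 4 * \<delta>) * Z {r}"
    by (rule order_trans[OF main mult_right_mono]) (use e1 e3 e4 in auto)
  \<comment> \<open>The 12 collects \<open>sn + 8 * sn\<close> and three roundings, each at most
    \<open>sn\<close>.\<close>
  moreover have "real (H + (\<Sum>k<K. L k) + L K) \<le> (12 + 5 * ln (1 / \<delta>) + 16 * t / \<sigma>) * sn"
  proof -
    have "(\<Sum>k<K. real (L k)) \<le> (\<Sum>k<K. 8 * t / \<sigma> * sn * (1 / 2) ^ k)"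
    proof (rule sum_mono)
      fix k assume "k \<in> {..<K}"
      then have "real (L k) \<le> 2 * x k" unfolding L_def using x1[of k] by auto linarith
      then show "real (L k) \<le> 8 * t / \<sigma> * sn * (1 / 2) ^ k" unfolding x_def by simp
    qed
    also have "\<dots> \<le> 8 * t / \<sigma> * sn * 2"
      unfolding sum_distrib_left[symmetric] using t0 \<sigma> sn by (intro mult_left_mono sum_half_powers) auto
    finally have "real (\<Sum>k<K. L k) \<le> 16 * t / \<sigma> * sn" by simp
    moreover have "real H \<le> sn + 1 + T + 1" unfolding H_def using T0 sn by linarith
    moreover have "real (L K) \<le> 8 * sn + 1" unfolding L_def using sn by simp
    moreover have "(12 + 5 * ln (1 / \<delta>) + 16 * t / \<sigma>) * sn = 12 * sn + T + 16 * t / \<sigma> * sn"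
      unfolding T_def by (simp add: algebra_simps)
    ultimately show ?thesis using sn(3) by simp
  qed
  ultimately show ?thesis unfolding t_def sn_def by blast
qed

end


section \<open>Walks\<close>

lemma walk_Cons: "walk V E (x # y # p) \<longleftrightarrow> x \<in> V \<and> {x, y} \<in> E \<and> walk V E (y # p)"
  by (auto simp: walk_def)

lemma walk_singleton [simp]: "walk V E [x] \<longleftrightarrow> x \<in> V"
  by (auto simp: walk_def)

lemma walk_rev: "walk V E (rev p) \<longleftrightarrow> walk V E p"
  by (simp add: walk_def insert_commute)

lemma walk_rev_ends:
  assumes "walk V E q" "hd q = v" "last q = w"
  shows "walk V E (rev q)" "hd (rev q) = w" "last (rev q) = v"
  using assms by (simp_all add: walk_rev) (auto simp: walk_def hd_rev last_rev)

lemma walk_mono: "walk V E p \<Longrightarrow> E \<subseteq> E' \<Longrightarrow> walk V E' p"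
  by (auto simp: walk_def elim: successively_mono)

lemma walk_join:
  assumes "walk V E p" "walk V E q" "last p = hd q"
  shows "walk V E (p @ tl q)" "hd (p @ tl q) = hd p" "last (p @ tl q) = last q"
proof -
  obtain b q' where q: "q = b # q'" using assms(2) by (cases q) (auto simp: walk_def)
  show "walk V E (p @ tl q)"
    using assms unfolding q walk_def
    by (cases q') (auto simp: successively_append_iff)
  show "hd (p @ tl q) = hd p" using assms(1) by (simp add: walk_def)
  show "last (p @ tl q) = last q" using assms(3) unfolding q by simp
qed

lemma graph_dist_le:
  assumes "walk V E p" "hd p = u" "last p = v"
  shows "graph_dist V E u v \<le> length p - 1"
  unfolding graph_dist_def
  by (rule Least_le) (use assms in \<open>auto simp: walk_def intro!: exI[of _ p]\<close>)

lemma graph_dist_walk: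
  assumes "connected_graph V E" "u \<in> V" "v \<in> V"
  shows "\<exists>p. walk V E p \<and> hd p = u \<and> last p = v \<and> length p = graph_dist V E u v + 1"
proof -
  obtain p where p: "walk V E p" "hd p = u" "last p = v"
    using assms by (auto simp: connected_graph_def)
  have "\<exists>p. walk V E p \<and> hd p = u \<and> last p = v \<and> length p = (length p - 1) + 1"
    using p by (auto simp: walk_def intro!: exI[of _ p])
  then have "\<exists>k p. walk V E p \<and> hd p = u \<and> last p = v \<and> length p = k + 1" by blast
  then show ?thesis unfolding graph_dist_def by (rule LeastI_ex)
qed

lemma shortest_walk_distinct:
  assumes "connected_graph V E" "u \<in> V" "v \<in> V"
  shows "\<exists>p. walk V E p \<and> hd p = u \<and> last p = v \<and> distinct p"
proof -
  obtain p where p: "walk V E p" "hd p = u" "last p = v" "length p = graph_dist V E u v + 1"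
    using graph_dist_walk[OF assms] by blast
  have "distinct p"
  proof (rule ccontr)
    assume "\<not> distinct p"
    then obtain as bs cs a where d: "p = as @ [a] @ bs @ [a] @ cs" using not_distinct_decomp by blast
    define q where "q = as @ [a] @ cs"
    have "walk V E q" using p(1) unfolding d q_def walk_def
      by (auto simp: successively_append_iff successively_Cons)
    moreover have "hd q = u" "last q = v" using p(2,3) unfolding d q_def by (cases as; simp)+
    ultimately have "graph_dist V E u v \<le> length q - 1" by (rule graph_dist_le)
    then show False using p(4) unfolding d q_def by simp
  qed
  then show ?thesis using p by blast
qed

lemma finite_dists: "finite V \<Longrightarrow> finite {graph_dist V E u v | u v. u \<in> V \<and> v \<in> V}"
  by (rule finite_subset[of _ "(\<lambda>(u, v). graph_dist V E u v) ` (V \<times> V)"]) auto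

lemma graph_dist_le_diam: "finite V \<Longrightarrow> u \<in> V \<Longrightarrow> v \<in> V \<Longrightarrow> graph_dist V E u v \<le> graph_diam V E"
  unfolding graph_diam_def by (rule Max_ge[OF finite_dists]) auto

lemma graph_diam_le:
  "finite V \<Longrightarrow> V \<noteq> {} \<Longrightarrow> (\<And>u v. u \<in> V \<Longrightarrow> v \<in> V \<Longrightarrow> graph_dist V E u v \<le> d) \<Longrightarrow> graph_diam V E \<le> d"
  unfolding graph_diam_def by (subst Max_le_iff[OF finite_dists]) blast+


section \<open>Spanning trees as parent functions\<close>

locale rooted_network = network V W for V :: "'a set" and W +
  fixes r :: 'a
  assumes r: "r \<in> V"
begin

definition edges :: "('a \<Rightarrow> 'a) \<Rightarrow> 'a set set" where
  "edges f = (\<lambda>v. {v, f v}) ` (V - {r})"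

lemma edgesD: "{x, y} \<in> edges f \<Longrightarrow> (x \<noteq> r \<and> f x = y) \<or> (y \<noteq> r \<and> f y = x)"
  unfolding edges_def by (auto simp: doubleton_eq_iff)

lemma edgesI: "v \<in> V \<Longrightarrow> v \<noteq> r \<Longrightarrow> {v, f v} \<in> edges f"
  unfolding edges_def by blast

lemma forest_walk:
  assumes f: "f \<in> forests {r}" and v: "v \<in> V" "(f ^^ h) v = r"
  shows "\<exists>p. walk V (edges f) p \<and> hd p = v \<and> last p = r \<and> length p \<le> h + 1"
  using v
proof (induction h arbitrary: v)
  case 0
  then show ?case by (intro exI[of _ "[v]"]) auto
next
  case (Suc h)
  show ?case
  proof (cases "v = r")
    case True
    then show ?thesis using Suc.prems by (intro exI[of _ "[v]"]) auto
  next
    case False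
    have "(f ^^ h) (f v) = r" using Suc.prems(2) by (simp add: funpow_swap1)
    then obtain p where p: "walk V (edges f) p" "hd p = f v" "last p = r" "length p \<le> h + 1"
      using Suc.IH[of "f v"] forestsD(3)[OF f Suc.prems(1)] by blast
    obtain p' where p': "p = f v # p'" using p(1,2) by (cases p) (auto simp: walk_def)
    show ?thesis
      using p edgesI[OF Suc.prems(1) False] Suc.prems(1) unfolding p'
      by (intro exI[of _ "v # f v # p'"]) (auto simp: walk_Cons)
  qed
qed

text \<open>An edge changes the depth by at most one, so no walk to \<open>r\<close> is shorter than
  the parent path. Surplus steps, as after moving to a child, are swallowed because \<open>r\<close>
  is absorbing.\<close>

lemma walk_to_root:
  assumes f: "f \<in> forests {r}" and p: "walk V (edges f) p" "last p = r"
  shows "(f ^^ (length p - 1)) (hd p) = r"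
  using p
proof (induction p)
  case (Cons a p)
  show ?case
  proof (cases p)
    case Nil
    then show ?thesis using Cons.prems by simp
  next
    case (Cons b p')
    have IH: "(f ^^ length p') b = r"
      using Cons.IH Cons.prems unfolding Cons by (simp add: walk_Cons)
    have "{a, b} \<in> edges f" using Cons.prems unfolding Cons by (simp add: walk_Cons)
    then consider "f a = b" | "f b = a" using edgesD by blast
    then have "(f ^^ Suc (length p')) a = r"
    proof cases
      case 1
      then show ?thesis using IH by (simp add: funpow_swap1)
    next
      case 2
      have "(f ^^ Suc (Suc (length p'))) b = r" using IH forestsD(2)[OF f, of r] by simp
      then show ?thesis using 2 unfolding funpow_Suc_right[of "Suc (length p')"] by simp
    qed
    then show ?thesis unfolding Cons by simp
  qed
qed (simp add: walk_def)

lemma edges_connected: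
  assumes f: "f \<in> forests {r}"
  shows "connected_graph V (edges f)"
proof -
  have to_root: "\<exists>p. walk V (edges f) p \<and> hd p = v \<and> last p = r" if v: "v \<in> V" for v
  proof -
    obtain h where "(f ^^ h) v = r" using forestsD(4)[OF f v] unfolding reaches_def by blast
    then show ?thesis using forest_walk[OF f v] by blast
  qed
  have "\<exists>p. walk V (edges f) p \<and> hd p = u \<and> last p = v" if "u \<in> V" "v \<in> V" for u v
  proof -
    obtain p where p: "walk V (edges f) p" "hd p = u" "last p = r" using to_root[OF \<open>u \<in> V\<close>] by blast
    obtain q where q: "walk V (edges f) q" "hd q = v" "last q = r" using to_root[OF \<open>v \<in> V\<close>] by blast
    have q': "walk V (edges f) (rev q)" "hd (rev q) = r" "last (rev q) = v"
      by (rule walk_rev_ends[OF q(1-3)])+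
    then show ?thesis using walk_join[OF p(1) q'(1)] p q' by metis
  qed
  then show ?thesis using r unfolding connected_graph_def by blast
qed

lemma edges_diam_le:
  assumes f: "f \<in> forests {r}" and h: "\<And>v. v \<in> V \<Longrightarrow> (f ^^ h) v = r"
  shows "graph_diam V (edges f) \<le> 2 * h"
proof (rule graph_diam_le[OF fin])
  fix u v assume uv: "u \<in> V" "v \<in> V"
  obtain p where p: "walk V (edges f) p" "hd p = u" "last p = r" "length p \<le> h + 1"
    using forest_walk[OF f uv(1) h[OF uv(1)]] by blast
  obtain q where q: "walk V (edges f) q" "hd q = v" "last q = r" "length q \<le> h + 1"
    using forest_walk[OF f uv(2) h[OF uv(2)]] by blast
  have q': "walk V (edges f) (rev q)" "hd (rev q) = r" "last (rev q) = v"
    by (rule walk_rev_ends[OF q(1-3)])+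
  have "graph_dist V (edges f) u v \<le> length (p @ tl (rev q)) - 1"
    using walk_join[OF p(1) q'(1)] p q' by (intro graph_dist_le) auto
  then show "graph_dist V (edges f) u v \<le> 2 * h" using p(4) q(4) by simp
qed (use r in auto)

text \<open>Turns a small diameter into the event of a short path from a single vertex, which
  \<open>root_short_le\<close> controls.\<close>

lemma edges_diam_ge:
  assumes f: "f \<in> forests {r}" and v: "v \<in> V" and d: "graph_diam V (edges f) \<le> h"
  shows "(f ^^ h) v = r"
proof -
  obtain p where p: "walk V (edges f) p" "hd p = v" "last p = r" "length p = graph_dist V (edges f) v r + 1"
    using graph_dist_walk[OF edges_connected[OF f] v r] by blast
  have le: "length p - 1 \<le> h" using p(4) d graph_dist_le_diam[OF fin v r, of "edges f"] by simp
  have "(f ^^ (length p - 1)) v \<in> {r}" using walk_to_root[OF f p(1,3)] p(2) by simp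
  from forests_absorb[OF f this le] this show ?thesis by simp
qed

text \<open>On a cycle, the neighbours of a deepest vertex could only be its parent, but it has two
  different neighbours there.\<close>

lemma edges_acyclic:
  assumes f: "f \<in> forests {r}"
  shows "\<not> graph_cycle V (edges f) p"
proof
  assume c: "graph_cycle V (edges f) p"
  define d where "d v = (LEAST k. (f ^^ k) v = r)" for v
  have dsuc: "d v = Suc (d (f v))" if v: "v \<in> V" "v \<noteq> r" for v
  proof -
    obtain k where "(f ^^ k) v = r" using forestsD(4)[OF f v(1)] unfolding reaches_def by blast
    then have "d v = Suc (LEAST m. (f ^^ Suc m) v = r)"
      unfolding d_def by (rule Least_Suc) (use v in simp)
    then show ?thesis unfolding d_def by (simp only: funpow_Suc_right o_apply)
  qed
  have p: "set p \<subseteq> V" "distinct p" "length p \<ge> 3" "{last p, hd p} \<in> edges f"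
    "successively (\<lambda>u v. {u, v} \<in> edges f) p" "p \<noteq> []"
    using c by (auto simp: graph_cycle_def walk_def)
  have "Max (d ` set p) \<in> d ` set p" using p by (intro Max_in) auto
  then obtain x where x: "x \<in> set p" "d x = Max (d ` set p)" by force
  have mx: "d y \<le> d x" if "y \<in> set p" for y using that unfolding x(2) by simp
  obtain xs ys where xy: "p = xs @ x # ys" using split_list[OF x(1)] by blast
  \<comment> \<open>The rest of the cycle in cyclic order after \<open>x\<close>, so that its first
    and last elements are the two neighbours of \<open>x\<close>.\<close>
  define q where "q = ys @ xs"
  have q: "distinct q" "length q \<ge> 2" "set q \<subseteq> set p" using p unfolding xy q_def by auto
  have nb: "f x = a" if a: "a \<in> set p" "{x, a} \<in> edges f" for a
  proof (rule ccontr)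
    assume "f x \<noteq> a"
    then have "a \<noteq> r" "f a = x" using edgesD[OF a(2)] by auto
    then have "d a = Suc (d x)" using dsuc[of a] a p by auto
    then show False using mx[OF a(1)] by simp
  qed
  have h: "{x, hd q} \<in> edges f"
    using p(4,5) q(2) unfolding xy q_def
    by (cases ys; cases xs) (auto simp: successively_append_iff successively_Cons insert_commute)
  have l: "{x, last q} \<in> edges f"
    using p(4,5) q(2) unfolding xy q_def
    by (cases ys rule: rev_cases; cases xs rule: rev_cases)
      (auto simp: successively_append_iff successively_Cons insert_commute)
  have "q \<noteq> []" using q(2) by auto
  then have "hd q = last q" using nb[OF _ h] nb[OF _ l] q(3) by (metis hd_in_set last_in_set subsetD)
  moreover have "hd q \<noteq> last q"
  proof -
    obtain a b q' where "q = a # b # q'" using q(2) by (metis One_nat_def Suc_1 Suc_le_length_iff)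
    then show ?thesis using q(1) by (metis distinct.simps(2) last.simps last_in_set list.sel(1) list.distinct(1))
  qed
  ultimately show False by simp
qed

lemma edges_in_spanning_trees:
  assumes f: "f \<in> forests {r}"
  shows "edges f \<in> spanning_trees V (complete_edges V)"
proof -
  have "f v \<noteq> v" if "v \<in> V - {r}" for v using forests_no_cycle[OF f, of v 0] that by auto
  then have "card {v, f v} = 2" if "v \<in> V - {r}" for v using that by (metis card_2_iff)
  then have "edges f \<subseteq> complete_edges V"
    unfolding edges_def complete_edges_def using forestsD(3)[OF f] by auto
  then show ?thesis
    using edges_connected[OF f] edges_acyclic[OF f] by (simp add: spanning_trees_def tree_def)
qed

text \<open>Induction from the root outwards. The edge from \<open>v\<close> to \<open>f v\<close>
  also occurs in \<open>edges g\<close>; if it were oriented the other way there, \<open>f\<close>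
  and \<open>g\<close> agreeing at \<open>f v\<close> would give \<open>f\<close> a cycle of length
  two.\<close>

lemma inj_edges: "inj_on edges (forests {r})"
proof (rule inj_onI)
  fix f g assume f: "f \<in> forests {r}" and g: "g \<in> forests {r}" and eq: "edges f = edges g"
  have "f v = g v" if v: "v \<in> V" for v
  proof -
    have "reaches f {r} v" by (rule forestsD(4)[OF f v])
    then have "v \<in> V \<longrightarrow> f v = g v"
    proof (induction rule: reaches_induct)
      case (base v)
      then show ?case using forestsD(2)[OF f] forestsD(2)[OF g] by simp
    next
      case (step v)
      show ?case
      proof
        assume v: "v \<in> V"
        have fv: "f (f v) = g (f v)" using step.IH forestsD(3)[OF f v] by blast
        have "{v, f v} \<in> edges g" using edgesI[of v f] v step.hyps unfolding eq by simp
        then consider "g v = f v" | "g (f v) = v" using edgesD by blast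
        then show "f v = g v"
        proof cases
          case 2
          then have "(f ^^ Suc 1) v = v" using fv by simp
          then have "v \<in> {r}" by (rule forests_no_cycle[OF f v])
          then show ?thesis using step.hyps by simp
        qed simp
      qed
    qed
    then show ?thesis using v by simp
  qed
  then show "f = g" using forestsD(1)[OF f] forestsD(1)[OF g] by (metis ext)
qed

text \<open>The parent of \<open>v\<close> is a neighbour in \<open>T\<close> closer to
  \<open>r\<close>. Any further edge of \<open>T\<close> would close a cycle with a simple path in
  \<open>edges f\<close> between its ends.\<close>

lemma spanning_tree_edges:
  assumes T: "T \<in> spanning_trees V (complete_edges V)"
  shows "\<exists>f\<in>forests {r}. edges f = T"
proof -
  have con: "connected_graph V T" and acyc: "\<And>p. \<not> graph_cycle V T p" and sub: "T \<subseteq> complete_edges V"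
    using T by (auto simp: spanning_trees_def tree_def)
  define d where "d v = graph_dist V T v r" for v
  define f where "f v = (if v \<in> V - {r} then SOME u. {v, u} \<in> T \<and> d u < d v else v)" for v
  have fv: "{v, f v} \<in> T \<and> d (f v) < d v" if v: "v \<in> V" "v \<noteq> r" for v
  proof -
    obtain p where p: "walk V T p" "hd p = v" "last p = r" "length p = d v + 1"
      using graph_dist_walk[OF con v(1) r] unfolding d_def by blast
    obtain u p' where p': "p = v # u # p'"
      using p v by (cases p; cases "tl p") (auto simp: walk_def)
    have "d u \<le> length (u # p') - 1"
      unfolding d_def using p unfolding p' by (intro graph_dist_le) (auto simp: walk_Cons)
    then have "{v, u} \<in> T \<and> d u < d v" using p unfolding p' by (auto simp: walk_Cons)
    then have "{v, SOME u. {v, u} \<in> T \<and> d u < d v} \<in> T \<and> d (SOME u. {v, u} \<in> T \<and> d u < d v) < d v"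
      by (rule someI)
    then show ?thesis using v by (simp add: f_def)
  qed
  have fV: "f v \<in> V" if "v \<in> V" for v
  proof (cases "v = r")
    case False
    then show ?thesis using fv[OF that] sub unfolding complete_edges_def by auto
  qed (use that in \<open>simp add: f_def\<close>)
  have "reaches f {r} v" if "v \<in> V" for v
    using that
  proof (induction "d v" arbitrary: v rule: less_induct)
    case less
    show ?case
    proof (cases "v = r")
      case False
      then show ?thesis using less.hyps[of "f v"] fv[OF less.prems] fV[OF less.prems] reaches_step by metis
    qed (simp add: reaches_refl)
  qed
  then have f: "f \<in> forests {r}" unfolding forests_def using fV by (auto simp: f_def)
  have "edges f \<subseteq> T" unfolding edges_def using fv by auto
  moreover have "T \<subseteq> edges f"
  proof (rule ccontr)
    assume "\<not> T \<subseteq> edges f"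
    then obtain e where e: "e \<in> T" "e \<notin> edges f" by blast
    then have "e \<subseteq> V" "card e = 2" using sub unfolding complete_edges_def by auto
    then obtain x y where xy: "e = {x, y}" "x \<noteq> y" "x \<in> V" "y \<in> V" by (auto simp: card_2_iff)
    obtain p where p: "walk V (edges f) p" "hd p = x" "last p = y" "distinct p"
      using shortest_walk_distinct[OF edges_connected[OF f] xy(3,4)] by blast
    have "length p \<ge> 3"
    proof (rule ccontr)
      assume "\<not> length p \<ge> 3"
      moreover have "p \<noteq> []" using p(1) by (simp add: walk_def)
      ultimately consider "p = [x]" | b where "p = [x, b]"
        using p(2) by (cases p; cases "tl p"; cases "tl (tl p)") auto
      then show False using p xy e by cases (auto simp: walk_Cons)
    qed
    moreover have "walk V T p" using walk_mono[OF p(1) \<open>edges f \<subseteq> T\<close>] .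
    ultimately have "graph_cycle V T p"
      using p e xy by (auto simp: graph_cycle_def insert_commute)
    then show False using acyc by blast
  qed
  ultimately show ?thesis using f by blast
qed

lemma prod_edges:
  assumes f: "f \<in> forests {r}" and w: "\<And>u v. u \<in> V \<Longrightarrow> v \<in> V \<Longrightarrow> u \<noteq> v \<Longrightarrow> W u v = w {u, v}"
  shows "(\<Prod>e\<in>edges f. w e) = forest_weight {r} f"
proof -
  have "inj_on (\<lambda>v. {v, f v}) (V - {r})"
  proof (rule inj_onI, rule ccontr)
    fix u v assume uv: "u \<in> V - {r}" "v \<in> V - {r}" "{u, f u} = {v, f v}" "u \<noteq> v"
    then have "f u = v" "f v = u" by (auto simp: doubleton_eq_iff)
    then have "(f ^^ Suc 1) u = u" by simp
    then show False using forests_no_cycle[OF f, of u 1] uv by auto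
  qed
  then have "(\<Prod>e\<in>edges f. w e) = (\<Prod>v\<in>V - {r}. w {v, f v})"
    unfolding edges_def by (subst prod.reindex) auto
  also have "\<dots> = forest_weight {r} f" unfolding forest_weight_def
  proof (rule prod.cong[OF refl])
    fix v assume v: "v \<in> V - {r}"
    then have "v \<noteq> f v" using forests_no_cycle[OF f, of v 0] by auto
    then show "w {v, f v} = W v (f v)" using w[of v "f v"] forestsD(3)[OF f, of v] v by simp
  qed
  finally show ?thesis .
qed

lemma sum_spanning_trees:
  assumes w: "\<And>u v. u \<in> V \<Longrightarrow> v \<in> V \<Longrightarrow> u \<noteq> v \<Longrightarrow> W u v = w {u, v}"
  shows "(\<Sum>T\<in>spanning_trees V (complete_edges V). (\<Prod>e\<in>T. w e) * of_bool (Q T)) = mass {r} (\<lambda>f. Q (edges f))"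
proof -
  have "bij_betw edges (forests {r}) (spanning_trees V (complete_edges V))"
    unfolding bij_betw_def using inj_edges edges_in_spanning_trees spanning_tree_edges by blast
  then show ?thesis
    unfolding mass_def wsum_def
    by (subst sum.reindex_bij_betw[symmetric]) (auto intro!: sum.cong simp: prod_edges[OF _ w])
qed

lemma weighted_ust_prob:
  assumes w: "\<And>u v. u \<in> V \<Longrightarrow> v \<in> V \<Longrightarrow> u \<noteq> v \<Longrightarrow> W u v = w {u, v}"
    and bad: "mass {r} (\<lambda>f. \<not> Q (edges f)) \<le> \<epsilon> * Z {r}" and \<epsilon>: "\<epsilon> \<ge> 0"
  shows "measure_pmf.prob (weighted_ust V (complete_edges V) w) {T. Q T} \<ge> 1 - \<epsilon>"
proof -
  let ?M = "weighted_ust V (complete_edges V) w"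
  let ?S = "spanning_trees V (complete_edges V)"
  let ?P = "partition_function V (complete_edges V) w"
  have finE: "finite (complete_edges V)"
    by (rule finite_subset[of _ "Pow V"]) (use fin in \<open>auto simp: complete_edges_def\<close>)
  then have finS: "finite ?S"
    by (intro finite_subset[of ?S "Pow (complete_edges V)"]) (auto simp: spanning_trees_def)
  have wpos: "w e > 0" if "e \<in> complete_edges V" for e
  proof -
    have "e \<subseteq> V" "card e = 2" using that unfolding complete_edges_def by auto
    then obtain x y where "e = {x, y}" "x \<noteq> y" "x \<in> V" "y \<in> V" by (auto simp: card_2_iff)
    then show ?thesis using W_pos[of x y] w[of x y] by simp
  qed
  have pmf: "pmf ?M T = (if T \<in> ?S then (\<Prod>e\<in>T. w e) / ?P else 0)" for T
    using r by (intro pmf_weighted_ust finE spanning_trees_complete_nonempty wpos) auto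
  have P: "?P = Z {r}"
    using sum_spanning_trees[OF w, of "\<lambda>_. True"] unfolding partition_function_def by simp
  have "measure_pmf.prob ?M {T. \<not> Q T} = measure_pmf.prob ?M {T \<in> ?S. \<not> Q T}"
    by (rule measure_prob_cong_0) (auto simp: pmf)
  also have "\<dots> = (\<Sum>T\<in>{T \<in> ?S. \<not> Q T}. pmf ?M T)"
    using finS by (intro measure_measure_pmf_finite) auto
  also have "\<dots> = (\<Sum>T\<in>?S. (\<Prod>e\<in>T. w e) * of_bool (\<not> Q T) / ?P)"
    by (rule sum.mono_neutral_cong_left) (use finS in \<open>auto simp: pmf\<close>)
  also have "\<dots> = mass {r} (\<lambda>f. \<not> Q (edges f)) / Z {r}"
    unfolding sum_divide_distrib[symmetric] P using sum_spanning_trees[OF w, of "\<lambda>T. \<not> Q T"] by simp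
  \<comment> \<open>For \<open>Z {r} = 0\<close> the quotient is 0 by convention.\<close>
  also have "\<dots> \<le> \<epsilon>"
  proof (cases "Z {r} = 0")
    case False
    then have "Z {r} > 0" using mass_nonneg[of "{r}" "\<lambda>_. True"] by linarith
    then show ?thesis using bad by (simp only: pos_divide_le_eq)
  qed (use \<epsilon> in simp)
  finally have "measure_pmf.prob ?M {T. \<not> Q T} \<le> \<epsilon>" .
  moreover have "measure_pmf.prob ?M (UNIV - {T. Q T}) = 1 - measure_pmf.prob ?M {T. Q T}"
    using measure_pmf.prob_compl[of "{T. Q T}" ?M] by simp
  moreover have "UNIV - {T. Q T} = {T. \<not> Q T}" by auto
  ultimately show ?thesis by simp
qed

end


section \<open>The random environment\<close>

text \<open>The underlying random graph with edge probability \<open>1 / n\<close>. It is free of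
  \<open>\<gamma>\<close>, and it cannot be recovered from the weights when
  \<open>\<gamma> = -1\<close>, where both values are 1.\<close>

definition coins :: "nat \<Rightarrow> (nat set \<Rightarrow> bool) pmf" where
  "coins n = Pi_pmf (K_edges n) False (\<lambda>_. bernoulli_pmf (1 / real n))"

lemma weights_pmf_coins:
  "weights_pmf n \<gamma> =
    map_pmf (\<lambda>b e. if e \<in> K_edges n then if b e then real n powr (1 + \<gamma>) else 1 else 0) (coins n)"
proof -
  let ?f = "\<lambda>b. if b then real n powr (1 + \<gamma>) else 1"
  have "weights_pmf n \<gamma> = map_pmf (\<lambda>f x. if x \<in> K_edges n then f x else 0)
      (Pi_pmf (K_edges n) 1 (\<lambda>_. map_pmf ?f (bernoulli_pmf (1 / real n))))"
    unfolding weights_pmf_def edge_weight_pmf_def by (rule Pi_pmf_default_swap[OF finite_K_edges, symmetric])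
  also have "Pi_pmf (K_edges n) 1 (\<lambda>_. map_pmf ?f (bernoulli_pmf (1 / real n))) = map_pmf (\<lambda>h. ?f \<circ> h) (coins n)"
    unfolding coins_def by (rule Pi_pmf_map[OF finite_K_edges]) simp
  finally show ?thesis by (simp add: pmf.map_comp o_def)
qed

lemma finite_coins: "finite (set_pmf (coins n))"
  unfolding coins_def
  by (rule finite_subset[OF set_Pi_pmf_subset'[OF finite_K_edges]]) (auto intro!: finite_PiE_dflt finite_K_edges)

lemma integrable_coins [simp]: "integrable (measure_pmf (coins n)) (f :: _ \<Rightarrow> real)"
  by (rule integrable_measure_pmf_finite[OF finite_coins])

lemma expectation_of_bool:
  "measure_pmf.expectation p (\<lambda>b. of_bool (P b) :: real) = measure_pmf.prob p {b. P b}"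
proof -
  have "(\<lambda>b. of_bool (P b) :: real) = indicator {b. P b}" by (auto simp: indicator_def)
  then show ?thesis by simp
qed

definition star :: "nat \<Rightarrow> nat \<Rightarrow> nat set set" where
  "star n u = {e \<in> K_edges n. u \<in> e}"

lemma star_eq: "u < n \<Longrightarrow> star n u = (\<lambda>v. {u, v}) ` ({..<n} - {u})"
  unfolding star_def complete_edges_def by (fastforce simp: card_2_iff)

lemma inj_pair: "inj_on (\<lambda>v. {u, v}) A"
  by (auto simp: inj_on_def doubleton_eq_iff)

lemma card_star: "u < n \<Longrightarrow> card (star n u) = n - 1"
  by (simp add: star_eq card_image[OF inj_pair])

lemma finite_star: "finite (star n u)"
  unfolding star_def using finite_K_edges by simp

lemma card_star_Un:
  assumes "u < n" "v < n" "u \<noteq> v"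
  shows "card (star n u \<union> star n v) = 2 * n - 3"
proof -
  have "star n u \<inter> star n v = {{u, v}}"
    using assms unfolding star_def complete_edges_def by (fastforce simp: card_2_iff)
  then have "card (star n u \<union> star n v) + 1 = (n - 1) + (n - 1)"
    using card_Un_Int[OF finite_star[of n u] finite_star[of n v]] card_star assms by simp
  then show ?thesis by simp
qed

lemma prob_no_coins:
  assumes n: "n > 0" and A: "A \<subseteq> K_edges n"
  shows "measure_pmf.prob (coins n) {b. \<forall>e\<in>A. \<not> b e} = (1 - 1 / real n) ^ card A"
proof -
  have b: "measure_pmf.prob (bernoulli_pmf (1 / real n)) {False} = 1 - 1 / real n"
    using n by (simp add: measure_pmf_single)
  have "{b. \<forall>e\<in>A. \<not> b e} = Pi (K_edges n) (\<lambda>e. if e \<in> A then {False} else UNIV)"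
    using A by (auto simp: Pi_def split: if_splits)
  then have "measure_pmf.prob (coins n) {b. \<forall>e\<in>A. \<not> b e} =
    (\<Prod>e\<in>K_edges n. measure_pmf.prob (bernoulli_pmf (1 / real n)) (if e \<in> A then {False} else UNIV))"
    unfolding coins_def by (simp only: measure_Pi_pmf_Pi[OF finite_K_edges])
  also have "\<dots> = (\<Prod>e\<in>K_edges n. if e \<in> A then 1 - 1 / real n else 1)"
    by (intro prod.cong refl) (simp add: b)
  also have "\<dots> = (\<Prod>e\<in>A. 1 - 1 / real n)"
    using A finite_K_edges by (subst prod.inter_restrict[symmetric]) (auto simp: Int_absorb1)
  finally show ?thesis by simp
qed

lemma e_bound: "(1 + 1 / real m) ^ m \<le> 3"
proof (cases "m = 0")
  case False
  have "(1 + 1 / real m) ^ m \<le> exp (1 / real m) ^ m"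
    by (intro power_mono exp_ge_add_one_self) auto
  also have "\<dots> = exp 1" using False by (simp add: exp_of_nat_mult[symmetric])
  finally show ?thesis using exp_le by linarith
qed simp

text \<open>The number of isolated vertices has variance equal to its mean.\<close>

lemma prob_no_isolated:
  assumes n: "n \<ge> 2"
  shows "measure_pmf.prob (coins n) {b. \<forall>u<n. \<exists>e\<in>star n u. b e} \<le> 3 / real n"
proof -
  define p where "p = (1 - 1 / real n) ^ (n - 1)"
  define I where "I u b = (of_bool (\<forall>e\<in>star n u. \<not> b e) :: real)" for u b
  define X where "X b = (\<Sum>u<n. I u b)" for b
  have sK: "star n u \<subseteq> K_edges n" for u unfolding star_def by auto
  have p3: "p \<ge> 1 / 3"
  proof -
    have "1 - 1 / real n = inverse (1 + 1 / real (n - 1))" using n by (simp add: field_simps)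
    then have "p = inverse ((1 + 1 / real (n - 1)) ^ (n - 1))" unfolding p_def by (simp add: power_inverse)
    also have "\<dots> \<ge> inverse 3"
      using e_bound[of "n - 1"] by (intro le_imp_inverse_le) (auto intro!: zero_less_power add_pos_nonneg)
    finally show ?thesis by (simp add: inverse_eq_divide)
  qed
  have EI: "measure_pmf.expectation (coins n) (I u) = p" if "u < n" for u
    unfolding I_def expectation_of_bool using prob_no_coins[OF _ sK] card_star[OF that] n by (simp add: p_def)
  have EII: "measure_pmf.expectation (coins n) (\<lambda>b. I u b * I v b) =
      (if u = v then p else (1 - 1 / real n) ^ (2 * n - 3))" if "u < n" "v < n" for u v
  proof (cases "u = v")
    case True
    have "(\<lambda>b. I u b * I v b) = I u" using True unfolding I_def fun_eq_iff by auto
    then show ?thesis using EI[OF that(1)] True by (simp only: if_True refl)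
  next
    case False
    have "(\<lambda>b. I u b * I v b) = (\<lambda>b. of_bool (\<forall>e\<in>star n u \<union> star n v. \<not> b e))"
      unfolding I_def fun_eq_iff by auto
    then have "measure_pmf.expectation (coins n) (\<lambda>b. I u b * I v b)
      = measure_pmf.prob (coins n) {b. \<forall>e\<in>star n u \<union> star n v. \<not> b e}"
      by (simp only: expectation_of_bool)
    then show ?thesis
      using False prob_no_coins[of n "star n u \<union> star n v"] sK n card_star_Un[OF that False] by simp
  qed
  have EX: "measure_pmf.expectation (coins n) X = real n * p"
    unfolding X_def by (subst Bochner_Integration.integral_sum) (simp_all add: EI)
  have EXX: "measure_pmf.expectation (coins n) (\<lambda>b. X b * X b) = real n * p + (real n * p)\<^sup>2"
  proof -
    have "measure_pmf.expectation (coins n) (\<lambda>b. X b * X b)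
      = (\<Sum>u<n. \<Sum>v<n. if u = v then p else (1 - 1 / real n) ^ (2 * n - 3))"
      unfolding X_def sum_product by (simp add: EII)
    also have "\<dots> = (\<Sum>u<n. p + real (n - 1) * (1 - 1 / real n) ^ (2 * n - 3))"
    proof (rule sum.cong[OF refl])
      fix u assume u: "u \<in> {..<n}"
      have "(\<Sum>v<n. if u = v then p else (1 - 1 / real n) ^ (2 * n - 3)) =
        p + (\<Sum>v\<in>{..<n} - {u}. if u = v then p else (1 - 1 / real n) ^ (2 * n - 3))"
        using u by (subst sum.remove[of _ u]) auto
      also have "(\<Sum>v\<in>{..<n} - {u}. if u = v then p else (1 - 1 / real n) ^ (2 * n - 3))
        = (\<Sum>v\<in>{..<n} - {u}. (1 - 1 / real n) ^ (2 * n - 3))" by (intro sum.cong) auto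
      finally show "(\<Sum>v<n. if u = v then p else (1 - 1 / real n) ^ (2 * n - 3))
        = p + real (n - 1) * (1 - 1 / real n) ^ (2 * n - 3)" using u by simp
    qed
    also have "\<dots> = real n * p + real n * (real (n - 1) * (1 - 1 / real n) ^ (2 * n - 3))"
      by (simp only: sum_constant card_lessThan distrib_left)
    \<comment> \<open>Two stars share one edge, which reduces the exponent from
      \<open>2 * (n - 1)\<close> to \<open>2 * n - 3\<close>; the factor \<open>n - 1\<close>, being
      \<open>n * (1 - 1 / n)\<close>, restores it exactly.\<close>
    also have "real (n - 1) * (1 - 1 / real n) ^ (2 * n - 3) = real n * p\<^sup>2"
    proof -
      have "real (n - 1) = real n * (1 - 1 / real n)" using n by (simp add: field_simps)
      moreover have "(1 - 1 / real n) * (1 - 1 / real n) ^ (2 * n - 3) = p\<^sup>2"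
      proof -
        have "Suc (2 * n - 3) = (n - 1) * 2" using n by simp
        then show ?thesis unfolding p_def power_mult[symmetric] power_Suc[symmetric] by simp
      qed
      ultimately show ?thesis by (simp add: mult.assoc)
    qed
    finally show ?thesis by (simp add: power2_eq_square algebra_simps)
  qed
  have "(real n * p)\<^sup>2 * measure_pmf.prob (coins n) {b. \<forall>u<n. \<exists>e\<in>star n u. b e}
    = measure_pmf.expectation (coins n) (\<lambda>b. (real n * p)\<^sup>2 * of_bool (\<forall>u<n. \<exists>e\<in>star n u. b e))"
    by (simp only: expectation_of_bool integral_mult_right_zero)
  \<comment> \<open>Chebyshev's inequality at \<open>X = 0\<close>: there the square of
    \<open>X - n * p\<close> equals \<open>(n * p)^2\<close>.\<close>
  also have "\<dots> \<le> measure_pmf.expectation (coins n) (\<lambda>b. X b * X b - 2 * (real n * p) * X b + (real n * p)\<^sup>2)"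
  proof (rule integral_mono)
    fix b
    have "X b = 0" if "\<forall>u<n. \<exists>e\<in>star n u. b e" using that unfolding X_def I_def by auto
    moreover have "0 \<le> X b * X b - 2 * (real n * p) * X b + (real n * p)\<^sup>2"
      using zero_le_power2[of "X b - real n * p"] by (simp add: power2_eq_square algebra_simps)
    ultimately show "(real n * p)\<^sup>2 * of_bool (\<forall>u<n. \<exists>e\<in>star n u. b e)
      \<le> X b * X b - 2 * (real n * p) * X b + (real n * p)\<^sup>2" by auto
  qed auto
  also have "\<dots> = real n * p + (real n * p)\<^sup>2 - 2 * (real n * p) * (real n * p) + (real n * p)\<^sup>2"
    by (simp add: EXX EX)
  also have "\<dots> = real n * p" by (simp add: power2_eq_square)
  finally have "(real n * p) * ((real n * p) * measure_pmf.prob (coins n) {b. \<forall>u<n. \<exists>e\<in>star n u. b e}) \<le> (real n * p) * 1"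
    by (simp add: power2_eq_square mult.assoc)
  moreover have np: "real n * p > 0" using n p3 by simp
  ultimately have "(real n * p) * measure_pmf.prob (coins n) {b. \<forall>u<n. \<exists>e\<in>star n u. b e} \<le> 1"
    by (simp only: mult_le_cancel_left_pos)
  moreover have "real n * (1 / 3) * measure_pmf.prob (coins n) {b. \<forall>u<n. \<exists>e\<in>star n u. b e}
     \<le> (real n * p) * measure_pmf.prob (coins n) {b. \<forall>u<n. \<exists>e\<in>star n u. b e}"
    using p3 by (intro mult_right_mono mult_left_mono) auto
  ultimately have "real n * (1 / 3) * measure_pmf.prob (coins n) {b. \<forall>u<n. \<exists>e\<in>star n u. b e} \<le> 1"
    by linarith
  then show ?thesis using n by (simp add: pos_le_divide_eq mult.commute)
qed

section \<open>Degrees and the good environments\<close>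

definition special :: "nat \<Rightarrow> (nat set \<Rightarrow> bool) \<Rightarrow> nat \<Rightarrow> nat \<Rightarrow> bool" where
  "special n b u v \<longleftrightarrow> {u, v} \<in> K_edges n \<and> b {u, v}"

text \<open>Markov's inequality for 2 to the power of the degree of \<open>u\<close>: its
  expectation factorises over the edges at \<open>u\<close> into
  \<open>(1 + 1 / n) ^ (n - 1)\<close>.\<close>

lemma prob_large_degree:
  assumes n: "n > 0" and u: "u < n"
  shows "measure_pmf.prob (coins n) {b. D < real (card {v \<in> {..<n}. special n b u v})} \<le> 3 * 2 powr (- D)"
proof -
  define f where "f e y = (if u \<in> e \<and> y then 2 else 1 :: real)" for e :: "nat set" and y
  have E: "measure_pmf.expectation (coins n) (\<lambda>b. \<Prod>e\<in>K_edges n. f e (b e)) \<le> 3"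
  proof -
    have "measure_pmf.expectation (coins n) (\<lambda>b. \<Prod>e\<in>K_edges n. f e (b e)) =
      (\<Prod>e\<in>K_edges n. measure_pmf.expectation (bernoulli_pmf (1 / real n)) (f e))"
      unfolding coins_def
      by (rule expectation_prod_Pi_pmf[OF finite_K_edges])
        (auto intro!: integrable_measure_pmf_finite simp: f_def)
    also have "\<dots> = (\<Prod>e\<in>K_edges n. if e \<in> star n u then 1 + 1 / real n else 1)"
      using n by (intro prod.cong refl) (auto simp: f_def star_def field_simps)
    also have "\<dots> = (\<Prod>e\<in>star n u. 1 + 1 / real n)"
      using finite_K_edges by (subst prod.inter_restrict[symmetric]) (auto simp: star_def Int_def intro!: prod.cong)
    also have "\<dots> = (1 + 1 / real n) ^ (n - 1)" using card_star[OF u] by simp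
    also have "\<dots> \<le> (1 + 1 / real n) ^ n" by (intro power_increasing) auto
    also have "\<dots> \<le> 3" by (rule e_bound)
    finally show ?thesis .
  qed
  have deg: "2 powr (D) * of_bool (D < real (card {v \<in> {..<n}. special n b u v})) \<le> (\<Prod>e\<in>K_edges n. f e (b e))" for b
  proof (cases "D < real (card {v \<in> {..<n}. special n b u v})")
    case True
    have "card {v \<in> {..<n}. special n b u v} = card ((\<lambda>v. {u, v}) ` {v \<in> {..<n}. special n b u v})"
      by (simp add: card_image[OF inj_pair])
    also have "\<dots> \<le> card {e \<in> K_edges n. u \<in> e \<and> b e}"
      using finite_K_edges by (intro card_mono) (auto simp: special_def)
    finally have c: "card {v \<in> {..<n}. special n b u v} \<le> card {e \<in> K_edges n. u \<in> e \<and> b e}" .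
    have "2 powr D \<le> 2 powr real (card {e \<in> K_edges n. u \<in> e \<and> b e})"
      using True c by (intro powr_mono) auto
    also have "\<dots> = (\<Prod>e\<in>{e \<in> K_edges n. u \<in> e \<and> b e}. 2)" by (simp add: powr_realpow)
    also have "\<dots> = (\<Prod>e\<in>K_edges n. f e (b e))"
      using finite_K_edges by (intro prod.mono_neutral_cong_left) (auto simp: f_def)
    finally show ?thesis using True by simp
  next
    case False
    then show ?thesis by (auto intro!: prod_nonneg simp: f_def)
  qed
  have "2 powr D * measure_pmf.prob (coins n) {b. D < real (card {v \<in> {..<n}. special n b u v})} =
    measure_pmf.expectation (coins n) (\<lambda>b. 2 powr D * of_bool (D < real (card {v \<in> {..<n}. special n b u v})))"
    by (simp only: expectation_of_bool integral_mult_right_zero)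
  also have "\<dots> \<le> measure_pmf.expectation (coins n) (\<lambda>b. \<Prod>e\<in>K_edges n. f e (b e))"
    by (intro integral_mono deg) auto
  also note E
  finally show ?thesis by (simp add: powr_minus field_simps)
qed

text \<open>The environments to which \<open>sparse_network\<close> applies. Which vertex without
  heavy edges becomes the root is immaterial, since the law of the unrooted tree does not involve
  it.\<close>

definition regular :: "nat \<Rightarrow> real \<Rightarrow> (nat set \<Rightarrow> bool) \<Rightarrow> bool" where
  "regular n D b \<longleftrightarrow> (\<forall>u<n. real (card {v \<in> {..<n}. special n b u v}) \<le> D) \<and>
    (\<exists>r<n. \<forall>v. \<not> special n b r v)"

lemma prob_regular:
  assumes n: "n \<ge> 2"
  shows "measure_pmf.prob (coins n) {b. regular n D b} \<ge> 1 - (3 * real n * 2 powr (- D) + 3 / real n)"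
proof -
  let ?P = "measure_pmf.prob (coins n)"
  let ?A = "\<Union>u\<in>{..<n}. {b. D < real (card {v \<in> {..<n}. special n b u v})}"
  let ?B = "{b. \<forall>u<n. \<exists>e\<in>star n u. b e}"
  have "UNIV - {b. regular n D b} \<subseteq> ?A \<union> ?B"
  proof
    fix b assume b: "b \<in> UNIV - {b. regular n D b}"
    show "b \<in> ?A \<union> ?B"
    proof (cases "b \<in> ?A")
      case False
      then have nr: "\<And>r. r < n \<Longrightarrow> \<exists>v. special n b r v" using b unfolding regular_def by (fastforce simp: not_less)
      have "\<exists>e\<in>star n u. b e" if u: "u < n" for u
      proof -
        obtain v where "special n b u v" using nr[OF u] by blast
        then show ?thesis unfolding special_def star_def by (intro bexI[of _ "{u, v}"]) auto
      qed
      then show ?thesis by simp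
    qed simp
  qed
  then have "?P (UNIV - {b. regular n D b}) \<le> ?P (?A \<union> ?B)"
    by (intro measure_pmf.finite_measure_mono) auto
  also have "\<dots> \<le> ?P ?A + ?P ?B" by (rule measure_Un_le) auto
  also have "?P ?A \<le> (\<Sum>u<n. ?P {b. D < real (card {v \<in> {..<n}. special n b u v})})"
    by (rule measure_pmf.finite_measure_subadditive_finite) auto
  also have "\<dots> \<le> (\<Sum>u<n. 3 * 2 powr (- D))" using n by (intro sum_mono prob_large_degree) auto
  also have "?P ?B \<le> 3 / real n" by (rule prob_no_isolated[OF n])
  finally have "?P (UNIV - {b. regular n D b}) \<le> 3 * real n * 2 powr (- D) + 3 / real n"
    by simp
  moreover have "?P (UNIV - {b. regular n D b}) = 1 - ?P {b. regular n D b}"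
    using measure_pmf.prob_compl[of "{b. regular n D b}" "coins n"] by simp
  ultimately show ?thesis by simp
qed


section \<open>The diameter\<close>

lemma exists_power4:
  fixes \<sigma> l :: real
  assumes "0 < \<sigma>" "\<sigma> \<le> 4 * l"
  shows "\<exists>K. l \<le> 4 ^ K * \<sigma> \<and> 4 ^ K * \<sigma> \<le> 4 * l"
proof -
  have ex: "\<exists>K. l \<le> 4 ^ K * \<sigma>"
  proof -
    obtain K where "l / \<sigma> < 4 ^ K" using real_arch_pow[of 4 "l / \<sigma>"] by auto
    then show ?thesis using assms(1) by (intro exI[of _ K]) (simp add: divide_simps)
  qed
  define K where "K = (LEAST K. l \<le> 4 ^ K * \<sigma>)"
  have K: "l \<le> 4 ^ K * \<sigma>" unfolding K_def by (rule LeastI_ex[OF ex])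
  have "4 ^ K * \<sigma> \<le> 4 * l"
  proof (cases K)
    case (Suc k)
    then have "\<not> l \<le> 4 ^ k * \<sigma>" using not_less_Least[of k "\<lambda>K. l \<le> 4 ^ K * \<sigma>"] unfolding K_def by simp
    then show ?thesis unfolding Suc by simp
  qed (use assms in simp)
  then show ?thesis using K by blast
qed

text \<open>Two paths to the root of length at most \<open>h\<close> join any two vertices, hence
  the factor 2 in the condition on \<open>A\<close>. For the lower bound the path of one vertex to
  \<open>r\<close> is enough.\<close>

lemma (in sparse_network) diameter_quenched:
  assumes \<sigma>: "0 < \<sigma>" "\<sigma> \<le> 1" and \<delta>: "0 < \<delta>" "\<delta> \<le> 1"
    and n1: "ln n \<ge> 1"
    and c1: "20 * sqrt n * ln n + D + B * D \<le> n / 2"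
    and c2: "80 * D * sqrt n * ln n \<le> n"
    and c3: "4 * ln n * (B * D + 4 * sqrt n * ln n) \<le> \<sigma> ^ 3 * n"
    and c4: "(4 * ln n)\<^sup>2 \<le> 2 * \<sigma> ^ 3 * sqrt n"
    and c5: "2 * D \<le> \<sigma> * sqrt n" and c6: "ln n \<le> ln (64 / \<delta>) * sqrt n" and c7: "1 / n \<le> \<delta>"
    and A: "A \<ge> 1" "A \<ge> 2 * (12 + 5 * ln (1 / \<delta>) + 16 * ln (64 / \<delta>) / \<sigma>)" "A \<le> sqrt n"
    and w: "\<And>u v. u \<in> V \<Longrightarrow> v \<in> V \<Longrightarrow> u \<noteq> v \<Longrightarrow> W u v = w {u, v}"
  shows "measure_pmf.prob (weighted_ust V (complete_edges V) w)
      {T. inverse A * sqrt n \<le> real (graph_diam V T) \<and> real (graph_diam V T) \<le> A * sqrt n}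
    \<ge> 1 - (324 * \<sigma>\<^sup>2 + 4 * \<delta> + 8 / A\<^sup>2)"
proof -
  interpret rooted_network V W r using root(1) by unfold_locales
  have n1': "n > 1"
  proof (rule ccontr)
    assume "\<not> n > 1"
    then have "ln n \<le> 0" using n_pos by simp
    then show False using n1 by simp
  qed
  have sn: "sqrt n \<ge> 1" using n1' by simp
  obtain K where K: "ln n \<le> 4 ^ K * \<sigma>" "4 ^ K * \<sigma> \<le> 4 * ln n"
    using exists_power4[of \<sigma> "ln n"] \<sigma> n1 by auto
  obtain h where h: "real h \<le> (12 + 5 * ln (1 / \<delta>) + 16 * ln (64 / \<delta>) / \<sigma>) * sqrt n"
    "mass {r} (\<lambda>f. \<exists>v\<in>V. (f ^^ h) v \<noteq> r) \<le> (324 * \<sigma>\<^sup>2 + 4 * \<delta>) * Z {r}"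
    using height_bound[OF \<sigma> \<delta> n1' K c1 c2 c3 c4 c5 c6 c7] by blast
  have hA: "2 * real h \<le> A * sqrt n"
  proof -
    have "2 * real h \<le> 2 * (12 + 5 * ln (1 / \<delta>) + 16 * ln (64 / \<delta>) / \<sigma>) * sqrt n"
      using mult_left_mono[OF h(1), of 2] by (simp only: mult.assoc)
    also have "\<dots> \<le> A * sqrt n" using A(2) sn by (intro mult_right_mono) auto
    finally show ?thesis .
  qed
  \<comment> \<open>From \<open>A \<le> sqrt n\<close> follows \<open>y \<ge> 1\<close>, so
    \<open>1 + L \<le> 2 * y\<close> and \<open>root_short_le\<close> gives
    \<open>4 * y * (2 * y) / n = 8 / A^2\<close>.\<close>
  define y where "y = inverse A * sqrt n"
  have y1: "y \<ge> 1" unfolding y_def using A by (simp add: field_simps)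
  have yn: "y \<le> sqrt n" unfolding y_def using A sn by (simp add: field_simps)
  define L where "L = nat \<lfloor>y\<rfloor>"
  have L: "real L \<le> y" unfolding L_def using y1 by simp
  have "\<exists>v\<in>V. v \<noteq> r"
  proof (rule ccontr)
    assume "\<not> ?thesis"
    then have "V = {r}" using root(1) by blast
    then show False using n1' by simp
  qed
  then obtain v where v: "v \<in> V" "v \<noteq> r" by blast
  have L2: "real (1 + L) \<le> 2 * sqrt n" using L y1 yn sn by simp
  have snl: "sqrt n * 1 \<le> sqrt n * ln n" using n1 by (intro mult_left_mono) auto
  have short: "mass {r} (\<lambda>f. (f ^^ L) v \<in> {r}) \<le> 8 / A\<^sup>2 * Z {r}"
  proof -
    have L3: "real (1 + L) \<le> 20 * sqrt n * ln n" using L2 snl sn by linarith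
    have "4 * D * real (1 + L) \<le> 4 * D * (20 * sqrt n * ln n)"
      using L3 D_nonneg by (intro mult_left_mono) auto
    then have "4 * D * real (1 + L) \<le> n" using c2 by (simp add: mult_ac)
    then have "mass {r} (\<lambda>f. (f ^^ L) v \<in> {r}) \<le> 4 * real L * real (1 + L) / n * Z {r}"
      using c1 L3 by (intro root_short_le[OF v]) linarith+
    also have "\<dots> \<le> 8 / A\<^sup>2 * Z {r}"
    proof (rule mult_right_mono)
      have "4 * real L * real (1 + L) \<le> 4 * y * (2 * y)"
        using L y1 by (intro mult_mono) auto
      also have "\<dots> = 8 / A\<^sup>2 * n"
        unfolding y_def using n_pos A by (simp add: field_simps power2_eq_square)
      finally show "4 * real L * real (1 + L) / n \<le> 8 / A\<^sup>2" using n_pos by (simp add: pos_divide_le_eq)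
    qed simp
    finally show ?thesis .
  qed
  have "mass {r} (\<lambda>f. \<not> (inverse A * sqrt n \<le> real (graph_diam V (edges f)) \<and> real (graph_diam V (edges f)) \<le> A * sqrt n))
    \<le> mass {r} (\<lambda>f. (\<exists>v\<in>V. (f ^^ h) v \<noteq> r) \<or> (f ^^ L) v \<in> {r})"
  proof (rule mass_mono)
    fix f assume f: "f \<in> forests {r}"
      and bad: "\<not> (inverse A * sqrt n \<le> real (graph_diam V (edges f)) \<and> real (graph_diam V (edges f)) \<le> A * sqrt n)"
    show "(\<exists>v\<in>V. (f ^^ h) v \<noteq> r) \<or> (f ^^ L) v \<in> {r}"
    proof (rule disjCI)
      assume "(f ^^ L) v \<notin> {r}"
      then have "\<not> graph_diam V (edges f) \<le> L" using edges_diam_ge[OF f v(1)] by auto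
      then have "inverse A * sqrt n \<le> real (graph_diam V (edges f))"
        unfolding L_def y_def[symmetric] using y1 by linarith
      then have "\<not> graph_diam V (edges f) \<le> 2 * h" using bad hA by linarith
      then show "\<exists>v\<in>V. (f ^^ h) v \<noteq> r" using edges_diam_le[OF f] by blast
    qed
  qed
  also have "\<dots> \<le> (324 * \<sigma>\<^sup>2 + 4 * \<delta> + 8 / A\<^sup>2) * Z {r}"
    using mass_disj[of "{r}" "\<lambda>f. \<exists>v\<in>V. (f ^^ h) v \<noteq> r" "\<lambda>f. (f ^^ L) v \<in> {r}"] h(2) short
    by (simp add: distrib_right)
  finally show ?thesis
    by (intro weighted_ust_prob[OF w]) (use \<delta> in auto)
qed

lemma eventually_small:
  fixes f :: "nat \<Rightarrow> real"
  shows "f \<longlonglongrightarrow> 0 \<Longrightarrow> c > 0 \<Longrightarrow> eventually (\<lambda>n. f n \<le> c) sequentially"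
  by (drule (1) order_tendstoD(2)) (auto elim: eventually_mono)

text \<open>Here \<open>\<gamma> < 0\<close> enters: with \<open>D = (ln n)^2\<close> the heavy
  terms divided by \<open>n\<close> are \<open>n powr \<gamma>\<close> times a power of
  \<open>ln n\<close>. This \<open>D\<close> is large enough for \<open>n * 2 powr (- D)\<close> to
  vanish and small against every power of \<open>n\<close>.\<close>

lemma eventually_conditions:
  fixes \<gamma> \<sigma> \<delta> t A e :: real
  assumes "\<gamma> < 0" "\<sigma> > 0" "\<delta> > 0" "t > 0" "e > 0"
  shows "eventually (\<lambda>n::nat. n \<ge> 2 \<and> ln n \<ge> 1 \<and>
    20 * sqrt n * ln n + (ln n)\<^sup>2 + n powr (1 + \<gamma>) * (ln n)\<^sup>2 \<le> n / 2 \<and>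
    80 * (ln n)\<^sup>2 * sqrt n * ln n \<le> n \<and>
    4 * ln n * (n powr (1 + \<gamma>) * (ln n)\<^sup>2 + 4 * sqrt n * ln n) \<le> \<sigma> ^ 3 * n \<and>
    (4 * ln n)\<^sup>2 \<le> 2 * \<sigma> ^ 3 * sqrt n \<and>
    2 * (ln n)\<^sup>2 \<le> \<sigma> * sqrt n \<and> ln n \<le> t * sqrt n \<and> 1 / n \<le> \<delta> \<and> A \<le> sqrt n \<and>
    3 * real n * 2 powr (- ((ln n)\<^sup>2)) + 3 / real n \<le> e) sequentially"
proof -
  have "(\<lambda>n::nat. n powr \<gamma> * (ln n)\<^sup>2) \<longlonglongrightarrow> 0" "(\<lambda>n::nat. n powr \<gamma> * (ln n) ^ 3) \<longlonglongrightarrow> 0"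
    using assms(1) by real_asymp+
  then have g: "eventually (\<lambda>n::nat. n powr \<gamma> * (ln n)\<^sup>2 \<le> 1 / 4) sequentially"
    "eventually (\<lambda>n::nat. n powr \<gamma> * (ln n) ^ 3 \<le> \<sigma> ^ 3 / 8) sequentially"
    using assms(2) by (auto intro!: eventually_small)
  have s: "\<sigma> ^ 3 > 0" using assms(2) by simp
  have "eventually (\<lambda>n::nat. ln n \<ge> 1) sequentially" by real_asymp
  then have 1: "eventually (\<lambda>n::nat. n \<ge> 2 \<and> ln n \<ge> 1) sequentially"
    using eventually_ge_at_top[of 2] by eventually_elim auto
  have 2: "eventually (\<lambda>n::nat. 20 * sqrt n * ln n + (ln n)\<^sup>2 \<le> n / 4) sequentially" by real_asymp
  have 3: "eventually (\<lambda>n::nat. 80 * (ln n)\<^sup>2 * sqrt n * ln n \<le> n) sequentially" by real_asymp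
  have 4: "eventually (\<lambda>n::nat. 4 * ln n * (4 * sqrt n * ln n) \<le> \<sigma> ^ 3 / 2 * n) sequentially" using s by real_asymp
  have 5: "eventually (\<lambda>n::nat. (4 * ln n)\<^sup>2 \<le> 2 * \<sigma> ^ 3 * sqrt n) sequentially" using s by real_asymp
  have 6: "eventually (\<lambda>n::nat. 2 * (ln n)\<^sup>2 \<le> \<sigma> * sqrt n) sequentially" using assms(2) by real_asymp
  have 7: "eventually (\<lambda>n::nat. ln n \<le> t * sqrt n) sequentially" using assms(4) by real_asymp
  have 8: "eventually (\<lambda>n::nat. 1 / n \<le> \<delta>) sequentially" using assms(3) by real_asymp
  have 9: "eventually (\<lambda>n::nat. A \<le> sqrt n) sequentially" by real_asymp
  have "(\<lambda>n::nat. 3 * real n * 2 powr (- ((ln n)\<^sup>2)) + 3 / real n) \<longlonglongrightarrow> 0" by real_asymp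
  then have 10: "eventually (\<lambda>n::nat. 3 * real n * 2 powr (- ((ln n)\<^sup>2)) + 3 / real n \<le> e) sequentially"
    using assms(5) by (rule eventually_small)
  show ?thesis
    using g 1 2 3 4 5 6 7 8 9 10
  proof eventually_elim
    case (elim n)
    have np: "real n powr (1 + \<gamma>) = n * n powr \<gamma>" using elim(3) by (simp add: powr_add)
    have a: "real n powr (1 + \<gamma>) * (ln n)\<^sup>2 \<le> n / 4"
      using mult_left_mono[OF elim(1), of "real n"] unfolding np by (simp add: mult_ac)
    have b: "4 * ln n * (real n powr (1 + \<gamma>) * (ln n)\<^sup>2) \<le> \<sigma> ^ 3 / 2 * n"
      using mult_left_mono[OF elim(2), of "4 * real n"] unfolding np
      by (simp add: mult_ac power2_eq_square power3_eq_cube)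
    have "4 * ln n * (n powr (1 + \<gamma>) * (ln n)\<^sup>2 + 4 * sqrt n * ln n) \<le> \<sigma> ^ 3 * n"
      using b elim(6) by (simp only: distrib_left)
    moreover have "20 * sqrt n * ln n + (ln n)\<^sup>2 + n powr (1 + \<gamma>) * (ln n)\<^sup>2 \<le> n / 2"
      using a elim(4) by linarith
    ultimately show ?case using elim by simp
  qed
qed

theorem proposition6p1:
  fixes \<epsilon> :: real
  assumes "\<epsilon> > 0"
  shows "\<exists>A::real. A > 0 \<and> (\<forall>\<gamma>::real. \<gamma> < 0 \<longrightarrow> (\<exists>n\<^sub>0::nat. \<forall>n\<ge>n\<^sub>0.
    measure_pmf.expectation (weights_pmf n \<gamma>)
      (\<lambda>w. measure_pmf.prob (K_ust n w)
        {T. inverse A * sqrt (real n) \<le> real (K_diam n T)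
            \<and> real (K_diam n T) \<le> A * sqrt (real n)})
    \<ge> 1 - \<epsilon>))"
proof -
  \<comment> \<open>The cap at 1 keeps \<open>\<sigma>\<close> and \<open>\<delta>\<close> at most 1
    and gives \<open>e * e \<le> e\<close>.\<close>
  define e where "e = min \<epsilon> 1"
  have e: "0 < e" "e \<le> 1" "e \<le> \<epsilon>" unfolding e_def using assms by auto
  \<comment> \<open>Chosen so that \<open>324 * \<sigma>^2 \<le> e / 10\<close> and
    \<open>4 * \<delta> = e / 10\<close>.\<close>
  define \<sigma> \<delta> where "\<sigma> = e / 60" and "\<delta> = e / 40"
  have \<sigma>: "0 < \<sigma>" "\<sigma> \<le> 1" and \<delta>: "0 < \<delta>" "\<delta> \<le> 1" unfolding \<sigma>_def \<delta>_def using e by auto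
  define t where "t = ln (64 / \<delta>)"
  have t: "t > 0" unfolding t_def using \<delta> by (intro ln_gt_zero) (simp add: divide_simps)
  define c where "c = 2 * (12 + 5 * ln (1 / \<delta>) + 16 * ln (64 / \<delta>) / \<sigma>)"
  have "ln (1 / \<delta>) \<ge> 0" using \<delta> by (intro ln_ge_zero) (simp add: divide_simps)
  then have c0: "c \<ge> 0" unfolding c_def t_def[symmetric] using t \<sigma> by simp
  \<comment> \<open>The first summand brings \<open>8 / A^2\<close> below \<open>e / 8\<close>; the
    second covers the height bound. Neither involves \<open>\<gamma>\<close>.\<close>
  define A where "A = 8 / e + c"
  have A8: "A \<ge> 8 / e" "A \<ge> c" unfolding A_def using c0 e by auto
  have "8 / e \<ge> 8" using e by (simp add: divide_simps)
  then have A1: "A \<ge> 1" using A8 by linarith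
  then have Ap: "A > 0" by linarith
  have fail: "324 * \<sigma>\<^sup>2 + 4 * \<delta> + 8 / A\<^sup>2 \<le> e / 2"
  proof -
    have ee: "e * e \<le> e" using e mult_left_le[of e e] by simp
    have "(8 / e)\<^sup>2 \<le> A\<^sup>2" using A8 e by (intro power_mono) auto
    then have "8 / A\<^sup>2 \<le> 8 / (8 / e)\<^sup>2" using e by (intro divide_left_mono) (auto intro!: mult_pos_pos zero_less_power simp: Ap)
    also have "\<dots> = e * e / 8" using e by (simp add: power2_eq_square)
    finally have "8 / A\<^sup>2 \<le> e / 8" using ee by simp
    moreover have "324 * \<sigma>\<^sup>2 \<le> e / 10" unfolding \<sigma>_def using ee e by (simp add: power2_eq_square)
    moreover have "4 * \<delta> = e / 10" unfolding \<delta>_def by simp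
    ultimately show ?thesis using e by linarith
  qed
  show ?thesis
  proof (intro exI[of _ A] conjI allI impI)
    show "A > 0" using A1 by simp
    fix \<gamma> :: real assume \<gamma>: "\<gamma> < 0"
    obtain n0 where n0: "\<forall>n\<ge>n0. n \<ge> 2 \<and> ln n \<ge> 1 \<and>
      20 * sqrt n * ln n + (ln n)\<^sup>2 + n powr (1 + \<gamma>) * (ln n)\<^sup>2 \<le> n / 2 \<and>
      80 * (ln n)\<^sup>2 * sqrt n * ln n \<le> n \<and>
      4 * ln n * (n powr (1 + \<gamma>) * (ln n)\<^sup>2 + 4 * sqrt n * ln n) \<le> \<sigma> ^ 3 * n \<and>
      (4 * ln n)\<^sup>2 \<le> 2 * \<sigma> ^ 3 * sqrt n \<and>
      2 * (ln n)\<^sup>2 \<le> \<sigma> * sqrt n \<and> ln n \<le> t * sqrt n \<and> 1 / n \<le> \<delta> \<and> A \<le> sqrt n \<and>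
      3 * real n * 2 powr (- ((ln n)\<^sup>2)) + 3 / real n \<le> e / 2"
      using eventually_conditions[OF \<gamma> \<sigma>(1) \<delta>(1) t, of "e / 2" A] e unfolding eventually_sequentially by auto
    show "\<exists>n\<^sub>0::nat. \<forall>n\<ge>n\<^sub>0.
      measure_pmf.expectation (weights_pmf n \<gamma>)
        (\<lambda>w. measure_pmf.prob (K_ust n w)
          {T. inverse A * sqrt (real n) \<le> real (K_diam n T)
              \<and> real (K_diam n T) \<le> A * sqrt (real n)})
      \<ge> 1 - \<epsilon>"
    proof (intro exI[of _ n0] allI impI)
      fix n assume "n \<ge> n0"
      note N = n0[rule_format, OF this]
      define B where "B = real n powr (1 + \<gamma>)"
      define D where "D = (ln (real n))\<^sup>2"
      define wt where "wt b e = (if e \<in> K_edges n then if b e then B else 1 else 0)" for b :: "nat set \<Rightarrow> bool" and e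
      let ?G = "{T. inverse A * sqrt (real n) \<le> real (K_diam n T) \<and> real (K_diam n T) \<le> A * sqrt (real n)}"
      have Bp: "B > 0" unfolding B_def using N by simp
      have quenched: "measure_pmf.prob (K_ust n (wt b)) ?G \<ge> 1 - e / 2" if b: "regular n D b" for b
      proof -
        obtain r where r: "r < n" "\<And>v. \<not> special n b r v" using b unfolding regular_def by blast
        define W where "W u v = (if u = v then 0 else if special n b u v then B else 1)" for u v :: nat
        interpret sparse_network "{..<n}" W "special n b" B D r
        proof
          show "W u v = W v u" for u v unfolding W_def special_def by (simp add: insert_commute)
          show "special n b u v = special n b v u" for u v unfolding special_def by (simp add: insert_commute)
        qed (use Bp r b in \<open>auto simp: W_def regular_def\<close>)
        have "measure_pmf.prob (K_ust n (wt b)) ?G \<ge> 1 - (324 * \<sigma>\<^sup>2 + 4 * \<delta> + 8 / A\<^sup>2)"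
        proof -
          have w: "W u v = wt b {u, v}" if "u \<in> {..<n}" "v \<in> {..<n}" "u \<noteq> v" for u v
            using that unfolding W_def wt_def special_def complete_edges_def by auto
          show ?thesis
            using diameter_quenched[OF \<sigma> \<delta>, of A "wt b"] N w A1 A8
            unfolding B_def D_def c_def t_def by simp
        qed
        then show ?thesis using fail by linarith
      qed
      \<comment> \<open>Half of the error is allotted to irregular environments and half to the tree
        in a regular one.\<close>
      have "1 - \<epsilon> \<le> (1 - e / 2) * (1 - e / 2)"

      proof -
        have "(1 - e / 2) * (1 - e / 2) = 1 - e + e * e / 4" by (simp add: algebra_simps)
        moreover have "e * e \<ge> 0" by simp
        ultimately show ?thesis using e(3) by linarith
      qed
      also have "\<dots> \<le> (1 - e / 2) * measure_pmf.prob (coins n) {b. regular n D b}"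
      proof (rule mult_left_mono)
        show "1 - e / 2 \<le> measure_pmf.prob (coins n) {b. regular n D b}"
          using prob_regular[of n D] N unfolding D_def by linarith
      qed (use e in simp)
      also have "\<dots> = measure_pmf.expectation (coins n) (\<lambda>b. (1 - e / 2) * indicator {b. regular n D b} b)"
        by simp
      \<comment> \<open>In an irregular environment the left integrand is 0.\<close>
      also have "\<dots> \<le> measure_pmf.expectation (coins n) (\<lambda>b. measure_pmf.prob (K_ust n (wt b)) ?G)"
        by (intro integral_mono) (use quenched in \<open>auto simp: indicator_def\<close>)
      also have "\<dots> = measure_pmf.expectation (weights_pmf n \<gamma>) (\<lambda>w. measure_pmf.prob (K_ust n w) ?G)"
        unfolding weights_pmf_coins wt_def[abs_def] B_def by (rule integral_map_pmf[symmetric])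
      finally show "1 - \<epsilon> \<le> measure_pmf.expectation (weights_pmf n \<gamma>) (\<lambda>w. measure_pmf.prob (K_ust n w) ?G)" .
    qed
  qed
qed

end
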